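(* Let $\mathcal{H}$ be a compact metric space with a minimal dynamical system $\theta$, let $X$ be a real Banach space, $A$ a sectorial operator on $X$ with compact resolvent, $0\le r<\infty$, $\alpha\in[0,1)$, $\mathcal{C}_\alpha=C([-r,0],X^\alpha)$, and let $F:\mathcal{H}\times\mathcal{C}_\alpha\to X$ be continuous with $$\|F(p,\phi)-F(p,\phi')\|_0\le L\|\phi-\phi'\|_{\mathcal{C}_\alpha},\qquad\forall\,\phi,\phi'\in\mathcal{C}_\alpha,\ p\in\mathcal{H},$$ for some $L>0$. Assume that $\operatorname{Re}z\ge\beta>0$ for all $z\in\sigma(A)$ and that $L<1/\big(\kappa_0M(1+M)\big)$, where $M\ge1$ is the constant described in the context and $$\kappa_0=\sup_{t\ge0}\int_0^t(t-s)^{-\alpha}e^{-\beta(t-s)}\,ds .$$ Then the equation $$\frac{du}{dt}+Au=F(\theta_tp,u_t),\qquad t\ge0,\ p\in\mathcal{H},$$ has a nonautonomous equilibrium solution $\Gamma\in C(\mathcal{H},X^\alpha)$ for which there exist $C,\lambda>0$ such that for all $(p,\phi)\in\mathcal{H}\times\mathcal{C}_\alpha$, with $u(t)=u(t;p,\phi)$, $$\|u(t)-\Gamma(\theta_tp)\|_\alpha\le Ce^{-\lambda t}\max_{s\in[-r,0]}\|\phi(s)-\Gamma(\theta_sp)\|_\alpha,\qquad t\ge0.$$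
   Context: Dynamical system on $\mathcal{H}$: a continuous map $\theta:\mathbb{R}\times\mathcal{H}\to\mathcal{H}$, written $\theta_tp=\theta(t,p)$, with $\theta_0p=p$ and $\theta_{s+t}p=\theta_s\theta_tp$. Minimal: $\theta$ has no proper nonempty compact invariant subset of $\mathcal{H}$. $\|\cdot\|_0$ is the norm of $X$. $X^s$ ($s\ge0$) is the fractional power space generated by $A$, with norm $\|u\|_s=\|\Lambda^su\|_0$, where $\Lambda=A+aI$ for a fixed $a$ such that $\operatorname{Re}\sigma(\Lambda)>0$. $\mathcal{C}_\alpha$ has the norm $\|\phi\|_{\mathcal{C}_\alpha}=\max_{s\in[-r,0]}\|\phi(s)\|_\alpha$. The lift of $u$ is $u_t(s)=u(t+s)$, $s\in[-r,0]$. $M\ge1$ is a constant such that, in operator norm on $X$, $$\|\Lambda^\alpha e^{-At}\Lambda^{-\alpha}\|\le Me^{-\beta t},\qquad\|\Lambda^\alpha e^{-At}\|\le Mt^{-\alpha}e^{-\beta t}\qquad(t>0).$$ For $p\in\mathcal{H}$, $\phi\in\mathcal{C}_\alpha$, $u(t;p,\phi)$ denotes the unique global mild solution pertaining to $p$: the continuous $u:[-r,\infty)\to X^\alpha$ with $u=\phi$ on $[-r,0]$ and $u(t)=e^{-At}\phi(0)+\int_0^te^{-A(t-s)}F(\theta_sp,u_s)\,ds$, $t\ge0$. A complete solution pertaining to $p$ is a continuous $\gamma:\mathbb{R}\to X^\alpha$ with $\gamma(t)=e^{-A(t-\tau)}\gamma(\tau)+\int_\tau^te^{-A(t-s)}F(\theta_sp,\gamma_s)\,ds$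 for all $t\ge\tau$; it is bounded if $\sup_{t\in\mathbb{R}}\|\gamma(t)\|_\alpha<\infty$. A nonautonomous equilibrium solution is a map $\Gamma\in C(\mathcal{H},X^\alpha)$ such that $\gamma_p(t):=\Gamma(\theta_tp)$ is a bounded complete solution pertaining to $p$, for each $p\in\mathcal{H}$. *)

theory Defs
  imports "HOL-Analysis.Analysis"
begin

section \<open>Sectorial operators on a real Banach space\<close>

text \<open>
  An unbounded operator is given by its domain D and a function A whose values off D are
  irrelevant.  Spectral notions refer to the complexification of the real space, realised on
  pairs (x, y) standing for x + i y.  The product norm on pairs is equivalent to the usual
  complexification norms; resolvent sets, sectoriality and compactness of the resolvent do not
  depend on the choice among equivalent norms.
\<close>

definition linear_operator :: "'x::real_vector set \<Rightarrow> ('x \<Rightarrow> 'x) \<Rightarrow> bool" where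
  "linear_operator D A \<longleftrightarrow>
     subspace D \<and>
     (\<forall>x\<in>D. \<forall>y\<in>D. A (x + y) = A x + A y) \<and>
     (\<forall>c. \<forall>x\<in>D. A (c *\<^sub>R x) = c *\<^sub>R A x)"

text \<open>The operator z I - A on the complexification.\<close>

definition cshift :: "('x::real_vector \<Rightarrow> 'x) \<Rightarrow> complex \<Rightarrow> 'x \<times> 'x \<Rightarrow> 'x \<times> 'x" where
  "cshift A z = (\<lambda>(x, y). (Re z *\<^sub>R x - Im z *\<^sub>R y - A x, Im z *\<^sub>R x + Re z *\<^sub>R y - A y))"

definition resolvent :: "'x::real_vector set \<Rightarrow> ('x \<Rightarrow> 'x) \<Rightarrow> complex \<Rightarrow> 'x \<times> 'x \<Rightarrow> 'x \<times> 'x" where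
  "resolvent D A z = inv_into (D \<times> D) (cshift A z)"

definition resolvent_set :: "'x::real_normed_vector set \<Rightarrow> ('x \<Rightarrow> 'x) \<Rightarrow> complex set" where
  "resolvent_set D A =
     {z. bij_betw (cshift A z) (D \<times> D) UNIV \<and> bounded_linear (resolvent D A z)}"

definition spectrum :: "'x::real_normed_vector set \<Rightarrow> ('x \<Rightarrow> 'x) \<Rightarrow> complex set" where
  "spectrum D A = - resolvent_set D A"

definition sectorial :: "'x::real_normed_vector set \<Rightarrow> ('x \<Rightarrow> 'x) \<Rightarrow> bool" where
  "sectorial D A \<longleftrightarrow>
     linear_operator D A \<and>
     closure D = UNIV \<and>
     closed ((\<lambda>x. (x, A x)) ` D) \<and>
     (\<exists>\<phi> K b. 0 < \<phi> \<and> \<phi> < pi / 2 \<and> 1 \<le> K \<and>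
        (\<forall>z. z \<noteq> complex_of_real b \<and> \<phi> \<le> \<bar>Arg (z - complex_of_real b)\<bar> \<longrightarrow>
           z \<in> resolvent_set D A \<and>
           onorm (resolvent D A z) \<le> K / cmod (z - complex_of_real b)))"

definition compact_resolvent :: "'x::real_normed_vector set \<Rightarrow> ('x \<Rightarrow> 'x) \<Rightarrow> bool" where
  "compact_resolvent D A \<longleftrightarrow>
     (\<exists>z\<in>resolvent_set D A. compact (closure (resolvent D A z ` cball 0 1)))"

text \<open>
  T t is exp (- t A) for t \<open>\<ge>\<close> 0: T is the strongly continuous semigroup whose infinitesimal
  generator, with its exact domain, is - A.  The generator determines T t for t \<open>\<ge>\<close> 0 uniquely;
  values at negative t are unconstrained.
\<close>

definition is_exp_semigroup ::
  "'x::real_normed_vector set \<Rightarrow> ('x \<Rightarrow> 'x) \<Rightarrow> (real \<Rightarrow> 'x \<Rightarrow> 'x) \<Rightarrow> bool" where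
  "is_exp_semigroup D A T \<longleftrightarrow>
     (\<forall>t\<ge>0. bounded_linear (T t)) \<and>
     (\<forall>x. T 0 x = x) \<and>
     (\<forall>s\<ge>0. \<forall>t\<ge>0. \<forall>x. T (s + t) x = T s (T t x)) \<and>
     (\<forall>x. continuous_on {0..} (\<lambda>t. T t x)) \<and>
     (\<forall>x y. ((\<lambda>h. (T h x - x) /\<^sub>R h) \<longlongrightarrow> - y) (at_right 0) \<longleftrightarrow> x \<in> D \<and> y = A x)"

section \<open>Fractional power spaces\<close>

text \<open>
  The negative power of order \<open>\<alpha>\<close> in [0,1) of a sectorial operator \<open>\<Lambda>\<close> with spectrum in the
  open right half plane, given for \<open>\<alpha>\<close> > 0 by Balakrishnan's integral
  \<open>(sin \<pi>\<alpha> / \<pi>) \<integral> s\<^sup>-\<^sup>\<alpha> (s + \<Lambda>)\<^sup>-\<^sup>1 x ds\<close> over s > 0.  It is injective; the power of order \<open>\<alpha>\<close> is its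
  inverse, with domain its range.
\<close>

definition neg_power :: "'x::real_normed_vector set \<Rightarrow> ('x \<Rightarrow> 'x) \<Rightarrow> real \<Rightarrow> 'x \<Rightarrow> 'x" where
  "neg_power D \<Lambda> \<alpha> x =
     (if \<alpha> = 0 then x
      else (sin (pi * \<alpha>) / pi) *\<^sub>R
             integral {0<..} (\<lambda>s. s powr (- \<alpha>) *\<^sub>R inv_into D (\<lambda>y. s *\<^sub>R y + \<Lambda> y) x))"

definition frac_space :: "'x::real_normed_vector set \<Rightarrow> ('x \<Rightarrow> 'x) \<Rightarrow> real \<Rightarrow> 'x set" where
  "frac_space D \<Lambda> \<alpha> = range (neg_power D \<Lambda> \<alpha>)"

definition frac_power :: "'x::real_normed_vector set \<Rightarrow> ('x \<Rightarrow> 'x) \<Rightarrow> real \<Rightarrow> 'x \<Rightarrow> 'x" where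
  "frac_power D \<Lambda> \<alpha> = inv (neg_power D \<Lambda> \<alpha>)"

definition frac_norm :: "'x::real_normed_vector set \<Rightarrow> ('x \<Rightarrow> 'x) \<Rightarrow> real \<Rightarrow> 'x \<Rightarrow> real" where
  "frac_norm D \<Lambda> \<alpha> u = norm (frac_power D \<Lambda> \<alpha> u)"

text \<open>Continuity of u on S as a map into the fractional power space with its own norm.\<close>

definition frac_continuous_on ::
  "'x::real_normed_vector set \<Rightarrow> ('x \<Rightarrow> 'x) \<Rightarrow> real \<Rightarrow> 't::topological_space set \<Rightarrow> ('t \<Rightarrow> 'x) \<Rightarrow> bool"
  where
  "frac_continuous_on D \<Lambda> \<alpha> S u \<longleftrightarrow>
     (\<forall>s\<in>S. u s \<in> frac_space D \<Lambda> \<alpha>) \<and>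
     (\<forall>s\<in>S. ((\<lambda>t. frac_norm D \<Lambda> \<alpha> (u t - u s)) \<longlongrightarrow> 0) (at s within S))"

text \<open>
  The space of continuous maps from [-r,0] into the fractional power space; its elements are
  functions on the whole line taking the default value off [-r,0].
\<close>

definition hist_space ::
  "real \<Rightarrow> 'x::real_normed_vector set \<Rightarrow> ('x \<Rightarrow> 'x) \<Rightarrow> real \<Rightarrow> (real \<Rightarrow> 'x) set" where
  "hist_space r D \<Lambda> \<alpha> = {\<phi> \<in> extensional {-r..0}. frac_continuous_on D \<Lambda> \<alpha> {-r..0} \<phi>}"

definition hist_norm ::
  "real \<Rightarrow> 'x::real_normed_vector set \<Rightarrow> ('x \<Rightarrow> 'x) \<Rightarrow> real \<Rightarrow> (real \<Rightarrow> 'x) \<Rightarrow> real" where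
  "hist_norm r D \<Lambda> \<alpha> \<phi> = (SUP s\<in>{-r..0}. frac_norm D \<Lambda> \<alpha> (\<phi> s))"

definition lift :: "real \<Rightarrow> (real \<Rightarrow> 'x) \<Rightarrow> real \<Rightarrow> (real \<Rightarrow> 'x)" where
  "lift r u t = (\<lambda>s\<in>{-r..0}. u (t + s))"

text \<open>Joint continuity on the product of the base space and the history space.\<close>

definition hist_continuous ::
  "real \<Rightarrow> 'x::real_normed_vector set \<Rightarrow> ('x \<Rightarrow> 'x) \<Rightarrow> real \<Rightarrow>
   ('h::metric_space \<Rightarrow> (real \<Rightarrow> 'x) \<Rightarrow> 'x) \<Rightarrow> bool" where
  "hist_continuous r D \<Lambda> \<alpha> F \<longleftrightarrow>
     (\<forall>p. \<forall>\<phi>\<in>hist_space r D \<Lambda> \<alpha>. \<forall>\<epsilon>>0. \<exists>\<delta>>0. \<forall>q. \<forall>\<psi>\<in>hist_space r D \<Lambda> \<alpha>.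
        dist q p < \<delta> \<and> hist_norm r D \<Lambda> \<alpha> (\<lambda>s. \<psi> s - \<phi> s) < \<delta> \<longrightarrow> dist (F q \<psi>) (F p \<phi>) < \<epsilon>)"

section \<open>Dynamical systems on the base space\<close>

definition dynamical_system :: "(real \<Rightarrow> 'h::topological_space \<Rightarrow> 'h) \<Rightarrow> bool" where
  "dynamical_system \<theta> \<longleftrightarrow>
     continuous_on UNIV (\<lambda>(t, p). \<theta> t p) \<and>
     (\<forall>p. \<theta> 0 p = p) \<and>
     (\<forall>s t p. \<theta> (s + t) p = \<theta> s (\<theta> t p))"

definition minimal_system :: "(real \<Rightarrow> 'h::topological_space \<Rightarrow> 'h) \<Rightarrow> bool" where
  "minimal_system \<theta> \<longleftrightarrow>
     (\<forall>K. compact K \<and> K \<noteq> {} \<and> (\<forall>t. \<theta> t ` K = K) \<longrightarrow> K = UNIV)"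

section \<open>Solutions\<close>

text \<open>
  The integrands below are continuous for the norm of the ambient space, so the integrals are
  ordinary integrals there.  Below, D is the domain of A and of \<open>\<Lambda>\<close>, and T is exp (- t A).
\<close>

definition mild_solution ::
  "real \<Rightarrow> 'x::banach set \<Rightarrow> ('x \<Rightarrow> 'x) \<Rightarrow> real \<Rightarrow> (real \<Rightarrow> 'x \<Rightarrow> 'x) \<Rightarrow> (real \<Rightarrow> 'h \<Rightarrow> 'h) \<Rightarrow>
   ('h \<Rightarrow> (real \<Rightarrow> 'x) \<Rightarrow> 'x) \<Rightarrow> 'h \<Rightarrow> (real \<Rightarrow> 'x) \<Rightarrow> (real \<Rightarrow> 'x) \<Rightarrow> bool" where
  "mild_solution r D \<Lambda> \<alpha> T \<theta> F p \<phi> u \<longleftrightarrow>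
     frac_continuous_on D \<Lambda> \<alpha> {-r..} u \<and>
     (\<forall>s\<in>{-r..0}. u s = \<phi> s) \<and>
     (\<forall>t\<ge>0. u t = T t (\<phi> 0) + integral {0..t} (\<lambda>s. T (t - s) (F (\<theta> s p) (lift r u s))))"

definition complete_solution ::
  "real \<Rightarrow> 'x::banach set \<Rightarrow> ('x \<Rightarrow> 'x) \<Rightarrow> real \<Rightarrow> (real \<Rightarrow> 'x \<Rightarrow> 'x) \<Rightarrow> (real \<Rightarrow> 'h \<Rightarrow> 'h) \<Rightarrow>
   ('h \<Rightarrow> (real \<Rightarrow> 'x) \<Rightarrow> 'x) \<Rightarrow> 'h \<Rightarrow> (real \<Rightarrow> 'x) \<Rightarrow> bool" where
  "complete_solution r D \<Lambda> \<alpha> T \<theta> F p \<gamma> \<longleftrightarrow>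
     frac_continuous_on D \<Lambda> \<alpha> UNIV \<gamma> \<and>
     (\<forall>\<tau> t. \<tau> \<le> t \<longrightarrow>
        \<gamma> t = T (t - \<tau>) (\<gamma> \<tau>) + integral {\<tau>..t} (\<lambda>s. T (t - s) (F (\<theta> s p) (lift r \<gamma> s))))"

definition equilibrium_solution ::
  "real \<Rightarrow> 'x::banach set \<Rightarrow> ('x \<Rightarrow> 'x) \<Rightarrow> real \<Rightarrow> (real \<Rightarrow> 'x \<Rightarrow> 'x) \<Rightarrow>
   (real \<Rightarrow> 'h::topological_space \<Rightarrow> 'h) \<Rightarrow> ('h \<Rightarrow> (real \<Rightarrow> 'x) \<Rightarrow> 'x) \<Rightarrow> ('h \<Rightarrow> 'x) \<Rightarrow> bool" where
  "equilibrium_solution r D \<Lambda> \<alpha> T \<theta> F \<Gamma> \<longleftrightarrow>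
     frac_continuous_on D \<Lambda> \<alpha> UNIV \<Gamma> \<and>
     (\<forall>p. complete_solution r D \<Lambda> \<alpha> T \<theta> F p (\<lambda>t. \<Gamma> (\<theta> t p)) \<and>
          (\<exists>B. \<forall>t. frac_norm D \<Lambda> \<alpha> (\<Gamma> (\<theta> t p)) \<le> B))"

section \<open>Constants\<close>

text \<open>
  The two operator norm bounds with constant M; that the composed operators are defined on the
  whole space is part of the meaning of the bounds.
\<close>

definition semigroup_bounds ::
  "'x::real_normed_vector set \<Rightarrow> ('x \<Rightarrow> 'x) \<Rightarrow> real \<Rightarrow> (real \<Rightarrow> 'x \<Rightarrow> 'x) \<Rightarrow> real \<Rightarrow> real \<Rightarrow> bool" where
  "semigroup_bounds D \<Lambda> \<alpha> T \<beta> M \<longleftrightarrow>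
     (\<forall>t>0. \<forall>x. T t x \<in> frac_space D \<Lambda> \<alpha> \<and>
        norm (frac_power D \<Lambda> \<alpha> (T t (neg_power D \<Lambda> \<alpha> x))) \<le> M * exp (- \<beta> * t) * norm x \<and>
        norm (frac_power D \<Lambda> \<alpha> (T t x)) \<le> M * t powr (- \<alpha>) * exp (- \<beta> * t) * norm x)"

definition kappa0 :: "real \<Rightarrow> real \<Rightarrow> real" where
  "kappa0 \<alpha> \<beta> =
     (SUP t\<in>{0..}. integral {0..t} (\<lambda>s. (t - s) powr (- \<alpha>) * exp (- \<beta> * (t - s))))"

end

theory Submission
  imports Defs
begin

text \<open>
  In the coordinates \<open>u = R v\<close> with \<open>R = \<Lambda>\<^sup>-\<^sup>\<alpha>\<close> the fractional space becomes the ambient space and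
  \<open>S t = R\<^sup>-\<^sup>1 T t\<close> is a convolution kernel of norm at most \<open>M t\<^sup>-\<^sup>\<alpha> e\<^sup>-\<^sup>\<beta>\<^sup>t\<close>.  A bounded complete solution along
  an orbit must be \<open>t \<mapsto> \<integral> S s (F (\<theta> (t - s) p) \<dots>) ds\<close> over \<open>s > 0\<close>, so the equilibrium is the fixed point
  of a map on the continuous functions on the compact base; its Lipschitz constant is at most \<open>M L \<kappa>\<^sub>0 < 1\<close>.
  For stability, a weight \<open>e\<^sup>\<omega>\<^sup>t\<close> with small \<open>\<omega>\<close> keeps \<open>M L e\<^sup>\<omega>\<^sup>r \<kappa>(\<beta> - \<omega>)\<close> below 1, and the maximum of the
  weighted distance to the equilibrium on \<open>[-r, t]\<close> is estimated by the variation of constants formula.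

  The injectivity of \<open>R\<close> has to be proved.  If \<open>\<integral> s\<^sup>-\<^sup>\<alpha> J s x ds = 0\<close>, where \<open>J s\<close> is the inverse of
  \<open>s + \<Lambda>\<close>, then applying \<open>J \<mu>\<close>, substituting \<open>s = \<mu> v\<close> and integrating over \<open>\<mu>\<close> gives
  \<open>\<integral> v\<^sup>-\<^sup>\<alpha> (\<integral> J \<mu> (J (\<mu> v) x) d\<mu>) dv = 0\<close>.  By the resolvent identity the inner integral is a Frullani
  integral with value \<open>(ln v / (v - 1)) J 0 x\<close>, and that kernel is positive; so \<open>J 0 x = 0\<close>.
\<close>

text \<open>Injectivity of \<open>R\<close> matters because the fractional power is the HOL inverse
  \<open>inv\<close> of the negative power: only for an injective \<open>R\<close> does
  \<open>inv R\<close> recover the coordinate, so that the fractional norm of \<open>R v\<close> is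
  the norm of \<open>v\<close>. In its proof the integrations over \<open>\<mu>\<close> and
  \<open>v\<close> are interchanged on rectangles \<open>m \<le> \<mu> \<le> l\<close>,
  \<open>1 / N \<le> v \<le> N\<close> only, where the integrand is continuous. The errors left by
  the truncation of \<open>\<mu>\<close> are powers \<open>m powr e\<close> and
  \<open>l powr (- e)\<close> times a function of \<open>v\<close> that stays integrable on the half
  line if \<open>e\<close> is small compared with \<open>\<alpha>\<close> and
  \<open>1 - \<alpha>\<close>. Since \<open>T\<close> is only strongly continuous and
  \<open>S\<close> is singular at \<open>0\<close>, each improper integral is controlled by a scalar
  dominator and approximated on compact intervals, uniformly over all integrands below that
  dominator. In the contraction constant, \<open>M\<close> comes from the smoothing bound,
  \<open>L\<close> from the nonlinearity and the last factor from the mass of the kernel. The factor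
  \<open>exp (\<omega> * r)\<close> is the price of the delay: a history reaches back by at most
  \<open>r\<close>, and the weight changes by at most this factor on the way.\<close>

section \<open>Dominated improper integrals in Banach spaces\<close>

text \<open>
  No measurability is available for values in a nonseparable space.  The primitive of f inherits
  uniform continuity from that of g, so it extends to the singular endpoint, and the fundamental
  theorem of calculus gives integrability.
\<close>

lemma dominated_integrable_Icc:
  fixes f :: "real \<Rightarrow> 'a::banach"
  assumes "0 < b" and f: "continuous_on {0<..b} f"
    and fg: "\<And>s. 0 < s \<Longrightarrow> s \<le> b \<Longrightarrow> norm (f s) \<le> g s" and g: "g integrable_on {0..b}"
  shows "f integrable_on {0..b}"
proof -
  \<comment> \<open>The primitive starts at the regular endpoint \<open>b\<close>, because
    integrability of \<open>f\<close> down to \<open>0\<close> is still open.\<close>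
  define \<Psi> where "\<Psi> x = - integral {x..b} f" for x
  define G where "G x = - integral {x..b} g" for x
  have fi: "f integrable_on {x..y}" if "0 < x" "y \<le> b" for x y
    by (rule integrable_continuous_real) (rule continuous_on_subset[OF f], use that in auto)
  have gi: "g integrable_on {x..y}" if "0 \<le> x" "y \<le> b" for x y
    by (rule integrable_on_subinterval[OF g]) (use that in auto)
  have le: "norm (\<Psi> y - \<Psi> x) \<le> G y - G x" if "0 < x" "x \<le> y" "y \<le> b" for x y
  proof -
    have "\<Psi> y - \<Psi> x = integral {x..y} f"
      using Henstock_Kurzweil_Integration.integral_combine[of x y b f] fi[of x b] that unfolding \<Psi>_def by (simp add: algebra_simps)
    moreover have "G y - G x = integral {x..y} g"
      using Henstock_Kurzweil_Integration.integral_combine[of x y b g] gi[of x b] that unfolding G_def by (simp add: algebra_simps)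
    moreover have "norm (integral {x..y} f) \<le> integral {x..y} g"
      by (rule integral_norm_bound_integral) (use that fi gi fg in auto)
    ultimately show ?thesis by simp
  qed
  have "uniformly_continuous_on {0..b} G"
    unfolding G_def
    by (intro compact_uniformly_continuous continuous_on_minus indefinite_integral_continuous_1' g) auto
  then have "uniformly_continuous_on {0<..b} \<Psi>"
    unfolding uniformly_continuous_on_def
  proof (elim all_forward imp_forward ex_forward conj_forward)
    fix e d :: real
    assume *: "\<forall>x\<in>{0..b}. \<forall>x'\<in>{0..b}. dist x' x < d \<longrightarrow> dist (G x') (G x) < e"
    have "dist (\<Psi> x') (\<Psi> x) < e" if "x \<in> {0<..b}" "x' \<in> {0<..b}" "dist x' x < d" for x x'
    proof -
      have "norm (\<Psi> x' - \<Psi> x) \<le> \<bar>G x' - G x\<bar>"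
        using le[of x x'] le[of x' x] that by (cases "x \<le> x'") (auto simp: norm_minus_commute)
      moreover have "dist (G x') (G x) < e" using * that by auto
      ultimately show ?thesis by (simp add: dist_norm)
    qed
    then show "\<forall>x\<in>{0<..b}. \<forall>x'\<in>{0<..b}. dist x' x < d \<longrightarrow> dist (\<Psi> x') (\<Psi> x) < e" by blast
  qed auto
  then obtain \<Phi> where \<Phi>: "uniformly_continuous_on (closure {0<..b}) \<Phi>" "\<And>x. x \<in> {0<..b} \<Longrightarrow> \<Psi> x = \<Phi> x"
    by (rule uniformly_continuous_on_extension_on_closure) blast
  have "(f has_integral (\<Phi> b - \<Phi> 0)) {0..b}"
  proof (rule fundamental_theorem_of_calculus_interior)
    show "continuous_on {0..b} \<Phi>"
      using \<Phi>(1) \<open>0 < b\<close> by (simp add: uniformly_continuous_imp_continuous)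
    fix x assume x: "x \<in> {0<..<b}"
    have "((\<lambda>u. integral {u..b} f) has_vector_derivative - f x) (at x within {x/2..b})"
      by (rule integral_has_vector_derivative') (use x in \<open>auto intro!: continuous_on_subset[OF f]\<close>)
    then have "(\<Psi> has_vector_derivative f x) (at x within {x/2..b})"
      unfolding \<Psi>_def using has_vector_derivative_minus by fastforce
    then have "(\<Psi> has_vector_derivative f x) (at x within {x/2<..<b})"
      by (rule has_vector_derivative_within_subset) auto
    then have "(\<Psi> has_vector_derivative f x) (at x)"
      using x by (subst (asm) at_within_open) auto
    then show "(\<Phi> has_vector_derivative f x) (at x)"
      by (rule has_vector_derivative_transform_within_open[where S="{0<..<b}"]) (use x \<Phi>(2) in auto)
  qed (use \<open>0 < b\<close> in auto)
  then show ?thesis by blast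
qed

text \<open>Extended by zero, \<open>f\<close> is integrable on every bounded interval by the
  preceding lemma; together with an integrable dominator this suffices on the half line.\<close>

lemma dominated_integrable_Ioi:
  fixes f :: "real \<Rightarrow> 'a::banach"
  assumes f: "continuous_on {0<..} f"
    and fg: "\<And>s. 0 < s \<Longrightarrow> norm (f s) \<le> g s" and g: "g integrable_on {0<..}"
  shows "f integrable_on {0<..}"
proof (rule integrable_on_all_intervals_integrable_bound[OF _ _ g])
  show "(\<lambda>x. if x \<in> {0<..} then f x else 0) integrable_on cbox a b" for a b
  proof (cases "0 < b")
    case True
    have "(\<lambda>x. if x \<in> {0<..} then f x else 0) integrable_on {0..b}"
    proof (rule dominated_integrable_Icc[OF True])
      show "continuous_on {0<..b} (\<lambda>x. if x \<in> {0<..} then f x else 0)"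
        by (rule continuous_on_eq[OF continuous_on_subset[OF f]]) auto
      show "(\<lambda>x. if x \<in> {0<..} then g x else 0) integrable_on {0..b}"
        using integrable_altD(1)[OF g, of 0 b] by (simp add: box_real)
    qed (use fg in auto)
    moreover have "(\<lambda>x. if x \<in> {0<..} then f x else 0) integrable_on {min a 0..0}"
      by (rule integrable_eq[OF integrable_0]) auto
    ultimately have "(\<lambda>x. if x \<in> {0<..} then f x else 0) integrable_on {min a 0..b}"
      using True by (intro Henstock_Kurzweil_Integration.integrable_combine[of "min a 0" 0 b]) auto
    then show ?thesis
      unfolding box_real by (rule integrable_on_subinterval) auto
  next
    case False
    then show ?thesis
      by (intro integrable_eq[OF integrable_0]) auto
  qed
qed (use fg in auto)

lemma norm_integral_Ioi_le:
  fixes f :: "real \<Rightarrow> 'a::banach"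
  assumes f: "continuous_on {0<..} f"
    and fg: "\<And>s. 0 < s \<Longrightarrow> norm (f s) \<le> g s" and g: "(g has_integral I) {0<..}"
  shows "norm (integral {0<..} f) \<le> I"
proof -
  have "f integrable_on {0<..}" using dominated_integrable_Ioi[OF f fg] g by blast
  from integral_norm_bound_integral[OF this has_integral_integrable[OF g]] fg show ?thesis
    using g by (auto simp: integral_unique)
qed

text \<open>Both ends are cut off, the singularity at \<open>0\<close> and the tail at infinity.
  Dominated convergence is applied to the scalar dominator; vector integrals are later compared with
  it in norm.\<close>

lemma tail_integral_tendsto_0:
  fixes g :: "real \<Rightarrow> real"
  assumes g: "g integrable_on {0<..}" and pos: "\<And>s. 0 < s \<Longrightarrow> 0 \<le> g s"
  shows "(\<lambda>n. integral {0<..} (\<lambda>s. if s \<in> {1 / Suc n..Suc n} then 0 else g s)) \<longlonglongrightarrow> 0"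
    (is "(\<lambda>n. integral _ (?h n)) \<longlonglongrightarrow> 0")
    and "(\<lambda>s. if s \<in> {1 / Suc n..Suc n} then 0 else g s) integrable_on {0<..}"
proof -
  have sub: "{1 / real (Suc n)..real (Suc n)} \<subseteq> {0<..}" for n
    by (auto intro: less_le_trans[rotated])
  show hi: "?h n integrable_on {0<..}" for n
  proof -
    have "g integrable_on {1 / real (Suc n)..real (Suc n)}"
      using integrable_on_subinterval[OF g sub] .
    then have "(\<lambda>s. if s \<in> {1 / real (Suc n)..real (Suc n)} then g s else 0) integrable_on {0<..}"
      using sub[of n] by (subst integrable_restrict_Int) (simp add: Int_absorb2)
    from integrable_diff[OF g this] show ?thesis
      by (rule integrable_eq) auto
  qed
  have lim: "(\<lambda>n. ?h n s) \<longlonglongrightarrow> 0" if s: "s \<in> {0<..}" for s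
  proof -
    obtain N where N: "real (Suc N) > max s (1/s)" using reals_Archimedean2 by (meson less_trans of_nat_less_iff lessI)
    have "?h n s = 0" if "n \<ge> N" for n
    proof -
      have "real (Suc n) \<ge> real (Suc N)" using that by simp
      with N have 1: "real (Suc n) > s" "real (Suc n) > 1/s" by linarith+
      have "1 / real (Suc n) < s" using 1(2) s by (simp add: field_simps)
      with 1 show ?thesis by simp
    qed
    then show ?thesis
      by (intro tendsto_eventually eventually_sequentiallyI[of N])
  qed
  have "(\<lambda>n. integral {0<..} (?h n)) \<longlonglongrightarrow> integral {0<..} (\<lambda>_::real. 0::real)"
    by (rule dominated_convergence(2)[of ?h "{0<..}" g "\<lambda>_. 0", OF hi g _ lim]) (use pos in auto)
  then show "(\<lambda>n. integral {0<..} (?h n)) \<longlonglongrightarrow> 0" by simp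
qed

text \<open>Common shape of the dominators, up to a constant factor: one power integrable at
  \<open>0\<close>, another at infinity. Balakrishnan's integral, the exponential kernel and the
  error term of the injectivity proof all use it.\<close>

lemma integrable_two_powers:
  fixes a b :: real
  assumes "- 1 < a" "b < - 1"
  shows "(\<lambda>v. if v < 1 then v powr a else v powr b) integrable_on {0<..}"
proof -
  have "(\<lambda>v. v powr a) integrable_on {0..1}"
    using has_integral_powr_from_0[of a 1] assms by auto
  then have 1: "(\<lambda>v. if v < 1 then v powr a else v powr b) integrable_on {0..1}"
    by (rule integrable_spike[where S="{1}"]) auto
  have "(\<lambda>v. v powr b) integrable_on {1..}"
    using has_integral_powr_to_inf[of b 1] assms by auto
  then have 2: "(\<lambda>v. if v < 1 then v powr a else v powr b) integrable_on {1..}"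
    by (rule integrable_eq) auto
  have "(\<lambda>v. if v < 1 then v powr a else v powr b) integrable_on ({0..1} \<union> {1..})"
    by (rule integrable_Un[OF _ 1 2]) (auto intro: negligible_subset[of "{1}"])
  then show ?thesis
    by (rule integrable_spike_set) (rule negligible_subset[of "{0}"]; auto)+
qed

text \<open>The error is at most the integral of \<open>g\<close> over the removed ends, so
  \<open>n\<close> depends on \<open>g\<close> and \<open>e\<close> alone. Uniformity in
  \<open>f\<close> serves integrals with parameters; uniformity in \<open>a\<close> and
  \<open>b\<close> serves the rescaled truncations in the injectivity proof.\<close>

lemma integral_Icc_uniform_limit_Ioi:
  fixes g :: "real \<Rightarrow> real"
  assumes g: "g integrable_on {0<..}" and pos: "\<And>s. 0 < s \<Longrightarrow> 0 \<le> g s" and "0 < e"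
  obtains n :: real where "0 < n"
    "\<And>a b (f :: real \<Rightarrow> 'a::banach). 0 < a \<Longrightarrow> a \<le> 1 / n \<Longrightarrow> n \<le> b \<Longrightarrow> continuous_on {0<..} f \<Longrightarrow>
       (\<And>s. 0 < s \<Longrightarrow> norm (f s) \<le> g s) \<Longrightarrow> norm (integral {a..b} f - integral {0<..} f) < e"
proof -
  let ?h = "\<lambda>n s. if s \<in> {1 / Suc n..Suc n} then 0 else g s"
  have "\<forall>\<^sub>F n in sequentially. integral {0<..} (?h n) < e"
    using tail_integral_tendsto_0(1)[OF g pos] \<open>e > 0\<close> order_tendstoD(2) by blast
  then obtain n where n: "integral {0<..} (?h n) < e"
    by (auto simp: eventually_sequentially)
  show ?thesis
  proof
    show "0 < real (Suc n)" by simp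
    fix a b and f :: "real \<Rightarrow> 'a"
    assume a: "0 < a" "a \<le> 1 / real (Suc n)" and b: "real (Suc n) \<le> b"
      and f: "continuous_on {0<..} f" and fg: "\<And>s. 0 < s \<Longrightarrow> norm (f s) \<le> g s"
    have fi: "f integrable_on {0<..}"
      using dominated_integrable_Ioi[OF f fg g] .
    have sub: "{a..b} \<subseteq> {0<..}" using a by auto
    have fi': "(\<lambda>s. if s \<in> {a..b} then f s else 0) integrable_on {0<..}"
      using sub integrable_on_subinterval[OF fi sub]
      by (subst integrable_restrict_Int) (simp add: Int_absorb2)
    have "integral {a..b} f = integral {0<..} (\<lambda>s. if s \<in> {a..b} then f s else 0)"
      using sub by (subst integral_restrict_Int) (simp add: Int_absorb2)
    then have "integral {0<..} f - integral {a..b} f =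
        integral {0<..} (\<lambda>s. f s - (if s \<in> {a..b} then f s else 0))"
      using Henstock_Kurzweil_Integration.integral_diff[OF fi fi'] by simp
    also have "norm \<dots> \<le> integral {0<..} (?h n)"
      by (rule integral_norm_bound_integral[OF integrable_diff[OF fi fi'] tail_integral_tendsto_0(2)[OF g pos]])
         (use fg pos a b in auto)
    finally show "norm (integral {a..b} f - integral {0<..} f) < e"
      using n by (simp add: norm_minus_commute)
  qed
qed

text \<open>A uniform limit of integrals over compact intervals, on which joint continuity of the
  integrand gives continuity in the parameter.\<close>

lemma continuous_on_integral_Ioi:
  fixes f :: "'p::topological_space \<Rightarrow> real \<Rightarrow> 'a::banach"
  assumes f: "continuous_on (U \<times> {0<..}) (\<lambda>(p, s). f p s)"
    and fg: "\<And>p s. p \<in> U \<Longrightarrow> 0 < s \<Longrightarrow> norm (f p s) \<le> g s" and g: "g integrable_on {0<..}"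
  shows "continuous_on U (\<lambda>p. integral {0<..} (f p))"
\<comment> \<open>A point of \<open>U\<close> is needed to read \<open>0 \<le> g s\<close> off the
  domination.\<close>
proof (cases "U = {}")
  case False
  then have pos: "0 < s \<Longrightarrow> 0 \<le> g s" for s using fg order_trans[OF norm_ge_zero] by blast
  have sub: "{1 / real (Suc n)..real (Suc n)} \<subseteq> {0<..}" for n
    by (auto intro: less_le_trans[rotated])
  have fp: "continuous_on {0<..} (f p)" if "p \<in> U" for p
  proof -
    have "continuous_on {0<..} (\<lambda>s. (p, s))" by (intro continuous_intros)
    from continuous_on_compose2[OF f this] that show ?thesis by auto
  qed
  have "uniform_limit U (\<lambda>n p. integral {1 / real (Suc n)..real (Suc n)} (f p))
          (\<lambda>p. integral {0<..} (f p)) sequentially"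
  proof (rule uniform_limitI)
    fix e :: real assume "e > 0"
    obtain n where n: "0 < n" "\<And>a b (f :: real \<Rightarrow> 'a). 0 < a \<Longrightarrow> a \<le> 1 / n \<Longrightarrow> n \<le> b \<Longrightarrow>
        continuous_on {0<..} f \<Longrightarrow> (\<And>s. 0 < s \<Longrightarrow> norm (f s) \<le> g s) \<Longrightarrow>
        norm (integral {a..b} f - integral {0<..} f) < e"
      using integral_Icc_uniform_limit_Ioi[OF g pos \<open>0 < e\<close>] by blast
    have "\<forall>p\<in>U. dist (integral {1 / real (Suc k)..real (Suc k)} (f p)) (integral {0<..} (f p)) < e"
      if "k \<ge> nat \<lceil>n\<rceil>" for k
    proof
      fix p assume p: "p \<in> U"
      have k: "n \<le> real (Suc k)" using that by linarith
      then have "1 / real (Suc k) \<le> 1 / n" using n(1) by (intro divide_left_mono) auto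
      then show "dist (integral {1 / real (Suc k)..real (Suc k)} (f p)) (integral {0<..} (f p)) < e"
        unfolding dist_norm by (intro n(2) fp p k fg) auto
    qed
    then show "\<forall>\<^sub>F k in sequentially. \<forall>p\<in>U.
        dist (integral {1 / real (Suc k)..real (Suc k)} (f p)) (integral {0<..} (f p)) < e"
      by (rule eventually_sequentiallyI)
  qed
  moreover have "continuous_on U (\<lambda>p. integral (cbox (1 / real (Suc n)) (real (Suc n))) (f p))" for n
  proof (rule integral_continuous_on_param)
    show "continuous_on (U \<times> cbox (1 / real (Suc n)) (real (Suc n))) (\<lambda>(x, y). f x y)"
      using sub[of n] by (intro continuous_on_subset[OF f]) (auto simp: box_real)
  qed
  ultimately show ?thesis
    by (intro uniform_limit_theorem[OF always_eventually _ sequentially_bot]) auto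
qed auto

text \<open>An equivalence, so that the next lemma also covers functions without an integral: then
  both sides take the same default value.\<close>

lemma has_integral_flip:
  fixes h :: "real \<Rightarrow> 'a::real_normed_vector"
  shows "((\<lambda>s. h (t - s)) has_integral I) {\<tau>..t} \<longleftrightarrow> (h has_integral I) {0..t - \<tau>}"
  using has_integral_shift_Icc_real[of h t I "- t" "- \<tau>"] has_integral_reflect_real[of "h \<circ> (+) t" I "- \<tau>" "- t"]
  by (simp add: o_def)

lemma integral_flip:
  fixes h :: "real \<Rightarrow> 'a::banach"
  shows "integral {\<tau>..t} (\<lambda>s. h (t - s)) = integral {0..t - \<tau>} h"
  using has_integral_flip[of h t _ \<tau>]
  by (metis integrable_integral integrable_on_def integral_unique not_integrable_integral)

text \<open>If a box contains the ball of radius \<open>B + \<bar>c\<bar>\<close>, its translate by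
  \<open>c\<close> contains the ball of radius \<open>B\<close>; so the limit over large boxes that
  defines the integral is unchanged.\<close>

lemma has_integral_translate:
  fixes f :: "real \<Rightarrow> 'a::banach"
  assumes "(f has_integral I) UNIV"
  shows "((\<lambda>x. f (x + c)) has_integral I) UNIV"
proof -
  have f: "f integrable_on {a..b}" for a b
    using integrable_on_subinterval[OF has_integral_integrable[OF assms]] by simp
  have shift: "((\<lambda>x. f (x + c)) has_integral integral {a + c..b + c} f) {a..b}" for a b
    using has_integral_shift_real_ivl[OF integrable_integral[OF f[of "a + c" "b + c"]], of c] by simp
  have "\<exists>B>0. \<forall>a b. ball 0 B \<subseteq> cbox a b \<longrightarrow> norm (integral (cbox a b) (\<lambda>x. f (x + c)) - I) < e" if "0 < e" for e
  proof -
    have "\<exists>B>0. \<forall>a b. ball 0 B \<subseteq> cbox a b \<longrightarrow> norm (integral (cbox a b) f - I) < e"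
      using assms that unfolding has_integral_alt'[of f I UNIV] by simp
    then obtain B where "0 < B \<and> (\<forall>a b. ball 0 B \<subseteq> cbox a b \<longrightarrow> norm (integral (cbox a b) f - I) < e)" ..
    then have B: "0 < B" "\<And>a b. ball 0 B \<subseteq> cbox a b \<Longrightarrow> norm (integral (cbox a b) f - I) < e"
      by simp_all
    have "norm (integral (cbox a b) (\<lambda>x. f (x + c)) - I) < e" if "ball 0 (B + \<bar>c\<bar>) \<subseteq> cbox a b" for a b
    proof -
      have "ball 0 B \<subseteq> cbox (a + c) (b + c)"
      proof
        fix x :: real assume "x \<in> ball 0 B"
        then have "\<bar>x - c\<bar> < B + \<bar>c\<bar>"
          using abs_triangle_ineq4[of x c] by (simp only: mem_ball_0 real_norm_def)
        then have "x - c \<in> cbox a b" by (intro subsetD[OF that]) (simp only: mem_ball_0 real_norm_def)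
        then show "x \<in> cbox (a + c) (b + c)" by (simp add: box_real algebra_simps)
      qed
      from B(2)[OF this] show ?thesis using integral_unique[OF shift[of a b]] by (simp add: box_real)
    qed
    with B(1) show ?thesis by (intro exI[of _ "B + \<bar>c\<bar>"]) auto
  qed
  moreover have "(\<lambda>x. f (x + c)) integrable_on cbox a b" for a b
    using shift[of a b] by (auto simp: box_real)
  ultimately show ?thesis unfolding has_integral_alt'[of "\<lambda>x. f (x + c)" I UNIV] by simp
qed

section \<open>Negative fractional powers\<close>

text \<open>Strong continuity and a uniform bound give joint continuity:
  \<open>B (a z) (f z)\<close> is split into \<open>B (a z) (f z0)\<close>, continuous for the fixed
  vector, and \<open>B (a z) (f z - f z0)\<close>, small by the bound.\<close>

lemma continuous_on_operator_family:
  fixes B :: "real \<Rightarrow> 'a::real_normed_vector \<Rightarrow> 'b::real_normed_vector"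
    and a :: "'t::topological_space \<Rightarrow> real"
  assumes lin: "\<And>s. s \<in> I \<Longrightarrow> linear (B s)"
    and cont: "\<And>x. continuous_on I (\<lambda>s. B s x)"
    and bound: "\<And>s x. s \<in> I \<Longrightarrow> norm (B s x) \<le> C * norm x"
    and a: "continuous_on U a" "\<And>z. z \<in> U \<Longrightarrow> a z \<in> I" and f: "continuous_on U f"
  shows "continuous_on U (\<lambda>z. B (a z) (f z))"
  unfolding continuous_on_def
proof
  fix z0 assume z0: "z0 \<in> U"
  have "((\<lambda>z. B (a z) (f z0)) \<longlongrightarrow> B (a z0) (f z0)) (at z0 within U)"
    using continuous_on_compose2[OF cont a(1)] a(2) z0 unfolding continuous_on_def by blast
  moreover have "((\<lambda>z. B (a z) (f z - f z0)) \<longlongrightarrow> 0) (at z0 within U)"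
  proof (rule Lim_null_comparison)
    show "\<forall>\<^sub>F z in at z0 within U. norm (B (a z) (f z - f z0)) \<le> C * norm (f z - f z0)"
      unfolding eventually_at_filter using bound a(2) by (intro always_eventually) auto
    have "((\<lambda>z. C * norm (f z - f z0)) \<longlongrightarrow> C * norm (f z0 - f z0)) (at z0 within U)"
      using f z0 unfolding continuous_on_def by (intro tendsto_intros) auto
    then show "((\<lambda>z. C * norm (f z - f z0)) \<longlongrightarrow> 0) (at z0 within U)" by simp
  qed
  ultimately have "((\<lambda>z. B (a z) (f z0) + B (a z) (f z - f z0)) \<longlongrightarrow> B (a z0) (f z0) + 0) (at z0 within U)"
    by (rule tendsto_add)
  moreover have "B (a z) (f z0) + B (a z) (f z - f z0) = B (a z) (f z)" if "z \<in> U" for z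
    using linear_diff[OF lin[OF a(2)[OF that]]] by simp
  ultimately show "((\<lambda>z. B (a z) (f z)) \<longlongrightarrow> B (a z0) (f z0)) (at z0 within U)"
    by (auto elim!: Lim_transform_eventually simp: eventually_at_filter)
qed

text \<open>Balakrishnan's integral involves the resolvent on the negative real axis only. The bound
  \<open>K / (1 + s)\<close> joins the sectorial decay at infinity to boundedness near
  \<open>s = 0\<close>, a point of the resolvent set.\<close>

locale positive_operator =
  fixes D :: "'x::banach set" and \<Lambda> :: "'x \<Rightarrow> 'x" and K :: real
  assumes linear_op: "linear_operator D \<Lambda>"
    and bij: "0 \<le> s \<Longrightarrow> bij_betw (\<lambda>y. s *\<^sub>R y + \<Lambda> y) D UNIV"
    and resolvent_bound: "0 \<le> s \<Longrightarrow> norm (inv_into D (\<lambda>y. s *\<^sub>R y + \<Lambda> y) x) \<le> K / (1 + s) * norm x"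
    and K_pos: "0 < K"
begin

definition J :: "real \<Rightarrow> 'x \<Rightarrow> 'x" where
  "J s = inv_into D (\<lambda>y. s *\<^sub>R y + \<Lambda> y)"

section \<open>Algebra and continuity of the resolvent on the half line\<close>

lemma subspace_D: "subspace D"
  and \<Lambda>_add: "x \<in> D \<Longrightarrow> y \<in> D \<Longrightarrow> \<Lambda> (x + y) = \<Lambda> x + \<Lambda> y"
  and \<Lambda>_scale: "x \<in> D \<Longrightarrow> \<Lambda> (c *\<^sub>R x) = c *\<^sub>R \<Lambda> x"
  using linear_op unfolding linear_operator_def by auto

lemma J_mem: "0 \<le> s \<Longrightarrow> J s x \<in> D"
  using bij[of s] unfolding J_def bij_betw_def by (metis UNIV_I inv_into_into)

lemma J_solves: "0 \<le> s \<Longrightarrow> s *\<^sub>R J s x + \<Lambda> (J s x) = x"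
  using bij[of s] f_inv_into_f[of x "\<lambda>y. s *\<^sub>R y + \<Lambda> y" D] unfolding J_def bij_betw_def by simp

lemma J_eqI: "0 \<le> s \<Longrightarrow> y \<in> D \<Longrightarrow> s *\<^sub>R y + \<Lambda> y = x \<Longrightarrow> J s x = y"
  using bij[of s] inv_into_f_f[of "\<lambda>y. s *\<^sub>R y + \<Lambda> y" D y] unfolding J_def bij_betw_def by auto

lemma linear_J: "0 \<le> s \<Longrightarrow> linear (J s)"
proof (rule linearI)
  assume s: "0 \<le> s"
  show "J s (x + y) = J s x + J s y" for x y
  proof (rule J_eqI[OF s])
    show "J s x + J s y \<in> D" using J_mem[OF s] subspace_D by (auto intro: subspace_add)
    show "s *\<^sub>R (J s x + J s y) + \<Lambda> (J s x + J s y) = x + y"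
      using J_solves[OF s, of x] J_solves[OF s, of y] J_mem[OF s] \<Lambda>_add by (simp add: algebra_simps)
  qed
  show "J s (c *\<^sub>R x) = c *\<^sub>R J s x" for c x
  proof (rule J_eqI[OF s])
    show "c *\<^sub>R J s x \<in> D" using J_mem[OF s] subspace_D by (auto intro: subspace_scale)
    have "s *\<^sub>R c *\<^sub>R J s x + \<Lambda> (c *\<^sub>R J s x) = c *\<^sub>R (s *\<^sub>R J s x + \<Lambda> (J s x))"
      using J_mem[OF s] \<Lambda>_scale by (simp add: algebra_simps)
    then show "s *\<^sub>R c *\<^sub>R J s x + \<Lambda> (c *\<^sub>R J s x) = c *\<^sub>R x" using J_solves[OF s] by simp
  qed
qed

lemma norm_J: "0 \<le> s \<Longrightarrow> norm (J s x) \<le> K / (1 + s) * norm x"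
  using resolvent_bound unfolding J_def .

lemma norm_J': "0 \<le> s \<Longrightarrow> norm (J s x) \<le> K * norm x"
proof -
  assume s: "0 \<le> s"
  have "K / (1 + s) \<le> K" using K_pos s by (simp add: divide_le_eq)
  then show ?thesis using norm_J[OF s, of x] mult_right_mono[of _ _ "norm x"] by fastforce
qed

lemma bounded_linear_J: "0 \<le> s \<Longrightarrow> bounded_linear (J s)"
  using linear_J norm_J'
  by (metis bounded_linear.intro bounded_linear_axioms.intro linear_conv_bounded_linear mult.commute bounded_linear_intro linear_add linear_scale)

text \<open>Since \<open>s + \<Lambda>\<close> maps \<open>J t x\<close> to
  \<open>x + (s - t) *\<^sub>R J t x\<close>, the difference \<open>J s x - J t x\<close> is the
  image under \<open>J s\<close> of \<open>x\<close> minus that vector.\<close>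

lemma resolvent_identity:
  assumes "0 \<le> s" "0 \<le> t"
  shows "J s x - J t x = (t - s) *\<^sub>R J s (J t x)"
proof -
  have "J s (x - (x + (s - t) *\<^sub>R J t x)) = J s x - J t x"
  proof (rule J_eqI[OF \<open>0 \<le> s\<close>])
    have m: "J s x \<in> D" "J t x \<in> D" using J_mem assms by auto
    then show "J s x - J t x \<in> D" using subspace_D by (auto intro: subspace_diff)
    have "\<Lambda> (J s x - J t x) = \<Lambda> (J s x) - \<Lambda> (J t x)"
      using \<Lambda>_add[of "J s x" "(- 1) *\<^sub>R J t x"] \<Lambda>_scale[of "J t x" "- 1"] m subspace_scale[OF subspace_D m(2), of "- 1"]
      by simp
    moreover have "\<Lambda> (J s x) = x - s *\<^sub>R J s x" "\<Lambda> (J t x) = x - t *\<^sub>R J t x"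
      using J_solves[OF assms(1), of x] J_solves[OF assms(2), of x] by (auto simp: algebra_simps)
    ultimately show "s *\<^sub>R (J s x - J t x) + \<Lambda> (J s x - J t x) = x - (x + (s - t) *\<^sub>R J t x)"
      by (simp add: algebra_simps)
  qed
  moreover have "x - (x + (s - t) *\<^sub>R J t x) = (t - s) *\<^sub>R J t x" by (simp add: algebra_simps)
  ultimately show ?thesis
    using linear_scale[OF linear_J[OF assms(1)], of "t - s" "J t x"] by (simp only:)
qed

text \<open>The resolvent identity makes the map Lipschitz.\<close>

lemma continuous_on_J: "continuous_on {0..} (\<lambda>s. J s x)"
proof (rule lipschitz_on_continuous_on[where L="K * (K * norm x)"], rule lipschitz_onI)
  fix s t :: real assume "s \<in> {0..}" "t \<in> {0..}"
  then have st: "0 \<le> s" "0 \<le> t" by auto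
  have "norm (J s (J t x)) \<le> K * (K * norm x)"
    using norm_J'[OF st(1), of "J t x"] norm_J'[OF st(2), of x] K_pos
    by (meson mult_left_mono order_trans less_imp_le)
  then have "\<bar>t - s\<bar> * norm (J s (J t x)) \<le> \<bar>t - s\<bar> * (K * (K * norm x))"
    by (rule mult_left_mono) simp
  then show "dist (J s x) (J t x) \<le> K * (K * norm x) * dist s t"
    unfolding dist_norm resolvent_identity[OF st] by (simp add: abs_minus_commute mult.commute)
qed (use K_pos in simp)

lemma continuous_on_J_compose:
  fixes a :: "'t::topological_space \<Rightarrow> real"
  assumes "continuous_on U a" "\<And>z. z \<in> U \<Longrightarrow> 0 \<le> a z" "continuous_on U f"
  shows "continuous_on U (\<lambda>z. J (a z) (f z))"
  by (rule continuous_on_operator_family[where I="{0..}", OF _ continuous_on_J _ assms(1) _ assms(3)])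
     (use linear_J norm_J' assms(2) in auto)

text \<open>Balakrishnan's integral without its scalar factor.\<close>

definition Q :: "real \<Rightarrow> 'x \<Rightarrow> 'x" where
  "Q \<alpha> x = integral {0<..} (\<lambda>s. s powr (- \<alpha>) *\<^sub>R J s x)"

text \<open>Up to the factor \<open>K * norm x\<close> a majorant for the integrand of
  \<open>Q\<close>: the resolvent factor \<open>1 / (1 + s)\<close> is replaced by \<open>1\<close>
  near \<open>0\<close> and by \<open>1 / s\<close> at infinity.\<close>

definition maj :: "real \<Rightarrow> real \<Rightarrow> real" where
  "maj \<alpha> v = (if v < 1 then v powr (- \<alpha>) else v powr (- \<alpha> - 1))"

lemma maj_integrable: "0 < \<alpha> \<Longrightarrow> \<alpha> < 1 \<Longrightarrow> maj \<alpha> integrable_on {0<..}"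
  unfolding maj_def by (rule integrable_two_powers) auto

lemma maj_nonneg: "0 \<le> maj \<alpha> v" unfolding maj_def by simp

lemma Q_integrand_bound:
  assumes "0 < s"
  shows "norm (s powr (- \<alpha>) *\<^sub>R J s x) \<le> K * norm x * maj \<alpha> s"
proof -
  have "1 / (1 + s) \<le> 1" "1 / (1 + s) \<le> 1 / s" using assms by (auto simp: field_simps)
  then have "s powr (- \<alpha>) * (1 / (1 + s)) \<le> s powr (- \<alpha>) * 1"
    "s powr (- \<alpha>) * (1 / (1 + s)) \<le> s powr (- \<alpha>) * (1 / s)"
    by (intro mult_left_mono; simp)+
  moreover have "s powr (- \<alpha>) * (1 / s) = s powr (- \<alpha> - 1)"
    using assms by (simp add: powr_diff)
  ultimately have "s powr (- \<alpha>) * (1 / (1 + s)) \<le> maj \<alpha> s" unfolding maj_def by auto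
  then have "(K * norm x) * (s powr (- \<alpha>) * (1 / (1 + s))) \<le> K * norm x * maj \<alpha> s"
    using K_pos by (intro mult_left_mono) auto
  moreover have "norm (s powr (- \<alpha>) *\<^sub>R J s x) \<le> s powr (- \<alpha>) * (K / (1 + s) * norm x)"
    using mult_left_mono[OF norm_J[of s x], of "s powr (- \<alpha>)"] assms by simp
  ultimately show ?thesis by (simp add: mult_ac)
qed

lemma Q_integrand_continuous: "continuous_on {0<..} (\<lambda>s. s powr (- \<alpha>) *\<^sub>R J s x)"
  by (intro continuous_intros continuous_on_subset[OF continuous_on_J]) auto

lemma maj_multiple_integrable: "0 < \<alpha> \<Longrightarrow> \<alpha> < 1 \<Longrightarrow> (\<lambda>s. K * norm x * maj \<alpha> s) integrable_on {0<..}"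
  using integrable_cmul[OF maj_integrable, of \<alpha> "K * norm x"] by simp

lemma Q_integrand_integrable:
  assumes "0 < \<alpha>" "\<alpha> < 1"
  shows "(\<lambda>s. s powr (- \<alpha>) *\<^sub>R J s x) integrable_on {0<..}"
  by (rule dominated_integrable_Ioi[OF Q_integrand_continuous Q_integrand_bound maj_multiple_integrable[OF assms]])

lemma bounded_linear_Q:
  assumes "0 < \<alpha>" "\<alpha> < 1"
  shows "bounded_linear (Q \<alpha>)"
proof (rule bounded_linear_intro)
  fix x y
  have "Q \<alpha> (x + y) = integral {0<..} (\<lambda>s. s powr (- \<alpha>) *\<^sub>R J s x + s powr (- \<alpha>) *\<^sub>R J s y)"
    unfolding Q_def by (rule integral_cong) (simp add: linear_add[OF linear_J] scaleR_add_right)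
  also have "\<dots> = Q \<alpha> x + Q \<alpha> y"
    unfolding Q_def
    by (rule Henstock_Kurzweil_Integration.integral_add) (rule Q_integrand_integrable[OF assms])+
  finally show "Q \<alpha> (x + y) = Q \<alpha> x + Q \<alpha> y" .
next
  fix c x
  have "Q \<alpha> (c *\<^sub>R x) = integral {0<..} (\<lambda>s. c *\<^sub>R (s powr (- \<alpha>) *\<^sub>R J s x))"
    unfolding Q_def by (rule integral_cong) (simp add: linear_scale[OF linear_J])
  then show "Q \<alpha> (c *\<^sub>R x) = c *\<^sub>R Q \<alpha> x"
    unfolding Q_def by (simp only: Henstock_Kurzweil_Integration.integral_cmul)
next
  fix x :: 'x
  have h: "((\<lambda>s. K * norm x * maj \<alpha> s) has_integral K * norm x * integral {0<..} (maj \<alpha>)) {0<..}"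
    using has_integral_cmul[OF integrable_integral[OF maj_integrable[OF assms]], of "K * norm x"] by simp
  have "norm (Q \<alpha> x) \<le> K * norm x * integral {0<..} (maj \<alpha>)"
    unfolding Q_def by (rule norm_integral_Ioi_le[OF Q_integrand_continuous Q_integrand_bound h])
  then show "norm (Q \<alpha> x) \<le> norm x * (K * integral {0<..} (maj \<alpha>))"
    by (simp add: mult_ac)
qed


lemma integral_Q_commute:
  assumes "0 < \<alpha>" "\<alpha> < 1" "bounded_linear h" "\<And>s x. 0 \<le> s \<Longrightarrow> h (J s x) = J s (h x)"
  shows "h (Q \<alpha> x) = Q \<alpha> (h x)"
proof -
  have "h (Q \<alpha> x) = integral {0<..} (h \<circ> (\<lambda>s. s powr (- \<alpha>) *\<^sub>R J s x))"
    unfolding Q_def using integral_linear[OF Q_integrand_integrable[OF assms(1,2)] assms(3)] by simp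
  also have "\<dots> = Q \<alpha> (h x)"
    unfolding Q_def using assms(4) by (intro integral_cong) (simp add: bounded_linear.linear[OF assms(3)] linear_scale)
  finally show ?thesis .
qed

text \<open>The integral is oriented: \<open>z > w\<close> gives the negative of the integral over \<open>{w..z}\<close>.\<close>

definition logint :: "'x \<Rightarrow> real \<Rightarrow> real \<Rightarrow> 'x" where
  "logint x z w = (if z \<le> w then integral {z..w} (\<lambda>u. (1 / u) *\<^sub>R J u x)
     else - integral {w..z} (\<lambda>u. (1 / u) *\<^sub>R J u x))"

text \<open>The first bound is for small \<open>a\<close> and \<open>b\<close>: there
  \<open>J u x\<close> is close to \<open>J 0 x\<close>, with difference
  \<open>- u J u (J 0 x)\<close>, and the integral of \<open>1 / u\<close> gives the logarithm. The
  second is for large ones, where \<open>J u x\<close> decays. Replacing \<open>1 / (1 + u)\<close>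
  by \<open>u powr (e - 1)\<close> or by \<open>u powr (- e)\<close> makes the bounds explicit
  powers, small as the endpoints tend to \<open>0\<close> or to infinity respectively.\<close>

lemma logint_estimates:
  assumes "0 < a" "0 < b" "0 < e" "e \<le> 1"
  shows "norm (logint x a b - ln (b / a) *\<^sub>R J 0 x) \<le> K * norm (J 0 x) / e * \<bar>b powr e - a powr e\<bar>"
    and "norm (logint x a b) \<le> K * norm x / e * \<bar>a powr (- e) - b powr (- e)\<bar>"
proof -
  have c: "continuous_on {z..w} (\<lambda>u. (1 / u) *\<^sub>R J u x)" if "0 < z" for z w
    using that by (intro continuous_intros continuous_on_subset[OF continuous_on_J]) auto
  have small: "norm (integral {z..w} (\<lambda>u. (1 / u) *\<^sub>R J u x) - ln (w / z) *\<^sub>R J 0 x) \<le> K * norm (J 0 x) / e * (w powr e - z powr e)"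
    if "0 < z" "z \<le> w" for z w
  proof -
    have 1: "((\<lambda>u. (1 / u) *\<^sub>R J 0 x) has_integral (ln w *\<^sub>R J 0 x - ln z *\<^sub>R J 0 x)) {z..w}"
      by (rule fundamental_theorem_of_calculus)
         (use that in \<open>auto intro!: derivative_eq_intros has_vector_derivative_scaleR simp: has_vector_derivative_def has_field_derivative_def inverse_eq_divide\<close>)
    have 2: "((\<lambda>u. K * norm (J 0 x) * u powr (e - 1)) has_integral (K * norm (J 0 x) * (w powr e / e) - K * norm (J 0 x) * (z powr e / e))) {z..w}"
      by (rule fundamental_theorem_of_calculus)
         (use that \<open>0 < e\<close> in \<open>auto intro!: derivative_eq_intros simp flip: has_real_derivative_iff_has_vector_derivative\<close>)
    have "integral {z..w} (\<lambda>u. (1 / u) *\<^sub>R J u x) - ln (w / z) *\<^sub>R J 0 x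
      = integral {z..w} (\<lambda>u. (1 / u) *\<^sub>R J u x) - integral {z..w} (\<lambda>u. (1 / u) *\<^sub>R J 0 x)"
      using integral_unique[OF 1] that by (simp add: ln_div algebra_simps)
    also have "\<dots> = integral {z..w} (\<lambda>u. (1 / u) *\<^sub>R J u x - (1 / u) *\<^sub>R J 0 x)"
      by (rule Henstock_Kurzweil_Integration.integral_diff[symmetric])
         (use integrable_continuous_real[OF c[OF that(1)]] 1 in auto)
    also have "norm \<dots> \<le> integral {z..w} (\<lambda>u. K * norm (J 0 x) * u powr (e - 1))"
    proof (rule integral_norm_bound_integral)
      show "(\<lambda>u. (1 / u) *\<^sub>R J u x - (1 / u) *\<^sub>R J 0 x) integrable_on {z..w}"
        using integrable_continuous_real[OF c[OF that(1)]] 1 by (auto intro!: integrable_diff)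
      fix u assume "u \<in> {z..w}"
      then have u: "0 < u" using that by auto
      have "norm ((1 / u) *\<^sub>R J u x - (1 / u) *\<^sub>R J 0 x) = norm ((1 / u) *\<^sub>R (J u x - J 0 x))"
        by (simp add: algebra_simps)
      also have "\<dots> = norm (J u (J 0 x))" using u by (simp add: resolvent_identity)
      also have "\<dots> \<le> K / (1 + u) * norm (J 0 x)" using norm_J u by simp
      also have "\<dots> = K * norm (J 0 x) * (1 / (1 + u))" by simp
      also have "1 / (1 + u) \<le> u powr (e - 1)"
      proof (cases "u < 1")
        case True
        have "1 = u powr 0" using u by simp
        also have "u powr 0 \<le> u powr (e - 1)" using True u \<open>e \<le> 1\<close> by (intro powr_mono') auto
        finally show ?thesis using u by (smt (verit) divide_le_eq_1_pos)
      next
        case False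
        have "1 / (1 + u) \<le> u powr (- 1)" using u by (simp add: powr_minus_divide field_simps)
        also have "\<dots> \<le> u powr (e - 1)" using False \<open>0 < e\<close> by (intro powr_mono) auto
        finally show ?thesis .
      qed
      finally show "norm ((1 / u) *\<^sub>R J u x - (1 / u) *\<^sub>R J 0 x) \<le> K * norm (J 0 x) * u powr (e - 1)"
        using K_pos by (simp add: mult_left_mono)
    qed (use 2 in auto)
    also have "\<dots> = K * norm (J 0 x) / e * (w powr e - z powr e)"
      unfolding integral_unique[OF 2] using \<open>0 < e\<close> by (simp add: field_simps)
    finally show ?thesis .
  qed
  have large: "norm (integral {z..w} (\<lambda>u. (1 / u) *\<^sub>R J u x)) \<le> K * norm x / e * (z powr (- e) - w powr (- e))"
    if "0 < z" "z \<le> w" for z w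
  proof -
    have 2: "((\<lambda>u. K * norm x * u powr (- e - 1)) has_integral (- (K * norm x * (w powr (- e) / e)) - - (K * norm x * (z powr (- e) / e)))) {z..w}"
      by (rule fundamental_theorem_of_calculus)
         (use that \<open>0 < e\<close> in \<open>auto intro!: derivative_eq_intros simp flip: has_real_derivative_iff_has_vector_derivative\<close>)
    have "norm (integral {z..w} (\<lambda>u. (1 / u) *\<^sub>R J u x)) \<le> integral {z..w} (\<lambda>u. K * norm x * u powr (- e - 1))"
    proof (rule integral_norm_bound_integral)
      show "(\<lambda>u. (1 / u) *\<^sub>R J u x) integrable_on {z..w}"
        by (rule integrable_continuous_real[OF c[OF that(1)]])
      fix u assume "u \<in> {z..w}"
      then have u: "0 < u" using that by auto
      have "norm ((1 / u) *\<^sub>R J u x) \<le> (1 / u) * (K / (1 + u) * norm x)"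
        using norm_J[of u x] u mult_left_mono[OF norm_J[of u x], of "1 / u"] by simp
      also have "\<dots> = K * norm x * (1 / (1 + u) * (1 / u))" by simp
      also have "1 / (1 + u) * (1 / u) \<le> u powr (- e) * (1 / u)"
      proof (rule mult_right_mono)
        show "1 / (1 + u) \<le> u powr (- e)"
        proof (cases "u < 1")
          case True
          have "1 = u powr 0" using u by simp
          also have "u powr 0 \<le> u powr (- e)" using True u \<open>0 < e\<close> by (intro powr_mono') auto
          finally show ?thesis using u by (smt (verit) divide_le_eq_1_pos)
        next
          case False
          have "1 / (1 + u) \<le> u powr (- 1)" using u by (simp add: powr_minus_divide field_simps)
          also have "\<dots> \<le> u powr (- e)" using False \<open>e \<le> 1\<close> by (intro powr_mono) auto
          finally show ?thesis .
        qed
      qed (use u in simp)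
      also have "u powr (- e) * (1 / u) = u powr (- e - 1)" using u by (simp add: powr_diff)
      finally show "norm ((1 / u) *\<^sub>R J u x) \<le> K * norm x * u powr (- e - 1)"
        using K_pos by (simp add: mult_left_mono)
    qed (use 2 in auto)
    also have "\<dots> = K * norm x / e * (z powr (- e) - w powr (- e))"
      unfolding integral_unique[OF 2] using \<open>0 < e\<close> by (simp add: field_simps)
    finally show ?thesis .
  qed
  have mono: "z powr e \<le> w powr e" "w powr (- e) \<le> z powr (- e)" if "0 < z" "z \<le> w" for z w
    using that \<open>0 < e\<close> by (auto intro: powr_mono2 powr_mono2')
  show "norm (logint x a b - ln (b / a) *\<^sub>R J 0 x) \<le> K * norm (J 0 x) / e * \<bar>b powr e - a powr e\<bar>"
  proof (cases "a \<le> b")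
    case True
    then show ?thesis using small[of a b] mono[of a b] assms by (simp add: logint_def)
  next
    case False
    have "logint x a b - ln (b / a) *\<^sub>R J 0 x = - (integral {b..a} (\<lambda>u. (1 / u) *\<^sub>R J u x) - ln (a / b) *\<^sub>R J 0 x)"
      using False assms(1,2) unfolding logint_def by (simp add: ln_div algebra_simps)
    then show ?thesis using small[of b a] mono[of b a] assms(1,2) False
      by (simp only: norm_minus_cancel) (simp add: abs_minus_commute)
  qed
  show "norm (logint x a b) \<le> K * norm x / e * \<bar>a powr (- e) - b powr (- e)\<bar>"
  proof (cases "a \<le> b")
    case True
    then show ?thesis using large[of a b] mono[of a b] assms unfolding logint_def by simp
  next
    case False
    then show ?thesis using large[of b a] mono[of b a] assms(1,2) unfolding logint_def
      by (simp add: abs_minus_commute)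
  qed
qed

end

text \<open>The estimate of \<open>W\<close> divides by \<open>v - 1\<close>. The quotients must
  stay bounded at \<open>v = 1\<close> and must grow so slowly at \<open>0\<close>, and decay so
  fast at infinity, that \<open>v powr (- \<alpha>) * h\<close> is integrable for small
  \<open>e\<close>.\<close>

lemma powr_difference_bounds:
  fixes v e :: real
  assumes "0 < v" "v \<noteq> 1" "0 < e" "e \<le> 1"
  defines "h \<equiv> if v < 1 then v powr (- e) else v powr (e - 1)"
  shows "\<bar>v powr e - 1\<bar> \<le> \<bar>v - 1\<bar> * h" "\<bar>1 - v powr (- e)\<bar> \<le> \<bar>v - 1\<bar> * h"
proof -
  show "\<bar>v powr e - 1\<bar> \<le> \<bar>v - 1\<bar> * h"
  proof (cases "v < 1")
    case True
    have "v powr e \<le> 1" using True assms powr_mono2[of e v 1] by simp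
    moreover have "v powr 1 \<le> v powr e" using True assms by (intro powr_mono') auto
    moreover have "1 \<le> v powr (- e)" using True assms powr_mono2'[of "- e" v 1] by simp
    moreover from this have "(1 - v) * 1 \<le> (1 - v) * v powr (- e)"
      using True by (intro mult_left_mono) auto
    then have "1 - v \<le> (1 - v) * v powr (- e)" by (simp only: mult_1_right)
    ultimately have "1 - v powr e \<le> (1 - v) * v powr (- e)" using assms(1) by simp
    then show ?thesis
      using True \<open>v powr e \<le> 1\<close> unfolding h_def by simp
  next
    case False
    have "1 \<le> v powr e" using False assms powr_mono2[of e 1 v] by simp
    moreover have "v powr (e - 1) \<le> 1" using False assms powr_mono2'[of "e - 1" 1 v] by simp
    moreover have "(v - 1) * v powr (e - 1) = v powr e - v powr (e - 1)"
      using assms(1) by (simp add: field_simps powr_diff)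
    ultimately show ?thesis using False unfolding h_def by simp
  qed
  show "\<bar>1 - v powr (- e)\<bar> \<le> \<bar>v - 1\<bar> * h"
  proof (cases "v < 1")
    case True
    have "1 \<le> v powr (- e)" using True assms powr_mono2'[of "- e" v 1] by simp
    moreover have "v powr (1 - e) \<le> 1" using True assms powr_mono2[of "1 - e" v 1] by simp
    moreover have "(1 - v) * v powr (- e) = v powr (- e) - v powr (1 - e)"
      using assms(1) by (simp add: algebra_simps powr_diff powr_minus divide_inverse)
    ultimately show ?thesis using True unfolding h_def by simp
  next
    case False
    have "v powr (- e) \<le> 1" using False assms powr_mono2'[of "- e" 1 v] by simp
    moreover have "1 - v powr (- e) \<le> (v - 1) * v powr (- 1)"
    proof -
      have "v powr (- 1) \<le> v powr (- e)" using False assms by (intro powr_mono) auto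
      moreover have "(v - 1) * v powr (- 1) = 1 - v powr (- 1)"
        using assms(1) by (simp add: algebra_simps powr_minus)
      ultimately show ?thesis by simp
    qed
    moreover have "(v - 1) * v powr (- 1) \<le> (v - 1) * v powr (e - 1)"
      using False assms by (intro mult_left_mono powr_mono) auto
    ultimately show ?thesis using False unfolding h_def by simp
  qed
qed

text \<open>The singularity at \<open>1\<close> is removable, the limit being the derivative of
  \<open>ln\<close> there. The formula itself has the value \<open>0\<close> at \<open>1\<close>,
  since division by zero gives zero; the two versions differ on a null set.\<close>

lemma ln_kernel_integrable:
  fixes \<alpha> c d :: real
  assumes "0 < c"
  shows "(\<lambda>v. v powr (- \<alpha>) * (ln v / (v - 1))) integrable_on {c..d}"
proof -
  let ?k = "\<lambda>v::real. if v = 1 then 1 else ln v / (v - 1)"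
  have "isCont ?k v" if "0 < v" for v
  proof (cases "v = 1")
    case True
    have "((\<lambda>y. (ln y - ln 1) / (y - 1)) \<longlongrightarrow> 1) (at (1::real))"
      using DERIV_ln[of "1::real"] by (simp add: has_field_derivative_iff)
    then have "(?k \<longlongrightarrow> 1) (at 1)"
      by (rule Lim_transform_eventually) (simp add: eventually_at_filter)
    then show ?thesis using True by (simp add: isCont_def)
  next
    case False
    have "isCont (\<lambda>v. ln v / (v - 1)) v" using that False by (intro continuous_intros) auto
    moreover have "\<forall>\<^sub>F y in nhds v. ?k y = ln y / (y - 1)"
      using False t1_space_nhds[of v 1] by (auto elim!: eventually_mono)
    ultimately show ?thesis by (subst isCont_cong) auto
  qed
  then have "continuous_on {c..d} (\<lambda>v. v powr (- \<alpha>) * ?k v)"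
    using assms by (intro continuous_on_mult continuous_on_powr' continuous_intros)
      (auto intro!: continuous_at_imp_continuous_on)
  then have "(\<lambda>v. v powr (- \<alpha>) * ?k v) integrable_on {c..d}" by (rule integrable_continuous_real)
  then show ?thesis by (rule integrable_spike[where S="{1}"]) auto
qed

section \<open>Frullani's integral of the resolvent and injectivity of Balakrishnan's
  integral\<close>

context positive_operator
begin

text \<open>Frullani's rearrangement: the bulk of the two integrals cancels and only contributions
  near the endpoints \<open>m\<close> and \<open>l\<close> remain. Orientation of
  \<open>logint\<close> covers \<open>v < 1\<close> and \<open>v > 1\<close> together; all integrals
  are differences of one primitive based at the least endpoint \<open>c\<close>.\<close>

lemma logint_cocycle:
  assumes "0 < m" "m \<le> l" "0 < v"
  shows "integral {m..l} (\<lambda>u. (1 / u) *\<^sub>R J u x) - integral {m * v..l * v} (\<lambda>u. (1 / u) *\<^sub>R J u x)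
     = logint x m (m * v) - logint x l (l * v)"
proof -
  define c where "c = min m (m * v)"
  define G where "G z = integral {c..z} (\<lambda>u. (1 / u) *\<^sub>R J u x)" for z
  have c0: "0 < c" unfolding c_def using assms by simp
  have ci: "(\<lambda>u. (1 / u) *\<^sub>R J u x) integrable_on {c..w}" for w
    using c0 by (intro integrable_continuous_real continuous_intros continuous_on_subset[OF continuous_on_J]) auto
  have I: "integral {z..w} (\<lambda>u. (1 / u) *\<^sub>R J u x) = G w - G z" if "c \<le> z" "z \<le> w" for z w
    using Henstock_Kurzweil_Integration.integral_combine[OF that ci] unfolding G_def by (simp add: algebra_simps)
  have P: "logint x z w = G w - G z" if "c \<le> z" "c \<le> w" for z w
    using I[of z w] I[of w z] that unfolding logint_def by auto
  have "c \<le> m" "c \<le> m * v" "m * v \<le> l * v" using assms unfolding c_def by auto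
  with \<open>m \<le> l\<close> show ?thesis by (simp add: I P)
qed

text \<open>The inner integral of the injectivity argument, truncated to a compact range of
  \<open>\<mu>\<close>. Its limit for \<open>m\<close> to \<open>0\<close> and \<open>l\<close> to
  infinity is \<open>(ln v / (v - 1)) *\<^sub>R J 0 x\<close>.\<close>

definition W :: "'x \<Rightarrow> real \<Rightarrow> real \<Rightarrow> real \<Rightarrow> 'x" where
  "W x m l v = integral {m..l} (\<lambda>\<mu>. J \<mu> (J (\<mu> * v) x))"

text \<open>By the resolvent identity \<open>(v - 1) J \<mu> (J (\<mu> v) x)\<close> equals
  \<open>(J \<mu> x - J (\<mu> v) x) / \<mu>\<close>, a Frullani integrand. The end at
  \<open>m\<close> yields the logarithm up to a multiple of \<open>m powr e\<close>, the end at
  \<open>l\<close> is itself a multiple of \<open>l powr (- e)\<close>.\<close>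

lemma W_estimate:
  assumes "0 < m" "m \<le> l" "0 < v" "v \<noteq> 1" "0 < e" "e \<le> 1"
  shows "norm (W x m l v - (ln v / (v - 1)) *\<^sub>R J 0 x)
    \<le> (K * norm (J 0 x) * m powr e + K * norm x * l powr (- e)) / e
       * (if v < 1 then v powr (- e) else v powr (e - 1))" (is "_ \<le> ?B / e * ?h")
proof -
  have l: "0 < l" using assms by simp
  have c: "continuous_on {a..b} (\<lambda>u. (1 / u) *\<^sub>R J u x)" if "0 < a" for a b
    using that by (intro continuous_intros continuous_on_subset[OF continuous_on_J]) auto
  have "((\<lambda>u. (1 / u) *\<^sub>R J u x) has_integral integral {m * v..l * v} (\<lambda>u. (1 / u) *\<^sub>R J u x)) {m * v..l * v}"
    using assms by (intro integrable_integral integrable_continuous_real c) auto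
  from has_integral_stretch_real[OF this, of v]
  have "((\<lambda>\<mu>. (1 / (v * \<mu>)) *\<^sub>R J (v * \<mu>) x) has_integral (1 / v) *\<^sub>R integral {m * v..l * v} (\<lambda>u. (1 / u) *\<^sub>R J u x)) ((\<lambda>u. u / v) ` {m * v..l * v})"
    using assms(3) by simp
  moreover have "(\<lambda>u. u / v) ` {m * v..l * v} = {m..l}"
    using assms(3) by (auto simp: image_iff field_simps intro!: bexI[of _ "_ * v"])
  ultimately have "((\<lambda>\<mu>. v *\<^sub>R (1 / (v * \<mu>)) *\<^sub>R J (v * \<mu>) x) has_integral v *\<^sub>R (1 / v) *\<^sub>R integral {m * v..l * v} (\<lambda>u. (1 / u) *\<^sub>R J u x)) {m..l}"
    by (intro has_integral_cmul) simp
  then have 1: "((\<lambda>\<mu>. (1 / \<mu>) *\<^sub>R J (\<mu> * v) x) has_integral integral {m * v..l * v} (\<lambda>u. (1 / u) *\<^sub>R J u x)) {m..l}"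
    using assms(3) by (simp add: mult.commute)
  have 2: "((\<lambda>\<mu>. (1 / \<mu>) *\<^sub>R J \<mu> x) has_integral integral {m..l} (\<lambda>u. (1 / u) *\<^sub>R J u x)) {m..l}"
    using assms by (intro integrable_integral integrable_continuous_real c) auto
  have "(v - 1) *\<^sub>R W x m l v = integral {m..l} (\<lambda>\<mu>. (v - 1) *\<^sub>R J \<mu> (J (\<mu> * v) x))"
    unfolding W_def by (simp only: Henstock_Kurzweil_Integration.integral_cmul)
  also have "\<dots> = integral {m..l} (\<lambda>\<mu>. (1 / \<mu>) *\<^sub>R J \<mu> x - (1 / \<mu>) *\<^sub>R J (\<mu> * v) x)"
  proof (rule integral_cong)
    fix \<mu> assume "\<mu> \<in> {m..l}"
    then have \<mu>: "0 < \<mu>" using assms by auto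
    have "(1 / \<mu>) *\<^sub>R J \<mu> x - (1 / \<mu>) *\<^sub>R J (\<mu> * v) x = (1 / \<mu>) *\<^sub>R (J \<mu> x - J (\<mu> * v) x)"
      by (simp add: scaleR_diff_right)
    also have "\<dots> = (v - 1) *\<^sub>R J \<mu> (J (\<mu> * v) x)"
      using \<mu> assms(3) by (subst resolvent_identity) (auto simp: field_simps)
    finally show "(v - 1) *\<^sub>R J \<mu> (J (\<mu> * v) x) = (1 / \<mu>) *\<^sub>R J \<mu> x - (1 / \<mu>) *\<^sub>R J (\<mu> * v) x" by simp
  qed
  also have "\<dots> = logint x m (m * v) - logint x l (l * v)"
    using integral_unique[OF has_integral_diff[OF 2 1]] logint_cocycle[OF assms(1-3)] by simp
  finally have W: "(v - 1) *\<^sub>R W x m l v = logint x m (m * v) - logint x l (l * v)" .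
  have "\<bar>v - 1\<bar> * norm (W x m l v - (ln v / (v - 1)) *\<^sub>R J 0 x) = norm ((v - 1) *\<^sub>R (W x m l v - (ln v / (v - 1)) *\<^sub>R J 0 x))"
    by simp
  also have "(v - 1) *\<^sub>R (W x m l v - (ln v / (v - 1)) *\<^sub>R J 0 x) = (logint x m (m * v) - ln (m * v / m) *\<^sub>R J 0 x) - logint x l (l * v)"
    using assms(1,4) unfolding scaleR_diff_right W by simp
  also have "norm \<dots> \<le> K * norm (J 0 x) / e * \<bar>(m * v) powr e - m powr e\<bar> + K * norm x / e * \<bar>l powr (- e) - (l * v) powr (- e)\<bar>"
    by (rule order_trans[OF norm_triangle_ineq4 add_mono])
       (rule logint_estimates; use assms l in simp)+
  also have "(m * v) powr e - m powr e = m powr e * (v powr e - 1)"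
    using assms by (simp add: powr_mult algebra_simps)
  also have "l powr (- e) - (l * v) powr (- e) = l powr (- e) * (1 - v powr (- e))"
    using assms l by (simp add: powr_mult algebra_simps)
  also have "K * norm (J 0 x) / e * \<bar>m powr e * (v powr e - 1)\<bar> + K * norm x / e * \<bar>l powr (- e) * (1 - v powr (- e))\<bar>
     = K * norm (J 0 x) * m powr e / e * \<bar>v powr e - 1\<bar> + K * norm x * l powr (- e) / e * \<bar>1 - v powr (- e)\<bar>"
    by (simp add: abs_mult)
  also have "\<dots> \<le> K * norm (J 0 x) * m powr e / e * (\<bar>v - 1\<bar> * ?h) + K * norm x * l powr (- e) / e * (\<bar>v - 1\<bar> * ?h)"
    using powr_difference_bounds[OF assms(3-6)] K_pos assms(5)
    by (intro add_mono mult_left_mono) auto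
  also have "\<dots> = \<bar>v - 1\<bar> * (?B / e * ?h)" by (simp add: add_divide_distrib algebra_simps)
  finally show ?thesis
    by (rule mult_left_le_imp_le) (use assms(4) in simp)
qed

text \<open>After interchanging the integrals, the one over \<open>v\<close> is, for fixed
  \<open>\<mu>\<close>, a multiple of \<open>J \<mu>\<close> applied to a truncation of the integral
  defining \<open>Q \<alpha> x = 0\<close>. The truncations are small uniformly for
  \<open>\<mu>\<close> between \<open>m\<close> and \<open>l\<close>.\<close>

lemma W_integral_tendsto_0:
  assumes \<alpha>: "0 < \<alpha>" "\<alpha> < 1" and Q0: "Q \<alpha> x = 0" and m: "0 < m" "m \<le> l" and "0 < \<epsilon>"
  obtains N where "3 \<le> N" "norm (integral {1 / N..N} (\<lambda>v. v powr (- \<alpha>) *\<^sub>R W x m l v)) \<le> \<epsilon>"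
proof -
  \<comment> \<open>The length of the range of \<open>\<mu>\<close> times the bound for
    \<open>J \<mu>\<close> and for the scaling factor \<open>\<mu> powr \<alpha> / \<mu>\<close>;
    the summand \<open>1\<close> keeps \<open>C\<close> positive when \<open>l = m\<close>.\<close>
  define C where "C = (l - m) * (K * (l powr \<alpha> / m)) + 1"
  have C: "0 < C" unfolding C_def using m K_pos by (intro add_nonneg_pos mult_nonneg_nonneg) auto
  have "0 < \<epsilon> / C" using C \<open>0 < \<epsilon>\<close> by simp
  moreover have "0 \<le> K * norm x * maj \<alpha> s" for s using maj_nonneg K_pos by simp
  ultimately obtain n where n: "0 < n" "\<And>a b (f :: real \<Rightarrow> 'x). 0 < a \<Longrightarrow> a \<le> 1 / n \<Longrightarrow> n \<le> b \<Longrightarrow>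
      continuous_on {0<..} f \<Longrightarrow> (\<And>s. 0 < s \<Longrightarrow> norm (f s) \<le> K * norm x * maj \<alpha> s) \<Longrightarrow>
      norm (integral {a..b} f - integral {0<..} f) < \<epsilon> / C"
    using integral_Icc_uniform_limit_Ioi[OF maj_multiple_integrable[OF \<alpha>, of x], of "\<epsilon> / C", where 'a='x] by blast
  \<comment> \<open>The last two entries put \<open>\<mu> / N\<close> below \<open>1 / n\<close> and
    \<open>\<mu> * N\<close> above \<open>n\<close> for all \<open>\<mu>\<close> between
    \<open>m\<close> and \<open>l\<close>. The entry \<open>3\<close> puts \<open>{2..3}\<close>
    inside \<open>{1 / N..N}\<close>, where the limit kernel will be bounded below.\<close>
  define N where "N = max 3 (max (n * l) (n / m))"
  have N: "3 \<le> N" "n * l \<le> N" "n / m \<le> N" unfolding N_def by auto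
  let ?q = "\<lambda>v \<mu>. v powr (- \<alpha>) *\<^sub>R J \<mu> (J (\<mu> * v) x)"
  have qc: "continuous_on ({1 / N..N} \<times> {m..l}) (\<lambda>(v, \<mu>). ?q v \<mu>)"
    unfolding case_prod_beta using N m
    by (intro continuous_intros continuous_on_J_compose)
       (auto intro!: mult_nonneg_nonneg intro: order_trans[of 0 "1 / N"] order_trans[of 0 m])
  have inner: "norm (integral {1 / N..N} (\<lambda>v. ?q v \<mu>)) \<le> K * (l powr \<alpha> / m) * (\<epsilon> / C)" if "\<mu> \<in> {m..l}" for \<mu>
  proof -
    have \<mu>: "0 < \<mu>" "m \<le> \<mu>" "\<mu> \<le> l" using that m by auto
    define I where "I = integral {\<mu> / N..\<mu> * N} (\<lambda>s. s powr (- \<alpha>) *\<^sub>R J s x)"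
    have "((\<lambda>s. s powr (- \<alpha>) *\<^sub>R J s x) has_integral I) {\<mu> / N..\<mu> * N}"
      unfolding I_def using \<mu> N
      by (intro integrable_integral integrable_continuous_real continuous_on_subset[OF Q_integrand_continuous])
         (auto intro: less_le_trans[rotated])
    \<comment> \<open>Substitution \<open>s = \<mu> v\<close>, which leaves the factor
      \<open>\<mu> powr \<alpha> / \<mu>\<close>.\<close>
    from has_integral_stretch_real[OF this, of \<mu>]
    have "((\<lambda>v. (\<mu> * v) powr (- \<alpha>) *\<^sub>R J (\<mu> * v) x) has_integral (1 / \<mu>) *\<^sub>R I) ((\<lambda>s. s / \<mu>) ` {\<mu> / N..\<mu> * N})"
      using \<mu> by simp
    moreover have "(\<lambda>s. s / \<mu>) ` {\<mu> / N..\<mu> * N} = {1 / N..N}"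
      using \<mu> by (auto simp: image_iff field_simps intro!: bexI[of _ "_ * \<mu>"])
    ultimately have "((\<lambda>v. \<mu> powr \<alpha> *\<^sub>R (\<mu> * v) powr (- \<alpha>) *\<^sub>R J (\<mu> * v) x) has_integral \<mu> powr \<alpha> *\<^sub>R (1 / \<mu>) *\<^sub>R I) {1 / N..N}"
      by (intro has_integral_cmul) simp
    then have "((\<lambda>v. v powr (- \<alpha>) *\<^sub>R J (\<mu> * v) x) has_integral (\<mu> powr \<alpha> / \<mu>) *\<^sub>R I) {1 / N..N}"
      by (rule has_integral_eq_rhs[OF has_integral_eq[rotated]])
         (use \<mu> N in \<open>auto simp: powr_mult powr_minus field_simps\<close>)
    from has_integral_linear[OF this bounded_linear_J[of \<mu>]]
    have "((\<lambda>v. ?q v \<mu>) has_integral J \<mu> ((\<mu> powr \<alpha> / \<mu>) *\<^sub>R I)) {1 / N..N}"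
      using \<mu> by (simp add: o_def linear_scale[OF linear_J])
    then have "norm (integral {1 / N..N} (\<lambda>v. ?q v \<mu>)) \<le> K * norm ((\<mu> powr \<alpha> / \<mu>) *\<^sub>R I)"
      using norm_J'[of \<mu>] \<mu> by (simp only: integral_unique less_imp_le)
    also have "\<dots> = K * ((\<mu> powr \<alpha> / \<mu>) * norm I)" using \<mu> by simp
    also have "\<dots> \<le> K * ((l powr \<alpha> / m) * (\<epsilon> / C))"
    proof (intro mult_left_mono mult_mono)
      show "\<mu> powr \<alpha> / \<mu> \<le> l powr \<alpha> / m"
        using \<mu> m \<alpha> by (intro frac_le powr_mono2) auto
      have "\<mu> / N \<le> 1 / n" using \<mu> N n(1) m
        by (simp add: field_simps) (smt (verit) mult_left_mono mult.commute)
      moreover have "n \<le> \<mu> * N"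
      proof -
        have "n \<le> m * N" using N(3) m by (simp add: field_simps)
        also have "\<dots> \<le> \<mu> * N" using \<mu> N by (intro mult_right_mono) auto
        finally show ?thesis .
      qed
      ultimately show "norm I \<le> \<epsilon> / C"
        using n(2)[of "\<mu> / N" "\<mu> * N" "\<lambda>s. s powr (- \<alpha>) *\<^sub>R J s x"] Q_integrand_continuous Q_integrand_bound \<mu> N Q0
        unfolding I_def Q_def by simp
    qed (use K_pos m in auto)
    finally show ?thesis by (simp add: mult_ac)
  qed
  have "integral {1 / N..N} (\<lambda>v. v powr (- \<alpha>) *\<^sub>R W x m l v) = integral {1 / N..N} (\<lambda>v. integral {m..l} (?q v))"
    unfolding W_def by (simp only: Henstock_Kurzweil_Integration.integral_cmul)
  also have "\<dots> = integral {m..l} (\<lambda>\<mu>. integral {1 / N..N} (\<lambda>v. ?q v \<mu>))"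
    using integral_swap_continuous[of "1 / N" m N l ?q] qc by (simp add: cbox_Pair_eq box_real)
  also have "norm \<dots> \<le> integral {m..l} (\<lambda>_. K * (l powr \<alpha> / m) * (\<epsilon> / C))"
  proof (rule integral_norm_bound_integral)
    have "continuous_on ({m..l} \<times> cbox (1 / N) N) (\<lambda>(\<mu>, v). ?q v \<mu>)"
      using continuous_on_compose2[OF qc continuous_on_swap, of "{m..l} \<times> {1 / N..N}"]
      by (force simp: box_real case_prod_beta prod.swap_def)
    from integral_continuous_on_param[OF this]
    show "(\<lambda>\<mu>. integral {1 / N..N} (\<lambda>v. ?q v \<mu>)) integrable_on {m..l}"
      by (intro integrable_continuous_real) (simp add: box_real)
  qed (use inner in auto)
  also have "\<dots> = (l - m) * (K * (l powr \<alpha> / m)) / C * \<epsilon>" using m by simp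
  also have "\<dots> \<le> 1 * \<epsilon>"
  proof (rule mult_right_mono)
    have "(l - m) * (K * (l powr \<alpha> / m)) \<le> C" unfolding C_def by simp
    then show "(l - m) * (K * (l powr \<alpha> / m)) / C \<le> 1" using C by (simp only: divide_le_eq_1_pos)
  qed (use \<open>0 < \<epsilon>\<close> in simp)
  finally show ?thesis using that N(1) by simp
qed

text \<open>The truncated integral of \<open>k v *\<^sub>R y\<close> has norm at least
  \<open>ln 2 / 6 * norm y\<close>, because \<open>k\<close> is nonnegative and bounded below on
  \<open>{2..3}\<close>. The same integral is within \<open>B m l * integral {0<..} g\<close> of the
  integral of \<open>W\<close>, which can be made arbitrarily small. Both errors vanish in the
  limit, so \<open>y = J 0 x\<close> is zero and \<open>x = \<Lambda> y\<close> as well.\<close>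

lemma Q_eq_0_imp:
  assumes \<alpha>: "0 < \<alpha>" "\<alpha> < 1" and Q0: "Q \<alpha> x = 0"
  shows "x = 0"
proof -
  \<comment> \<open>Integrability of \<open>g\<close> needs \<open>\<alpha> + e < 1\<close> at
    \<open>0\<close> and \<open>e < \<alpha>\<close> at infinity.\<close>
  define e where "e = min \<alpha> (1 - \<alpha>) / 2"
  have e: "0 < e" "e \<le> 1" "e < \<alpha>" "\<alpha> + e < 1" unfolding e_def using \<alpha> by (auto simp: min_def field_simps)
  define g where "g v = (if v < 1 then v powr (- \<alpha> - e) else v powr (- \<alpha> + e - 1))" for v :: real
  have g: "g integrable_on {0<..}"
    unfolding g_def by (rule integrable_two_powers) (use e in auto)
  define y where "y = J 0 x"
  define B where "B m l = (K * norm y * m powr e + K * norm x * l powr (- e)) / e" for m l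
  define k where "k v = v powr (- \<alpha>) * (ln v / (v - 1))" for v
  have k_pos: "0 \<le> k v" if "0 < v" for v
  proof -
    have "0 \<le> ln v / (v - 1)"
      using that by (cases "1 \<le> v") (auto intro: divide_nonneg_nonneg divide_nonpos_nonpos)
    then show ?thesis unfolding k_def by (intro mult_nonneg_nonneg) auto
  qed
  \<comment> \<open>On \<open>{2..3}\<close> the power is at least \<open>1 / 3\<close>, the
    logarithm at least \<open>ln 2\<close>, and \<open>v - 1\<close> at most
    \<open>2\<close>.\<close>
  have k_large: "ln 2 / 6 \<le> k v" if "v \<in> {2..3}" for v
  proof -
    have "v powr (- 1) \<le> v powr (- \<alpha>)" using that \<alpha> by (intro powr_mono) auto
    moreover have "1 / 3 \<le> v powr (- 1)" using that by (simp add: powr_minus field_simps)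
    ultimately have "1 / 3 \<le> v powr (- \<alpha>)" by (rule order_trans[rotated])
    moreover have "ln 2 / 2 \<le> ln v / (v - 1)" using that by (intro frac_le) auto
    ultimately have "1 / 3 * (ln 2 / 2) \<le> k v" unfolding k_def by (rule mult_mono) auto
    then show ?thesis by simp
  qed
  have main: "ln 2 / 6 * norm y \<le> \<epsilon> + B m l * integral {0<..} g" if h: "0 < m" "m \<le> l" "0 < \<epsilon>" for m l \<epsilon>
  proof -
    obtain N where N: "3 \<le> N" and small: "norm (integral {1 / N..N} (\<lambda>v. v powr (- \<alpha>) *\<^sub>R W x m l v)) \<le> \<epsilon>"
      using W_integral_tendsto_0[OF \<alpha> Q0 h] .
    have pos: "0 < v" if "v \<in> {1 / N..N}" for v
      using that N less_le_trans[of 0 "1 / N" v] by simp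
    have "{1 / N..N} \<subseteq> {0<..}" by (rule subsetI) (simp only: greaterThan_iff pos)
    from integrable_cmul[OF integrable_on_subinterval[OF g this], of "B m l"]
    have gi: "(\<lambda>v. B m l * g v) integrable_on {1 / N..N}" by simp
    have N2: "1 / N \<le> 2" using N by (simp add: divide_le_eq)
    have ki: "k integrable_on {1 / N..N}"
      unfolding k_def using N by (intro ln_kernel_integrable) auto
    have kyi: "(\<lambda>v. k v *\<^sub>R y) integrable_on {1 / N..N}"
      using integrable_linear[OF ki bounded_linear_scaleR_left[of y]] by (simp add: o_def)
    have "continuous_on ({1 / N..N} \<times> cbox m l) (\<lambda>(v, \<mu>). J \<mu> (J (\<mu> * v) x))"
      unfolding case_prod_beta using \<open>0 < m\<close> pos
      by (intro continuous_intros continuous_on_J_compose) (fastforce intro!: mult_nonneg_nonneg less_imp_le simp: box_real)+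
    from integral_continuous_on_param[OF this]
    have "continuous_on {1 / N..N} (W x m l)" unfolding W_def by (simp add: box_real)
    then have Wi: "(\<lambda>v. v powr (- \<alpha>) *\<^sub>R W x m l v) integrable_on {1 / N..N}"
      using pos N by (intro integrable_continuous_real continuous_intros) auto
    \<comment> \<open>At \<open>v = 1\<close> the formula for \<open>k\<close> does not give the
      limit value, so the estimate of \<open>W\<close> excludes this point; there the difference is
      replaced by \<open>0\<close>.\<close>
    let ?r = "\<lambda>v. if v = 1 then 0 else v powr (- \<alpha>) *\<^sub>R W x m l v - k v *\<^sub>R y"
    have ri: "?r integrable_on {1 / N..N}"
      by (rule integrable_spike[OF integrable_diff[OF Wi kyi], where S="{1}"]) auto
    have "ln 2 / 6 = integral {2..3} (\<lambda>_::real. ln 2 / 6 :: real)" by simp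
    also have "\<dots> \<le> integral {2..3} k"
      using N N2 by (intro integral_le k_large integrable_on_subinterval[OF ki]) auto
    also have "\<dots> \<le> integral {1 / N..N} k"
      using N N2 by (intro integral_subset_le ki integrable_on_subinterval[OF ki] ballI k_pos pos) auto
    finally have "ln 2 / 6 \<le> \<bar>integral {1 / N..N} k\<bar>" by linarith
    then have "ln 2 / 6 * norm y \<le> norm (integral {1 / N..N} k *\<^sub>R y)"
      unfolding norm_scaleR by (rule mult_right_mono) simp
    also have "integral {1 / N..N} k *\<^sub>R y = integral {1 / N..N} (\<lambda>v. k v *\<^sub>R y)"
      using integral_linear[OF ki bounded_linear_scaleR_left[of y]] by (simp add: o_def)
    also have "\<dots> = integral {1 / N..N} (\<lambda>v. v powr (- \<alpha>) *\<^sub>R W x m l v) - integral {1 / N..N} (\<lambda>v. v powr (- \<alpha>) *\<^sub>R W x m l v - k v *\<^sub>R y)"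
      using Henstock_Kurzweil_Integration.integral_diff[OF Wi kyi] by simp
    also have "integral {1 / N..N} (\<lambda>v. v powr (- \<alpha>) *\<^sub>R W x m l v - k v *\<^sub>R y) = integral {1 / N..N} ?r"
      by (rule integral_spike[where S="{1}"]) auto
    also have "norm (integral {1 / N..N} (\<lambda>v. v powr (- \<alpha>) *\<^sub>R W x m l v) - integral {1 / N..N} ?r)
        \<le> \<epsilon> + norm (integral {1 / N..N} ?r)"
      using norm_triangle_ineq4 small by (meson add_right_mono order_trans)
    also have "norm (integral {1 / N..N} ?r) \<le> integral {1 / N..N} (\<lambda>v. B m l * g v)"
    proof (rule integral_norm_bound_integral[OF ri gi])
      fix v assume "v \<in> {1 / N..N}"
      then have v: "0 < v" by (rule pos)
      have B: "0 \<le> B m l" unfolding B_def using K_pos e by simp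
      show "norm (?r v) \<le> B m l * g v"
      proof (cases "v = 1")
        case True
        then show ?thesis using B unfolding g_def by simp
      next
        case False
        have "?r v = v powr (- \<alpha>) *\<^sub>R (W x m l v - (ln v / (v - 1)) *\<^sub>R y)"
          using False unfolding k_def by (simp add: scaleR_diff_right)
        then have "norm (?r v) = v powr (- \<alpha>) * norm (W x m l v - (ln v / (v - 1)) *\<^sub>R y)"
          by (simp only: norm_scaleR abs_of_nonneg powr_ge_zero)
        also have "\<dots> \<le> v powr (- \<alpha>) * (B m l * (if v < 1 then v powr (- e) else v powr (e - 1)))"
          unfolding B_def y_def
          using W_estimate[OF \<open>0 < m\<close> \<open>m \<le> l\<close> v False e(1,2), of x] by (intro mult_left_mono) auto
        also have "\<dots> = B m l * g v"
          unfolding g_def using v by (simp add: powr_diff powr_add powr_minus field_simps)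
        finally show ?thesis .
      qed
    qed
    also have "\<dots> \<le> integral {0<..} (\<lambda>v. B m l * g v)"
    proof (rule integral_subset_le[OF _ gi])
      show "(\<lambda>v. B m l * g v) integrable_on {0<..}"
        using integrable_cmul[OF g, of "B m l"] by simp
    qed (use pos K_pos e in \<open>auto simp: B_def g_def\<close>)
    finally show ?thesis by simp
  qed
  \<comment> \<open>The three parameters move together: \<open>m = 1 / Suc n\<close>,
    \<open>l = Suc n\<close> and \<open>\<epsilon> = 1 / Suc n\<close>.\<close>
  have "(\<lambda>n. 1 / real (Suc n) + B (1 / real (Suc n)) (real (Suc n)) * integral {0<..} g) \<longlonglongrightarrow> 0 + (K * norm y * 0 + K * norm x * 0) / e * integral {0<..} g"
  proof -
    have lim: "(\<lambda>n. real (Suc n) powr (- e)) \<longlonglongrightarrow> 0"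
      using tendsto_neg_powr[of "- e" "\<lambda>n. real (Suc n)" sequentially] e(1)
        filterlim_compose[OF filterlim_real_sequentially filterlim_Suc] by simp
    have "(1 / real (Suc n)) powr e = real (Suc n) powr (- e)" for n
      by (simp add: powr_divide powr_minus_divide del: of_nat_Suc)
    with lim have "(\<lambda>n. (1 / real (Suc n)) powr e) \<longlonglongrightarrow> 0" by (simp only:)
    then show ?thesis
      unfolding B_def using e(1) LIMSEQ_inverse_real_of_nat lim
      by (intro tendsto_intros) (auto simp: inverse_eq_divide)
  qed
  then have "ln 2 / 6 * norm y \<le> 0 + (K * norm y * 0 + K * norm x * 0) / e * integral {0<..} g"
    by (rule LIMSEQ_le_const) (intro exI allI impI main, auto simp: field_simps)
  then have "y = 0" by (simp add: mult_le_0_iff)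
  moreover have "0 *\<^sub>R y + \<Lambda> y = x" unfolding y_def by (rule J_solves) simp
  moreover have "\<Lambda> 0 = 0" using \<Lambda>_scale[of 0 0] subspace_0[OF subspace_D] by simp
  ultimately show "x = 0" by simp
qed

end

section \<open>The singular exponential kernel\<close>

text \<open>For \<open>c > 0\<close> and \<open>\<alpha> < 1\<close> this is Gamma(1 - \<alpha>)
  times \<open>c powr (\<alpha> - 1)\<close>. Dependence on \<open>c\<close> is kept because the
  stability estimate uses the weakened rate \<open>\<beta> - \<omega>\<close>.\<close>

definition kernel_mass :: "real \<Rightarrow> real \<Rightarrow> real" where
  "kernel_mass \<alpha> c = integral {0<..} (\<lambda>s. s powr (- \<alpha>) * exp (- c * s))"

context
  fixes \<alpha> :: real
  assumes \<alpha>: "0 \<le> \<alpha>" "\<alpha> < 1"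
begin

text \<open>One dominator for all rates \<open>d \<ge> c\<close>, from the quadratic lower bound of
  the exponential function. Uniformity in \<open>d\<close> gives continuity of the mass in the
  rate.\<close>

lemma kernel_le:
  assumes "0 < c" "c \<le> d" "0 < s"
  shows "s powr (- \<alpha>) * exp (- d * s) \<le> max 1 (2 / c\<^sup>2) * (if s < 1 then s powr (- \<alpha>) else s powr (- 2))"
proof -
  have e: "exp (- d * s) \<le> exp (- c * s)" using assms by simp
  show ?thesis
  proof (cases "s < 1")
    case True
    have "exp (- d * s) \<le> max 1 (2 / c\<^sup>2)" using assms by (simp add: le_max_iff_disj)
    then show ?thesis using True by (simp add: mult.commute mult_left_mono del: max.bounded_iff)
  next
    case False
    have "(c * s)\<^sup>2 / 2 \<le> exp (c * s)"
      using exp_lower_Taylor_quadratic[of "c * s"] mult_pos_pos[of c s] assms by linarith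
    then have "exp (- c * s) \<le> 2 / c\<^sup>2 * s powr (- 2)"
      using assms by (simp add: exp_minus field_simps powr_minus power_mult_distrib)
    with e have "exp (- d * s) \<le> max 1 (2 / c\<^sup>2) * s powr (- 2)"
      by (rule order_trans[OF order_trans]) (rule mult_right_mono, auto)
    moreover have "s powr (- \<alpha>) \<le> 1" using False \<alpha> powr_mono2'[of "- \<alpha>" 1 s] by simp
    ultimately have "s powr (- \<alpha>) * exp (- d * s) \<le> 1 * (max 1 (2 / c\<^sup>2) * s powr (- 2))"
      by (intro mult_mono) auto
    then show ?thesis using False by simp
  qed
qed

lemma kernel_dominator_integrable:
  "(\<lambda>s. max 1 (2 / c\<^sup>2) * (if s < 1 then s powr (- \<alpha>) else s powr (- 2))) integrable_on {0<..}"
  using integrable_cmul[OF integrable_two_powers[of "- \<alpha>" "- 2"], of "max 1 (2 / c\<^sup>2)"] \<alpha> by simp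

lemma kernel_continuous: "continuous_on {0<..} (\<lambda>s. s powr (- \<alpha>) * exp (- c * s))"
  by (intro continuous_intros) auto

lemma kernel_integrable:
  assumes "0 < c"
  shows "(\<lambda>s. s powr (- \<alpha>) * exp (- c * s)) integrable_on {0<..}"
  by (rule dominated_integrable_Ioi[OF kernel_continuous _ kernel_dominator_integrable[of c]])
     (use kernel_le[OF assms order_refl] in \<open>auto simp: abs_mult\<close>)

lemma kernel_has_integral:
  "0 < c \<Longrightarrow> ((\<lambda>s. s powr (- \<alpha>) * exp (- c * s)) has_integral kernel_mass \<alpha> c) {0<..}"
  unfolding kernel_mass_def by (rule integrable_integral[OF kernel_integrable])

lemma continuous_on_kernel_mass:
  assumes "0 < c"
  shows "continuous_on {c..} (kernel_mass \<alpha>)"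
  unfolding kernel_mass_def
proof (rule continuous_on_integral_Ioi[OF _ _ kernel_dominator_integrable[of c]])
  show "continuous_on ({c..} \<times> {0<..}) (\<lambda>(d, s). s powr (- \<alpha>) * exp (- d * s))"
    unfolding case_prod_beta by (intro continuous_intros) auto
qed (use kernel_le[OF assms] in \<open>auto simp: abs_mult\<close>)

lemma kernel_integral_Icc:
  assumes "0 < c"
  shows "(\<lambda>s. s powr (- \<alpha>) * exp (- c * s)) integrable_on {0..t}"
    and "integral {0..t} (\<lambda>s. s powr (- \<alpha>) * exp (- c * s)) \<le> kernel_mass \<alpha> c"
proof -
  let ?h = "\<lambda>s. s powr (- \<alpha>) * exp (- c * s)"
  have null: "negligible {s \<in> {0<..} - {0..}. ?h s \<noteq> 0}" "negligible {s \<in> {0..} - {0<..}. ?h s \<noteq> 0}"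
    by (rule negligible_subset[of "{0}"]; auto)+
  have i: "?h integrable_on {0..}"
    by (rule integrable_spike_set[OF kernel_integrable[OF assms] null])
  have eq: "integral {0..} ?h = kernel_mass \<alpha> c"
    unfolding kernel_mass_def by (rule integral_spike_set[OF null(2,1)])
  show "(\<lambda>s. s powr (- \<alpha>) * exp (- c * s)) integrable_on {0..t}"
    by (rule integrable_on_subinterval[OF i]) auto
  then show "integral {0..t} (\<lambda>s. s powr (- \<alpha>) * exp (- c * s)) \<le> kernel_mass \<alpha> c"
    unfolding eq[symmetric] by (intro integral_subset_le i) auto
qed

text \<open>A lower bound on \<open>{1..2}\<close> suffices. Positivity lets the denominator in the
  hypothesis on \<open>L\<close> be cleared.\<close>

lemma kernel_mass_pos: assumes "0 < c" shows "0 < kernel_mass \<alpha> c"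
proof -
  have "exp (- 2 * c) / 2 \<le> s powr (- \<alpha>) * exp (- c * s)" if "s \<in> {1..2}" for s
  proof -
    have "s powr (- 1) \<le> s powr (- \<alpha>)" using that \<alpha> by (intro powr_mono) auto
    moreover have "1 / 2 \<le> s powr (- 1)" using that by (simp add: powr_minus field_simps)
    ultimately have "1 / 2 \<le> s powr (- \<alpha>)" by (rule order_trans[rotated])
    moreover have "exp (- 2 * c) \<le> exp (- c * s)" using that assms by simp
    ultimately have "1 / 2 * exp (- 2 * c) \<le> s powr (- \<alpha>) * exp (- c * s)" by (rule mult_mono) auto
    then show ?thesis by simp
  qed
  then have "integral {1..2} (\<lambda>_::real. exp (- 2 * c) / 2) \<le> integral {1..2} (\<lambda>s. s powr (- \<alpha>) * exp (- c * s))"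
    by (intro integral_le integrable_on_subinterval[OF kernel_integrable[OF assms]]) auto
  also have "\<dots> \<le> integral {0..2} (\<lambda>s. s powr (- \<alpha>) * exp (- c * s))"
    by (intro integral_subset_le kernel_integral_Icc[OF assms] integrable_on_subinterval[OF kernel_integrable[OF assms]]) auto
  also have "\<dots> \<le> kernel_mass \<alpha> c" by (rule kernel_integral_Icc[OF assms])
  finally show ?thesis by simp (smt (verit) exp_gt_zero)
qed

text \<open>Reversal of time turns the integrals under the supremum into truncations of the mass,
  which approximate it. The mass in turn bounds them all, so the supremum is a genuine one.\<close>

lemma kernel_mass_le_kappa0:
  assumes "0 < c"
  shows "kernel_mass \<alpha> c \<le> kappa0 \<alpha> c"
proof (rule field_le_epsilon)
  fix e :: real assume "0 < e"
  let ?h = "\<lambda>s. s powr (- \<alpha>) * exp (- c * s)"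
  have pos: "0 \<le> ?h s" for s by simp
  obtain n where n: "0 < n" "\<And>a b (f :: real \<Rightarrow> real). 0 < a \<Longrightarrow> a \<le> 1 / n \<Longrightarrow> n \<le> b \<Longrightarrow>
      continuous_on {0<..} f \<Longrightarrow> (\<And>s. 0 < s \<Longrightarrow> norm (f s) \<le> ?h s) \<Longrightarrow>
      norm (integral {a..b} f - integral {0<..} f) < e"
    using integral_Icc_uniform_limit_Ioi[OF kernel_integrable[OF assms] pos \<open>0 < e\<close>, where 'a=real] by blast
  have "norm (integral {1 / n..n} ?h - integral {0<..} ?h) < e"
    by (rule n(2)[OF _ _ _ kernel_continuous]) (use n(1) in auto)
  then have "kernel_mass \<alpha> c \<le> integral {1 / n..n} ?h + e"
    unfolding kernel_mass_def by (simp add: abs_less_iff)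
  also have "integral {1 / n..n} ?h \<le> integral {0..n} ?h"
    using n(1) by (intro integral_subset_le kernel_integral_Icc[OF assms] integrable_on_subinterval[OF kernel_integral_Icc(1)[OF assms]]) auto
  also have "integral {0..n} ?h = integral {0..n} (\<lambda>s. ?h (n - s))"
    using integral_flip[of 0 n ?h] by simp
  also have "\<dots> \<le> kappa0 \<alpha> c"
    unfolding kappa0_def
  proof (rule cSUP_upper)
    show "bdd_above ((\<lambda>t. integral {0..t} (\<lambda>s. ?h (t - s))) ` {0..})"
      using integral_flip[of 0 _ ?h] kernel_integral_Icc(2)[OF assms] by (intro bdd_aboveI2) auto
  qed (use n(1) in auto)
  finally show "kernel_mass \<alpha> c \<le> kappa0 \<alpha> c + e" by simp
qed

end

section \<open>Sectorial operators\<close>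

text \<open>At a real point \<open>- s\<close> the complexified operator is diagonal: it acts on
  both components as the negative of \<open>s + \<Lambda>\<close>. Diagonal pairs give injectivity,
  first components surjectivity, and pairs with second component \<open>0\<close> the norm
  bound.\<close>

lemma resolvent_real:
  fixes \<Lambda> :: "'x::banach \<Rightarrow> 'x"
  assumes lin: "linear_operator D \<Lambda>" and s: "complex_of_real (- s) \<in> resolvent_set D \<Lambda>"
  shows "bij_betw (\<lambda>y. s *\<^sub>R y + \<Lambda> y) D UNIV"
    and "norm (inv_into D (\<lambda>y. s *\<^sub>R y + \<Lambda> y) x) \<le> onorm (resolvent D \<Lambda> (complex_of_real (- s))) * norm x"
proof -
  let ?g = "\<lambda>y. s *\<^sub>R y + \<Lambda> y"
  let ?z = "complex_of_real (- s)"
  have shift: "cshift \<Lambda> ?z (x, y) = (- ?g x, - ?g y)" for x y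
    unfolding cshift_def by simp
  have bij: "bij_betw (cshift \<Lambda> ?z) (D \<times> D) UNIV" and bl: "bounded_linear (resolvent D \<Lambda> ?z)"
    using s unfolding resolvent_set_def by auto
  show bg: "bij_betw ?g D UNIV"
    unfolding bij_betw_def
  proof
    show "inj_on ?g D"
    proof (rule inj_onI)
      fix x y assume "x \<in> D" "y \<in> D" "?g x = ?g y"
      then have "cshift \<Lambda> ?z (x, x) = cshift \<Lambda> ?z (y, y)" unfolding shift by simp
      then show "x = y" using bij_betw_imp_inj_on[OF bij] \<open>x \<in> D\<close> \<open>y \<in> D\<close> by (auto dest: inj_onD)
    qed
    have "w \<in> ?g ` D" for w
    proof -
      have "(- w, 0) \<in> cshift \<Lambda> ?z ` (D \<times> D)" using bij unfolding bij_betw_def by auto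
      then obtain x y where "x \<in> D" "(- w, 0) = cshift \<Lambda> ?z (x, y)" by auto
      then have "- w = - ?g x" unfolding shift by (simp only: prod.inject)
      then have "w = ?g x" by (simp only: neg_equal_iff_equal)
      then show ?thesis using \<open>x \<in> D\<close> by blast
    qed
    then show "?g ` D = UNIV" by auto
  qed
  have D0: "0 \<in> D" and \<Lambda>0: "\<Lambda> 0 = 0"
    using lin subspace_0[of D] unfolding linear_operator_def by (auto, metis scaleR_zero_left)
  define y where "y = inv_into D ?g x"
  have y: "y \<in> D" "?g y = x"
    unfolding y_def using bg inv_into_into[of x ?g D] f_inv_into_f[of x ?g D] by (auto simp: bij_betw_def)
  \<comment> \<open>The sign comes from \<open>z - \<Lambda> = - (s + \<Lambda>)\<close> at
    \<open>z = - s\<close>.\<close>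
  have "resolvent D \<Lambda> ?z (- x, 0) = (y, 0)"
    unfolding resolvent_def
  proof (rule inv_into_f_eq)
    show "cshift \<Lambda> ?z (y, 0) = (- x, 0)" unfolding shift by (simp only: y \<Lambda>0) simp
  qed (use bij y D0 in \<open>auto simp: bij_betw_def\<close>)
  then have "norm (y, 0::'x) \<le> onorm (resolvent D \<Lambda> ?z) * norm (- x, 0::'x)"
    using onorm[OF bl, of "(- x, 0)"] by simp
  then show "norm (inv_into D ?g x) \<le> onorm (resolvent D \<Lambda> ?z) * norm x"
    unfolding y_def by (simp add: norm_Pair)
qed

text \<open>For large \<open>s\<close> the point \<open>- s - a\<close> lies on the ray left of the
  vertex \<open>b\<close>, inside the sector where the resolvent estimate of \<open>A\<close> holds.
  The remaining compact range of \<open>s\<close> is covered by local boundedness of the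
  resolvent.\<close>

lemma sectorial_imp_positive_operator:
  fixes A :: "'x::banach \<Rightarrow> 'x"
  assumes "sectorial D A" and \<Lambda>: "\<Lambda> = (\<lambda>x. A x + a *\<^sub>R x)" and spec: "\<forall>z\<in>spectrum D \<Lambda>. Re z > 0"
  obtains K where "positive_operator D \<Lambda> K"
proof -
  obtain \<phi> K b where linA: "linear_operator D A" and \<phi>: "\<phi> < pi / 2" and K: "1 \<le> K"
    and sect: "\<And>z. z \<noteq> complex_of_real b \<Longrightarrow> \<phi> \<le> \<bar>Arg (z - complex_of_real b)\<bar> \<Longrightarrow>
           onorm (resolvent D A z) \<le> K / cmod (z - complex_of_real b)"
    using assms(1) unfolding sectorial_def by blast
  have lin: "linear_operator D \<Lambda>"
    using linA unfolding linear_operator_def \<Lambda> by (simp add: algebra_simps)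
  let ?g = "\<lambda>s y. s *\<^sub>R y + \<Lambda> y"
  define N where "N s = onorm (resolvent D \<Lambda> (complex_of_real (- s)))" for s
  have mem: "complex_of_real (- s) \<in> resolvent_set D \<Lambda>" if "0 \<le> s" for s
    using spec that unfolding spectrum_def by (metis ComplI Re_complex_of_real neg_0_less_iff_less not_less)
  note bij = resolvent_real(1)[OF lin mem]
  have bound: "norm (inv_into D (?g s) x) \<le> N s * norm x" if "0 \<le> s" for s x
    unfolding N_def by (rule resolvent_real(2)[OF lin mem[OF that]])
  have N_nonneg: "0 \<le> N s" if "0 \<le> s" for s
    unfolding N_def using mem[OF that] onorm_pos_le unfolding resolvent_set_def by auto
  \<comment> \<open>The distance from \<open>- s - a\<close> to the vertex is
    \<open>s + a + b\<close>; it is at least \<open>(1 + s) / 2\<close> as soon as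
    \<open>s \<ge> 1 + 2 * c\<close>.\<close>
  define c where "c = \<bar>a + b\<bar>"
  have large: "N s \<le> 2 * K / (1 + s)" if s: "1 + 2 * c \<le> s" for s
  proof -
    let ?z = "complex_of_real (- s - a)"
    have sab: "(1 + s) / 2 \<le> s + a + b" using s unfolding c_def by (auto simp: abs_if split: if_splits)
    have "0 \<le> 1 + 2 * c" unfolding c_def by simp
    then have s0: "0 \<le> s" using s by (rule order_trans)
    have "cshift \<Lambda> (complex_of_real (- s)) = cshift A ?z"
      unfolding cshift_def \<Lambda> by (auto simp: algebra_simps)
    then have "N s = onorm (resolvent D A ?z)" unfolding N_def resolvent_def by simp
    also have "\<dots> \<le> K / cmod (?z - complex_of_real b)"
    proof (rule sect)
      have eq: "?z - complex_of_real b = complex_of_real (- (s + a + b))" by simp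
      have "Arg (?z - complex_of_real b) = pi"
        unfolding eq using sab s0 by (subst Arg_of_real) auto
      moreover have "\<phi> \<le> \<bar>pi\<bar>" using \<phi> pi_gt_zero by linarith
      ultimately show "\<phi> \<le> \<bar>Arg (?z - complex_of_real b)\<bar>" by (simp only:)
      show "?z \<noteq> complex_of_real b" using eq sab s0 by (metis diff_self of_real_eq_0_iff add_nonneg_pos divide_pos_pos less_le_trans less_numeral_extra(1) less_irrefl neg_equal_0_iff_equal zero_less_numeral add.commute)
    qed
    also have "cmod (?z - complex_of_real b) = s + a + b"
    proof -
      have "?z - complex_of_real b = complex_of_real (- (s + a + b))" by simp
      then show ?thesis using sab s0 by (simp only: norm_of_real) simp
    qed
    also have "K / (s + a + b) \<le> K / ((1 + s) / 2)"
      using sab s0 K by (intro divide_left_mono) auto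
    finally show ?thesis by (simp add: mult.commute)
  qed
  \<comment> \<open>Bisection reduces a common bound on the compact range to a bound near each
    point.\<close>
  have "\<exists>C. \<forall>s\<in>{0..1 + 2 * c}. 0 \<le> s \<longrightarrow> (\<forall>x. norm (inv_into D (?g s) x) \<le> C * norm x)"
  proof (rule Bolzano[where P="\<lambda>u v. \<exists>C. \<forall>s\<in>{u..v}. 0 \<le> s \<longrightarrow> (\<forall>x. norm (inv_into D (?g s) x) \<le> C * norm x)"])
    show "0 \<le> 1 + 2 * c" unfolding c_def by simp
  next
    fix u v w
    assume "\<exists>C. \<forall>s\<in>{u..v}. 0 \<le> s \<longrightarrow> (\<forall>x. norm (inv_into D (?g s) x) \<le> C * norm x)"
      and "\<exists>C. \<forall>s\<in>{v..w}. 0 \<le> s \<longrightarrow> (\<forall>x. norm (inv_into D (?g s) x) \<le> C * norm x)"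
    then obtain C1 C2 where C: "\<And>s x. s \<in> {u..v} \<Longrightarrow> 0 \<le> s \<Longrightarrow> norm (inv_into D (?g s) x) \<le> C1 * norm x"
      "\<And>s x. s \<in> {v..w} \<Longrightarrow> 0 \<le> s \<Longrightarrow> norm (inv_into D (?g s) x) \<le> C2 * norm x" by blast
    have "norm (inv_into D (?g s) x) \<le> max C1 C2 * norm x" if "s \<in> {u..w}" "0 \<le> s" for s x
    proof -
      have "C1 * norm x \<le> max C1 C2 * norm x" "C2 * norm x \<le> max C1 C2 * norm x"
        by (auto intro: mult_right_mono)
      moreover have "s \<in> {u..v} \<or> s \<in> {v..w}" using that by auto
      ultimately show ?thesis using C that(2) order_trans by blast
    qed
    then show "\<exists>C. \<forall>s\<in>{u..w}. 0 \<le> s \<longrightarrow> (\<forall>x. norm (inv_into D (?g s) x) \<le> C * norm x)" by blast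
  next
    fix s0 assume "0 \<le> s0" "s0 \<le> 1 + 2 * c"
    \<comment> \<open>Chosen so that \<open>N s0 * d \<le> 1 / 2\<close>: the perturbation term is
      absorbed in the left side and the bound at most doubles.\<close>
    define d where "d = 1 / (2 * (N s0 + 1))"
    have d: "0 < d" unfolding d_def using N_nonneg[OF \<open>0 \<le> s0\<close>] by simp
    have "norm (inv_into D (?g s) x) \<le> 2 * N s0 * norm x"
      if "u \<le> s0" "s0 \<le> v" "v - u < d" "s \<in> {u..v}" "0 \<le> s" for u v s x
    proof -
      define y where "y = inv_into D (?g s) x"
      have y: "y \<in> D" "?g s y = x"
        unfolding y_def using bij[OF \<open>0 \<le> s\<close>] inv_into_into[of x "?g s" D] f_inv_into_f[of x "?g s" D]
        by (auto simp: bij_betw_def)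
      have "?g s0 y = x + (s0 - s) *\<^sub>R y" using y(2) by (simp add: algebra_simps)
      then have "y = inv_into D (?g s0) (x + (s0 - s) *\<^sub>R y)"
        using bij[OF \<open>0 \<le> s0\<close>] y(1) inv_into_f_f[of "?g s0" D y] by (simp add: bij_betw_def)
      then have "norm y \<le> N s0 * norm (x + (s0 - s) *\<^sub>R y)"
        using bound[OF \<open>0 \<le> s0\<close>] by metis
      also have "\<dots> \<le> N s0 * (norm x + d * norm y)"
      proof (intro mult_left_mono N_nonneg \<open>0 \<le> s0\<close>)
        have "\<bar>s0 - s\<bar> \<le> d" using that by auto
        then have "norm ((s0 - s) *\<^sub>R y) \<le> d * norm y" by (simp add: mult_right_mono)
        then show "norm (x + (s0 - s) *\<^sub>R y) \<le> norm x + d * norm y"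
          using norm_triangle_ineq[of x "(s0 - s) *\<^sub>R y"] by linarith
      qed
      also have "\<dots> = N s0 * norm x + (N s0 * d) * norm y" by (simp add: algebra_simps)
      also have "(N s0 * d) * norm y \<le> 1 / 2 * norm y"
        using N_nonneg[OF \<open>0 \<le> s0\<close>] by (intro mult_right_mono) (auto simp: d_def field_simps)
      finally show ?thesis unfolding y_def by simp
    qed
    then have "\<forall>u v. u \<le> s0 \<and> s0 \<le> v \<and> v - u < d \<longrightarrow>
        (\<exists>C. \<forall>s\<in>{u..v}. 0 \<le> s \<longrightarrow> (\<forall>x. norm (inv_into D (?g s) x) \<le> C * norm x))" by blast
    with d show "\<exists>d>0. \<forall>u v. u \<le> s0 \<and> s0 \<le> v \<and> v - u < d \<longrightarrow>
        (\<exists>C. \<forall>s\<in>{u..v}. 0 \<le> s \<longrightarrow> (\<forall>x. norm (inv_into D (?g s) x) \<le> C * norm x))" by blast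
  qed
  then obtain C where "\<forall>s\<in>{0..1 + 2 * c}. 0 \<le> s \<longrightarrow> (\<forall>x. norm (inv_into D (?g s) x) \<le> C * norm x)" ..
  then have C: "\<And>s x. 0 \<le> s \<Longrightarrow> s \<le> 1 + 2 * c \<Longrightarrow> norm (inv_into D (?g s) x) \<le> C * norm x"
    by auto
  \<comment> \<open>The second entry compensates for the division by
    \<open>1 + s \<le> 2 + 2 * c\<close> on the compact range.\<close>
  define K' where "K' = max (2 * K) (C * (2 + 2 * c))"
  have "positive_operator D \<Lambda> K'"
  proof
    show "0 < K'" unfolding K'_def using K by simp
    fix s x assume s: "0 \<le> (s::real)"
    show "norm (inv_into D (?g s) x) \<le> K' / (1 + s) * norm x"
    proof (cases "s \<le> 1 + 2 * c")
      case True
      show ?thesis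
      proof (cases "0 \<le> C")
        case C0: True
        have "C * (1 + s) \<le> C * (2 + 2 * c)" using True C0 by (intro mult_left_mono) auto
        also have "\<dots> \<le> K'" unfolding K'_def by simp
        finally have "C \<le> K' / (1 + s)" using s by (simp add: field_simps)
        then show ?thesis using C[OF s True, of x] mult_right_mono[of C _ "norm x"] by fastforce
      next
        case False
        then have "C * norm x \<le> 0" by (simp add: mult_nonpos_nonneg)
        moreover have "0 \<le> K' / (1 + s) * norm x" using \<open>0 < K'\<close> s by simp
        ultimately show ?thesis using C[OF s True, of x] by linarith
      qed
    next
      case False
      then have "N s \<le> 2 * K / (1 + s)" by (intro large) simp
      also have "\<dots> \<le> K' / (1 + s)" unfolding K'_def using s by (intro divide_right_mono) auto
      finally show ?thesis using bound[OF s, of x] mult_right_mono[of "N s" _ "norm x"] by fastforce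
    qed
  qed (use lin bij in auto)
  then show ?thesis by (rule that)
qed

section \<open>The negative power as a bounded injective operator and its commutation
  properties\<close>

context positive_operator
begin

lemma neg_power_eq: "neg_power D \<Lambda> \<alpha> x = (if \<alpha> = 0 then x else (sin (pi * \<alpha>) / pi) *\<^sub>R Q \<alpha> x)"
  unfolding neg_power_def Q_def J_def by simp

lemma bounded_linear_neg_power:
  assumes "0 \<le> \<alpha>" "\<alpha> < 1"
  shows "bounded_linear (neg_power D \<Lambda> \<alpha>)"
proof (cases "\<alpha> = 0")
  case True
  then have "neg_power D \<Lambda> \<alpha> = (\<lambda>x. x)" by (auto simp: neg_power_eq)
  then show ?thesis by simp
next
  case False
  then have "neg_power D \<Lambda> \<alpha> = (\<lambda>x. (sin (pi * \<alpha>) / pi) *\<^sub>R Q \<alpha> x)" by (auto simp: neg_power_eq)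
  then show ?thesis
    using bounded_linear_compose[OF bounded_linear_scaleR_right bounded_linear_Q[of \<alpha>]] False assms by simp
qed

lemma inj_neg_power:
  assumes "0 \<le> \<alpha>" "\<alpha> < 1"
  shows "inj (neg_power D \<Lambda> \<alpha>)"
  unfolding linear_injective_0[OF bounded_linear.linear[OF bounded_linear_neg_power[OF assms]]]
proof (intro allI impI)
  fix x assume x: "neg_power D \<Lambda> \<alpha> x = 0"
  show "x = 0"
  proof (cases "\<alpha> = 0")
    case False
    then have "0 < sin (pi * \<alpha>)" using assms by (intro sin_gt_zero) auto
    then have "Q \<alpha> x = 0" using x False by (simp add: neg_power_eq)
    then show ?thesis using Q_eq_0_imp[of \<alpha> x] False assms by simp
  qed (use x in \<open>simp add: neg_power_eq\<close>)
qed

text \<open>Commuting with \<open>\<Lambda>\<close> on \<open>D\<close> implies commuting with each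
  \<open>J s\<close>, hence with Balakrishnan's integral. It is applied to the semigroup operators
  \<open>h = T t\<close>.\<close>

lemma neg_power_commute:
  assumes "0 \<le> \<alpha>" "\<alpha> < 1" "bounded_linear h" "\<And>y. y \<in> D \<Longrightarrow> h y \<in> D \<and> \<Lambda> (h y) = h (\<Lambda> y)"
  shows "h (neg_power D \<Lambda> \<alpha> x) = neg_power D \<Lambda> \<alpha> (h x)"
proof -
  interpret h: bounded_linear h by fact
  have "J s (h x) = h (J s x)" if "0 \<le> s" for s x
  proof (rule J_eqI[OF that])
    have "s *\<^sub>R h (J s x) + \<Lambda> (h (J s x)) = h (s *\<^sub>R J s x + \<Lambda> (J s x))"
      using assms(4)[OF J_mem[OF that]] by (simp add: h.add h.scaleR)
    then show "s *\<^sub>R h (J s x) + \<Lambda> (h (J s x)) = h x" using J_solves[OF that] by simp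
  qed (use assms(4) J_mem[OF that] in auto)
  then have "h (Q \<alpha> x) = Q \<alpha> (h x)" if "\<alpha> \<noteq> 0"
    using integral_Q_commute[OF _ assms(2,3)] that assms(1) by simp
  then show ?thesis by (simp add: neg_power_eq h.scaleR)
qed

end

text \<open>\<open>T t\<close> commutes with the difference quotients at \<open>y\<close>. Because
  the generator is given with its exact domain, convergence of the quotients at \<open>T t y\<close>
  yields membership in \<open>D\<close> together with the value.\<close>

lemma exp_semigroup_generator_commute:
  fixes T :: "real \<Rightarrow> 'x::banach \<Rightarrow> 'x"
  assumes T: "is_exp_semigroup D A T" and "0 \<le> t" "y \<in> D"
  shows "T t y \<in> D \<and> A (T t y) = T t (A y)"
proof -
  have bl: "bounded_linear (T t)" using T \<open>0 \<le> t\<close> unfolding is_exp_semigroup_def by blast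
  interpret bounded_linear "T t" by fact
  have gen: "((\<lambda>h. (T h x - x) /\<^sub>R h) \<longlongrightarrow> - z) (at_right 0) \<longleftrightarrow> x \<in> D \<and> z = A x" for x z
    using T unfolding is_exp_semigroup_def by blast
  have add: "T (s + t) x = T s (T t x)" if "0 \<le> s" "0 \<le> t" for s t x
    using T that unfolding is_exp_semigroup_def by blast
  have "((\<lambda>h. (T h y - y) /\<^sub>R h) \<longlongrightarrow> - A y) (at_right 0)" using gen \<open>y \<in> D\<close> by blast
  from tendsto[OF this]
  have "((\<lambda>h. T t ((T h y - y) /\<^sub>R h)) \<longlongrightarrow> - T t (A y)) (at_right 0)" by (simp add: linear_neg[OF linear_axioms])
  moreover have "\<forall>\<^sub>F h in at_right 0. T t ((T h y - y) /\<^sub>R h) = (T h (T t y) - T t y) /\<^sub>R h"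
    unfolding eventually_at_filter
  proof (intro always_eventually allI impI)
    fix h :: real assume "h \<in> {0<..}"
    then have "T t (T h y) = T h (T t y)"
      using add[of t h y] add[of h t y] \<open>0 \<le> t\<close> by (simp add: add.commute)
    then show "T t ((T h y - y) /\<^sub>R h) = (T h (T t y) - T t y) /\<^sub>R h"
      by (simp add: scaleR diff)
  qed
  ultimately have "((\<lambda>h. (T h (T t y) - T t y) /\<^sub>R h) \<longlongrightarrow> - T t (A y)) (at_right 0)"
    by (rule Lim_transform_eventually)
  then show ?thesis using gen by auto
qed

section \<open>Convolution with a smoothing semigroup\<close>

text \<open>Here \<open>R\<close> stands for the negative power. From now on the operator
  \<open>\<Lambda>\<close> enters only through the commutation, range and norm properties
  listed.\<close>

locale smoothing_semigroup =
  fixes R :: "'x::banach \<Rightarrow> 'x" and T :: "real \<Rightarrow> 'x \<Rightarrow> 'x" and \<alpha> \<beta> M :: real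
  assumes bounded_linear_R: "bounded_linear R" and inj_R: "inj R"
    and bounded_linear_T: "0 \<le> t \<Longrightarrow> bounded_linear (T t)"
    and T_0: "T 0 x = x"
    and T_add: "0 \<le> s \<Longrightarrow> 0 \<le> t \<Longrightarrow> T (s + t) x = T s (T t x)"
    and T_cont: "continuous_on {0..} (\<lambda>t. T t x)"
    and T_R: "0 \<le> t \<Longrightarrow> T t (R x) = R (T t x)"
    and T_range: "0 < t \<Longrightarrow> T t x \<in> range R"
    and T_bound: "0 < t \<Longrightarrow> norm (inv R (T t (R x))) \<le> M * exp (- \<beta> * t) * norm x"
    and T_smoothing: "0 < t \<Longrightarrow> norm (inv R (T t x)) \<le> M * t powr (- \<alpha>) * exp (- \<beta> * t) * norm x"
    and \<alpha>: "0 \<le> \<alpha>" "\<alpha> < 1" and \<beta>: "0 < \<beta>" and M: "1 \<le> M"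
begin

text \<open>Meant for \<open>t > 0\<close>: at \<open>t = 0\<close> the vector \<open>x\<close> may
  lie outside the range of \<open>R\<close>, where \<open>inv R\<close> is arbitrary. Hence
  integrands are altered on the null set \<open>{0}\<close> below.\<close>

definition S :: "real \<Rightarrow> 'x \<Rightarrow> 'x" where
  "S t x = inv R (T t x)"

abbreviation "\<kappa> \<equiv> kernel_mass \<alpha>"

lemma R_S: "0 < t \<Longrightarrow> R (S t x) = T t x"
  unfolding S_def using T_range by (simp add: f_inv_into_f)

lemma S_eqI: "R y = T t x \<Longrightarrow> S t x = y"
  unfolding S_def using inv_f_f[OF inj_R] by metis

text \<open>\<open>T t\<close> commutes with \<open>R\<close>, so the first semigroup bound is a
  bound for \<open>T t\<close> itself; at \<open>t = 0\<close> it follows from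
  \<open>1 \<le> M\<close>.\<close>

lemma norm_T: "0 \<le> t \<Longrightarrow> norm (T t x) \<le> M * exp (- \<beta> * t) * norm x"
proof (cases "t = 0")
  case True
  then show ?thesis using M mult_right_mono[of 1 M "norm x"] by (simp add: T_0)
next
  case False
  assume "0 \<le> t"
  with False have "inv R (T t (R x)) = T t x" using T_R inv_f_f[OF inj_R] by simp
  with T_bound[of t x] False \<open>0 \<le> t\<close> show ?thesis by simp
qed

lemma norm_T': "0 \<le> t \<Longrightarrow> norm (T t x) \<le> M * norm x"
proof -
  assume t: "0 \<le> t"
  have "M * exp (- \<beta> * t) \<le> M * 1" using t \<beta> M by (intro mult_left_mono) auto
  then show ?thesis using norm_T[OF t, of x] mult_right_mono[of _ _ "norm x"] by fastforce
qed

lemma norm_S: "0 < t \<Longrightarrow> norm (S t x) \<le> M * (t powr (- \<alpha>) * exp (- \<beta> * t)) * norm x"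
  using T_smoothing unfolding S_def by (simp add: mult.assoc)

lemma linear_T: "0 \<le> t \<Longrightarrow> linear (T t)"
  using bounded_linear_T bounded_linear.linear by blast

lemma linear_R: "linear R"
  using bounded_linear_R bounded_linear.linear by blast

lemma bounded_linear_S: "0 < t \<Longrightarrow> bounded_linear (S t)"
proof (rule bounded_linear_intro)
  assume t: "0 < t"
  then have T: "linear (T t)" using linear_T by simp
  show "S t (x + y) = S t x + S t y" for x y
    using t by (intro S_eqI) (simp add: R_S linear_add[OF linear_R] linear_add[OF T])
  show "S t (c *\<^sub>R x) = c *\<^sub>R S t x" for c x
    using t by (intro S_eqI) (simp add: R_S linear_scale[OF linear_R] linear_scale[OF T])
  show "norm (S t x) \<le> norm x * (M * (t powr (- \<alpha>) * exp (- \<beta> * t)))" for x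
    using norm_S[OF t, of x] by (simp add: mult.commute)
qed

lemma S_diff: "0 < t \<Longrightarrow> S t (x - y) = S t x - S t y"
  using bounded_linear_S bounded_linear.linear linear_diff by blast

lemma S_add: "0 \<le> t \<Longrightarrow> 0 < h \<Longrightarrow> S (t + h) x = T t (S h x)"
  by (rule S_eqI) (simp add: R_S T_R[symmetric] T_add)

lemma continuous_on_T_compose:
  fixes a :: "'t::topological_space \<Rightarrow> real"
  assumes "continuous_on U a" "\<And>z. z \<in> U \<Longrightarrow> 0 \<le> a z" "continuous_on U f"
  shows "continuous_on U (\<lambda>z. T (a z) (f z))"
  by (rule continuous_on_operator_family[where I="{0..}", OF _ T_cont _ assms(1) _ assms(3)])
     (use linear_T norm_T' assms(2) in auto)

text \<open>Near \<open>z0\<close> the operator \<open>S (a z)\<close> factors as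
  \<open>T (a z - c)\<close> after the fixed bounded operator \<open>S c\<close>, which reduces the
  claim to joint continuity of \<open>T\<close>.\<close>

lemma continuous_on_S_compose:
  fixes a :: "'t::topological_space \<Rightarrow> real"
  assumes a: "continuous_on U a" "\<And>z. z \<in> U \<Longrightarrow> 0 < a z" and f: "continuous_on U f"
  shows "continuous_on U (\<lambda>z. S (a z) (f z))"
  unfolding continuous_on_def
proof
  fix z0 assume z0: "z0 \<in> U"
  define c where "c = a z0 / 2"
  have c: "0 < c" "c < a z0" unfolding c_def using a(2)[OF z0] by auto
  have "continuous_on U (\<lambda>z. S c (f z))"
    by (rule bounded_linear.continuous_on[OF bounded_linear_S[OF c(1)] f])
  \<comment> \<open>The maximum keeps the time nonnegative on all of \<open>U\<close>; it is
    inactive near \<open>z0\<close>.\<close>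
  then have "continuous_on U (\<lambda>z. T (max 0 (a z - c)) (S c (f z)))"
    by (intro continuous_on_T_compose continuous_intros a) auto
  then have "((\<lambda>z. T (max 0 (a z - c)) (S c (f z))) \<longlongrightarrow> T (max 0 (a z0 - c)) (S c (f z0))) (at z0 within U)"
    using z0 unfolding continuous_on_def by blast
  moreover have "(a \<longlongrightarrow> a z0) (at z0 within U)" using a(1) z0 unfolding continuous_on_def by blast
  from order_tendstoD(1)[OF this c(2)]
  have "\<forall>\<^sub>F z in at z0 within U. T (max 0 (a z - c)) (S c (f z)) = S (a z) (f z)"
  proof eventually_elim
    fix z assume "c < a z"
    then show "T (max 0 (a z - c)) (S c (f z)) = S (a z) (f z)"
      using S_add[of "a z - c" c "f z"] c(1) by simp
  qed
  moreover have "T (max 0 (a z0 - c)) (S c (f z0)) = S (a z0) (f z0)"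
    using S_add[of "a z0 - c" c "f z0"] c by simp
  ultimately show "((\<lambda>z. S (a z) (f z)) \<longlongrightarrow> S (a z0) (f z0)) (at z0 within U)"
    by (auto intro: Lim_transform_eventually)
qed

lemma S_kernel_bound:
  assumes "0 < s" "norm y \<le> B"
  shows "norm (S s y) \<le> M * B * (s powr (- \<alpha>) * exp (- \<beta> * s))"
proof -
  have "norm (S s y) \<le> M * (s powr (- \<alpha>) * exp (- \<beta> * s)) * norm y" by (rule norm_S[OF assms(1)])
  also have "\<dots> \<le> M * (s powr (- \<alpha>) * exp (- \<beta> * s)) * B" using assms(2) M by (intro mult_left_mono) auto
  finally show ?thesis by (simp add: mult_ac)
qed

lemma kernel_cmul_has_integral: "((\<lambda>s. C * (s powr (- \<alpha>) * exp (- \<beta> * s))) has_integral C * \<kappa> \<beta>) {0<..}"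
  using has_integral_cmul[OF kernel_has_integral[OF \<alpha> \<beta>], of C] by simp

lemma S_integrable:
  assumes h: "continuous_on {0<..} h" and B: "\<And>s. 0 < s \<Longrightarrow> norm (h s) \<le> B"
  shows "(\<lambda>s. S s (h s)) integrable_on {0<..}"
  by (rule dominated_integrable_Ioi[OF _ S_kernel_bound[OF _ B] has_integral_integrable[OF kernel_cmul_has_integral]])
     (auto intro!: continuous_on_S_compose h continuous_intros)

lemma norm_S_integral:
  assumes h: "continuous_on {0<..} h" and B: "\<And>s. 0 < s \<Longrightarrow> norm (h s) \<le> B"
  shows "norm (integral {0<..} (\<lambda>s. S s (h s))) \<le> M * B * \<kappa> \<beta>"
  by (rule norm_integral_Ioi_le[OF _ S_kernel_bound[OF _ B] kernel_cmul_has_integral])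
     (auto intro!: continuous_on_S_compose h continuous_intros)

lemma S_integrable_Icc:
  assumes h: "continuous_on {0..t} h"
  shows "(\<lambda>s. S s (h s)) integrable_on {0..t}"
proof (cases "0 < t")
  case True
  have "bounded (h ` {0..t})" by (intro compact_imp_bounded compact_continuous_image h) auto
  then obtain B where "\<forall>y\<in>h ` {0..t}. norm y \<le> B" unfolding bounded_iff ..
  then have B: "\<And>s. s \<in> {0..t} \<Longrightarrow> norm (h s) \<le> B" by simp
  show ?thesis
  proof (rule dominated_integrable_Icc[OF True])
    show "continuous_on {0<..t} (\<lambda>s. S s (h s))"
      by (rule continuous_on_S_compose) (auto intro!: continuous_intros continuous_on_subset[OF h])
    show "norm (S s (h s)) \<le> M * B * (s powr (- \<alpha>) * exp (- \<beta> * s))" if "0 < s" "s \<le> t" for s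
      using that B by (intro S_kernel_bound) auto
    show "(\<lambda>s. M * B * (s powr (- \<alpha>) * exp (- \<beta> * s))) integrable_on {0..t}"
      using integrable_cmul[OF kernel_integral_Icc(1)[OF \<alpha> \<beta>, of t], of "M * B"] by simp
  qed
next
  case False
  then have "negligible {0..t}" by (intro negligible_subset[OF negligible_sing[of 0]]) auto
  then show ?thesis by (rule integrable_negligible)
qed

text \<open>For \<open>s > 0\<close> the operator \<open>T s\<close> is \<open>R\<close> after
  \<open>S s\<close>, and the bounded \<open>R\<close> leaves the integral because the singular
  convolution is integrable. The point \<open>s = 0\<close> is a null set.\<close>

lemma convolution_eq:
  assumes h: "continuous_on {\<tau>..t} h"
  shows "integral {\<tau>..t} (\<lambda>s. T (t - s) (h s)) = R (integral {0..t - \<tau>} (\<lambda>s. S s (h (t - s))))"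
proof -
  have i: "(\<lambda>s. S s (h (t - s))) integrable_on {0..t - \<tau>}"
    by (rule S_integrable_Icc) (intro continuous_on_compose2[OF h] continuous_intros, auto)
  have "integral {\<tau>..t} (\<lambda>s. T (t - s) (h s)) = integral {0..t - \<tau>} (\<lambda>s. T s (h (t - s)))"
    using integral_flip[of \<tau> t "\<lambda>s. T s (h (t - s))"] by simp
  also have "\<dots> = integral {0..t - \<tau>} (R \<circ> (\<lambda>s. S s (h (t - s))))"
    by (rule integral_spike[where S="{0}"]) (auto simp: R_S)
  also have "\<dots> = R (integral {0..t - \<tau>} (\<lambda>s. S s (h (t - s))))"
    by (rule integral_linear[OF i bounded_linear_R])
  finally show ?thesis .
qed

text \<open>The translate by \<open>d\<close> of the whole past contributes \<open>T d\<close>, because \<open>S (s + d) = T d \<circ> S s\<close>.\<close>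

lemma S_integral_split:
  assumes h: "continuous_on UNIV h" and B: "\<And>s. norm (h s) \<le> B" and "0 \<le> d"
  shows "integral {0<..} (\<lambda>s. S s (h (t + d - s)))
    = T d (integral {0<..} (\<lambda>s. S s (h (t - s)))) + integral {0..d} (\<lambda>s. S s (h (t + d - s)))"
proof -
  let ?k = "\<lambda>s. S s (h (t + d - s))" and ?l = "\<lambda>s. S s (h (t - s))"
  have ki: "?k integrable_on {0<..}" and li: "?l integrable_on {0<..}"
    by (rule S_integrable[OF _ B]; intro continuous_intros continuous_on_compose2[OF h]; auto)+
  \<comment> \<open>Extension by zero to the whole line prepares the translation by
    \<open>d\<close>.\<close>
  have "((\<lambda>s. if s \<in> {0<..} then T d (?l s) else 0) has_integral T d (integral {0<..} ?l)) UNIV"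
    using has_integral_linear[OF integrable_integral[OF li] bounded_linear_T[OF \<open>0 \<le> d\<close>]]
    by (simp only: has_integral_restrict_UNIV o_def)
  from has_integral_translate[OF this, of "- d"]
  have "((\<lambda>s. if s \<in> {d<..} then ?k s else 0) has_integral T d (integral {0<..} ?l)) UNIV"
  proof (rule has_integral_eq[rotated])
    fix s :: real
    show "(if s + - d \<in> {0<..} then T d (?l (s + - d)) else 0) = (if s \<in> {d<..} then ?k s else 0)"
      using S_add[OF \<open>0 \<le> d\<close>, of "s - d" "h (t + d - s)"] by (simp add: algebra_simps)
  qed
  then have 1: "(?k has_integral T d (integral {0<..} ?l)) {d<..}"
    by (simp only: has_integral_restrict_UNIV)
  have 2: "(?k has_integral integral {0..d} ?k) {0..d}"
    by (intro integrable_integral S_integrable_Icc continuous_intros continuous_on_compose2[OF h]) auto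
  have "(?k has_integral (T d (integral {0<..} ?l) + integral {0..d} ?k)) ({d<..} \<union> {0..d})"
    by (rule has_integral_Un[OF 1 2]) (auto intro: negligible_subset[of "{}"])
  then have "(?k has_integral (T d (integral {0<..} ?l) + integral {0..d} ?k)) {0<..}"
    by (rule has_integral_spike_set_eq[THEN iffD1, rotated 2])
       (rule negligible_subset[of "{0}"]; use \<open>0 \<le> d\<close> in auto)+
  then show ?thesis by (rule integral_unique)
qed

end

context smoothing_semigroup
begin

text \<open>Growth of \<open>h\<close> is absorbed by the kernel, whose rate drops from
  \<open>\<beta>\<close> to \<open>\<beta> - \<omega>\<close>.\<close>

lemma norm_S_integral_Icc:
  assumes h: "continuous_on {0..t} h" and B: "\<And>s. 0 \<le> s \<Longrightarrow> s \<le> t \<Longrightarrow> norm (h s) \<le> B * exp (\<omega> * s)"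
    and \<omega>: "\<omega> < \<beta>" and "0 \<le> B"
  shows "norm (integral {0..t} (\<lambda>s. S s (h s))) \<le> M * B * \<kappa> (\<beta> - \<omega>)"
proof -
  let ?f = "\<lambda>s. if s = 0 then 0 else S s (h s)"
  let ?k = "\<lambda>s. s powr (- \<alpha>) * exp (- (\<beta> - \<omega>) * s)"
  have \<beta>\<omega>: "0 < \<beta> - \<omega>" using \<omega> by simp
  have "integral {0..t} (\<lambda>s. S s (h s)) = integral {0..t} ?f"
    by (rule integral_spike[where S="{0}"]) auto
  also have "norm \<dots> \<le> integral {0..t} (\<lambda>s. (M * B) * ?k s)"
  proof (rule integral_norm_bound_integral)
    show "?f integrable_on {0..t}"
      by (rule integrable_spike[OF S_integrable_Icc[OF h], where S="{0}"]) auto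
    show "(\<lambda>s. (M * B) * ?k s) integrable_on {0..t}"
      using integrable_cmul[OF kernel_integral_Icc(1)[OF \<alpha> \<beta>\<omega>, of t], of "M * B"] by simp
    fix s assume s: "s \<in> {0..t}"
    show "norm (?f s) \<le> (M * B) * ?k s"
    proof (cases "s = 0")
      case False
      then have "norm (S s (h s)) \<le> M * (B * exp (\<omega> * s)) * (s powr (- \<alpha>) * exp (- \<beta> * s))"
        using s B by (intro S_kernel_bound) auto
      also have "\<dots> = (M * B) * (s powr (- \<alpha>) * (exp (\<omega> * s) * exp (- \<beta> * s)))" by simp
      also have "exp (\<omega> * s) * exp (- \<beta> * s) = exp (- (\<beta> - \<omega>) * s)"
        by (simp add: algebra_simps flip: exp_add)
      finally show ?thesis using False by simp
    qed simp
  qed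
  also have "\<dots> = (M * B) * integral {0..t} ?k" by (rule integral_mult_right)
  also have "\<dots> \<le> (M * B) * \<kappa> (\<beta> - \<omega>)"
    using M \<open>0 \<le> B\<close> by (intro mult_left_mono kernel_integral_Icc(2)[OF \<alpha> \<beta>\<omega>]) auto
  finally show ?thesis .
qed

end

section \<open>The equation in coordinates\<close>

text \<open>\<open>G\<close> is the nonlinearity \<open>F\<close> read in coordinates. Histories are
  arbitrary functions continuous on \<open>{-r..0}\<close>, and pointwise bounds \<open>d\<close>
  and \<open>\<delta>\<close> replace the supremum norm.\<close>

locale retarded_equation = smoothing_semigroup R T \<alpha> \<beta> M
  for R :: "'x::banach \<Rightarrow> 'x" and T :: "real \<Rightarrow> 'x \<Rightarrow> 'x" and \<alpha> \<beta> M :: real +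
  fixes \<theta> :: "real \<Rightarrow> 'h::metric_space \<Rightarrow> 'h" and G :: "'h \<Rightarrow> (real \<Rightarrow> 'x) \<Rightarrow> 'x" and r L :: real
  assumes compact_base: "compact (UNIV :: 'h set)" and dynamical: "dynamical_system \<theta>" and r: "0 \<le> r"
    and G_lipschitz: "continuous_on {-r..0} \<phi> \<Longrightarrow> continuous_on {-r..0} \<psi> \<Longrightarrow>
        (\<And>\<sigma>. \<sigma> \<in> {-r..0} \<Longrightarrow> norm (\<phi> \<sigma> - \<psi> \<sigma>) \<le> d) \<Longrightarrow> norm (G p \<phi> - G p \<psi>) \<le> L * d"
    and G_cont: "continuous_on {-r..0} \<phi> \<Longrightarrow> 0 < e \<Longrightarrow>
        \<exists>\<delta>>0. \<forall>q \<psi>. continuous_on {-r..0} \<psi> \<longrightarrow> dist q p < \<delta> \<longrightarrow>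
          (\<forall>\<sigma>\<in>{-r..0}. norm (\<psi> \<sigma> - \<phi> \<sigma>) \<le> \<delta>) \<longrightarrow> dist (G q \<psi>) (G p \<phi>) < e"
    and L: "0 < L" and small: "M * L * \<kappa> \<beta> < 1"
begin

section \<open>Continuity of the nonlinearity along histories and orbits\<close>

lemma \<theta>_0: "\<theta> 0 p = p" and \<theta>_add: "\<theta> (s + t) p = \<theta> s (\<theta> t p)"
  using dynamical unfolding dynamical_system_def by auto

lemma continuous_on_\<theta>:
  assumes "continuous_on U a" "continuous_on U f"
  shows "continuous_on U (\<lambda>z. \<theta> (a z) (f z))"
  using continuous_on_compose2[of UNIV "\<lambda>(t, p). \<theta> t p" U "\<lambda>z. (a z, f z)"] dynamical assms
  unfolding dynamical_system_def by (auto intro: continuous_on_Pair)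

text \<open>Compactness of \<open>{-r..0}\<close> turns joint continuity of \<open>v\<close> into
  closeness of whole histories, uniform in \<open>\<sigma>\<close>, as continuity of
  \<open>G\<close> requires.\<close>

lemma continuous_on_G:
  fixes v :: "'p::topological_space \<Rightarrow> real \<Rightarrow> 'x"
  assumes v: "continuous_on (U \<times> {-r..0}) (\<lambda>(z, \<sigma>). v z \<sigma>)" and q: "continuous_on U q"
  shows "continuous_on U (\<lambda>z. G (q z) (v z))"
  unfolding continuous_on_def
proof
  fix z0 assume z0: "z0 \<in> U"
  have vc: "continuous_on {-r..0} (v z)" if "z \<in> U" for z
  proof -
    have "continuous_on {-r..0} (\<lambda>\<sigma>. (z, \<sigma>))" by (intro continuous_intros)
    from continuous_on_compose2[OF v this] that show ?thesis by auto
  qed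
  show "((\<lambda>z. G (q z) (v z)) \<longlongrightarrow> G (q z0) (v z0)) (at z0 within U)"
  proof (rule tendstoI)
    fix e :: real assume "0 < e"
    from G_cont[OF vc[OF z0] this, of "q z0"]
    obtain \<delta> where "0 < \<delta> \<and> (\<forall>p \<psi>. continuous_on {-r..0} \<psi> \<longrightarrow> dist p (q z0) < \<delta> \<longrightarrow>
          (\<forall>\<sigma>\<in>{-r..0}. norm (\<psi> \<sigma> - v z0 \<sigma>) \<le> \<delta>) \<longrightarrow> dist (G p \<psi>) (G (q z0) (v z0)) < e)" ..
    then have \<delta>: "0 < \<delta>" and close: "\<And>p \<psi>. continuous_on {-r..0} \<psi> \<Longrightarrow> dist p (q z0) < \<delta> \<Longrightarrow>
          (\<forall>\<sigma>\<in>{-r..0}. norm (\<psi> \<sigma> - v z0 \<sigma>) \<le> \<delta>) \<Longrightarrow> dist (G p \<psi>) (G (q z0) (v z0)) < e"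
      by simp_all
    obtain X0 where X0: "z0 \<in> X0" "open X0"
      "\<forall>z\<in>X0 \<inter> U. \<forall>\<sigma>\<in>{-r..0}. dist (case (z, \<sigma>) of (z, \<sigma>) \<Rightarrow> v z \<sigma>) (case (z0, \<sigma>) of (z, \<sigma>) \<Rightarrow> v z \<sigma>) \<le> \<delta>"
      by (rule continuous_on_prod_compactE[OF v compact_Icc z0 \<delta>])
    have "\<forall>\<^sub>F z in at z0 within U. z \<in> X0 \<inter> U"
      unfolding eventually_at_topological using X0(1,2) by blast
    moreover have "(q \<longlongrightarrow> q z0) (at z0 within U)" using q z0 unfolding continuous_on_def by blast
    from tendstoD[OF this \<delta>] have "\<forall>\<^sub>F z in at z0 within U. dist (q z) (q z0) < \<delta>" .
    ultimately show "\<forall>\<^sub>F z in at z0 within U. dist (G (q z) (v z)) (G (q z0) (v z0)) < e"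
    proof eventually_elim
      fix z assume z: "z \<in> X0 \<inter> U" "dist (q z) (q z0) < \<delta>"
      then show "dist (G (q z) (v z)) (G (q z0) (v z0)) < e"
        using X0(3) by (intro close vc) (auto simp: dist_norm)
    qed
  qed
qed

lemma continuous_on_G_history:
  assumes u: "continuous_on {-r..} u"
  shows "continuous_on {0..} (\<lambda>t. G (\<theta> t p) (\<lambda>\<sigma>. u (t + \<sigma>)))"
proof (rule continuous_on_G)
  show "continuous_on ({0..} \<times> {-r..0}) (\<lambda>(t, \<sigma>). u (t + \<sigma>))"
    unfolding case_prod_beta
    by (rule continuous_on_compose2[OF u]) (auto intro!: continuous_intros)
qed (intro continuous_on_\<theta> continuous_intros)

text \<open>For a curve of the form \<open>g (\<theta> t p)\<close> the history at time
  \<open>t\<close> is determined by the point \<open>q = \<theta> t p\<close>, so the nonlinearity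
  becomes a function on the base.\<close>

definition \<Phi> :: "('h \<Rightarrow> 'x) \<Rightarrow> 'h \<Rightarrow> 'x" where
  "\<Phi> g q = G q (\<lambda>\<sigma>. g (\<theta> \<sigma> q))"

definition V :: "('h \<Rightarrow> 'x) \<Rightarrow> 'h \<Rightarrow> 'x" where
  "V g p = integral {0<..} (\<lambda>s. S s (\<Phi> g (\<theta> (- s) p)))"

section \<open>The convolution over the past as a contraction on the base\<close>

lemma continuous_orbit:
  assumes "continuous_on UNIV g"
  shows "continuous_on U (\<lambda>\<sigma>. g (\<theta> \<sigma> q))"
  by (rule continuous_on_compose2[OF assms]) (auto intro!: continuous_on_\<theta> continuous_intros)

lemma continuous_on_\<Phi>:
  assumes "continuous_on UNIV g"
  shows "continuous_on U (\<Phi> g)"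
proof -
  have "continuous_on (U \<times> {-r..0}) (\<lambda>(z, \<sigma>). g (\<theta> \<sigma> z))"
    unfolding case_prod_beta
    by (rule continuous_on_compose2[OF assms]) (auto intro!: continuous_on_\<theta> continuous_intros)
  from continuous_on_G[OF this continuous_on_id] show ?thesis unfolding \<Phi>_def .
qed

lemma \<Phi>_bounded:
  assumes "continuous_on UNIV g"
  obtains B where "\<And>q. norm (\<Phi> g q) \<le> B"
proof -
  have "bounded (range (\<Phi> g))"
    by (intro compact_imp_bounded compact_continuous_image continuous_on_\<Phi> assms compact_base)
  then obtain B where "\<forall>y\<in>range (\<Phi> g). norm y \<le> B" unfolding bounded_iff ..
  then show ?thesis using that by blast
qed

lemma continuous_\<Phi>_orbit:
  assumes "continuous_on UNIV g" "continuous_on U a" "continuous_on U f"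
  shows "continuous_on U (\<lambda>z. \<Phi> g (\<theta> (a z) (f z)))"
  by (rule continuous_on_compose2[OF continuous_on_\<Phi>[OF assms(1)] continuous_on_\<theta>[OF assms(2,3)]]) auto

lemma \<Phi>_lipschitz:
  assumes g: "continuous_on UNIV g" "continuous_on UNIV g'" and d: "\<And>q. norm (g q - g' q) \<le> d"
  shows "norm (\<Phi> g q - \<Phi> g' q) \<le> L * d"
  unfolding \<Phi>_def by (intro G_lipschitz continuous_orbit g d)

lemma continuous_on_V:
  assumes g: "continuous_on UNIV g"
  shows "continuous_on UNIV (V g)"
proof -
  obtain B where B: "\<And>q. norm (\<Phi> g q) \<le> B" using \<Phi>_bounded[OF g] by blast
  show ?thesis
    unfolding V_def
  proof (rule continuous_on_integral_Ioi[OF _ _ has_integral_integrable[OF kernel_cmul_has_integral]])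
    show "continuous_on (UNIV \<times> {0<..}) (\<lambda>(p, s). S s (\<Phi> g (\<theta> (- s) p)))"
      unfolding case_prod_beta
      by (intro continuous_on_S_compose continuous_\<Phi>_orbit[OF g] continuous_intros) auto
    show "norm (S s (\<Phi> g (\<theta> (- s) p))) \<le> M * B * (s powr (- \<alpha>) * exp (- \<beta> * s))" if "0 < s" for p s
      by (rule S_kernel_bound[OF that B])
  qed
qed

lemma V_lipschitz:
  assumes g: "continuous_on UNIV g" "continuous_on UNIV g'" and d: "\<And>q. norm (g q - g' q) \<le> d"
  shows "norm (V g p - V g' p) \<le> M * L * \<kappa> \<beta> * d"
proof -
  have c: "continuous_on U (\<lambda>s. \<Phi> f (\<theta> (- s) p))" if "continuous_on UNIV f" for f U
    by (intro continuous_\<Phi>_orbit[OF that] continuous_intros)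
  have i: "(\<lambda>s. S s (\<Phi> f (\<theta> (- s) p))) integrable_on {0<..}" if f: "continuous_on UNIV f" for f
  proof -
    obtain B where B: "\<And>q. norm (\<Phi> f q) \<le> B" using \<Phi>_bounded[OF f] by blast
    show ?thesis by (rule S_integrable[OF c[OF f] B])
  qed
  have "V g p - V g' p = integral {0<..} (\<lambda>s. S s (\<Phi> g (\<theta> (- s) p)) - S s (\<Phi> g' (\<theta> (- s) p)))"
    unfolding V_def by (rule Henstock_Kurzweil_Integration.integral_diff[symmetric]) (intro i g)+
  also have "\<dots> = integral {0<..} (\<lambda>s. S s (\<Phi> g (\<theta> (- s) p) - \<Phi> g' (\<theta> (- s) p)))"
    by (rule integral_cong) (simp add: S_diff)
  also have "norm \<dots> \<le> M * (L * d) * \<kappa> \<beta>"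
    by (rule norm_S_integral) (intro continuous_intros c g, rule \<Phi>_lipschitz[OF g d])
  finally show ?thesis by (simp add: mult_ac)
qed

text \<open>Compactness of the base makes every continuous function bounded, so \<open>V\<close>
  acts on the complete space of bounded continuous functions. Continuity of the equilibrium is built
  into this space.\<close>

lemma equilibrium_exists:
  obtains g where "continuous_on UNIV g" "\<And>p. V g p = g p"
proof -
  have app: "apply_bcontfun (Bcontfun f) = f" if "continuous_on UNIV f" for f :: "'h \<Rightarrow> 'x"
    using that compact_imp_bounded[OF compact_continuous_image[OF that compact_base]]
    by (intro Bcontfun_inverse) (simp add: bcontfun_def)
  have cont: "continuous_on UNIV (apply_bcontfun f)" for f :: "'h \<Rightarrow>\<^sub>C 'x"
    by (rule continuous_on_apply_bcontfun)
  let ?W = "\<lambda>f. Bcontfun (V (apply_bcontfun f))"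
  have W: "apply_bcontfun (?W f) = V (apply_bcontfun f)" for f
    by (rule app[OF continuous_on_V[OF cont]])
  have "\<exists>!f. ?W f = f"
  proof (rule banach_fix_type)
    show "0 \<le> M * L * \<kappa> \<beta>" using M L kernel_mass_pos[OF \<alpha> \<beta>] by simp
    show "M * L * \<kappa> \<beta> < 1" by (rule small)
    show "\<forall>f f'. dist (?W f) (?W f') \<le> M * L * \<kappa> \<beta> * dist f f'"
    proof (intro allI dist_bound)
      fix f f' p
      show "dist (apply_bcontfun (?W f) p) (apply_bcontfun (?W f') p) \<le> M * L * \<kappa> \<beta> * dist f f'"
        unfolding W dist_norm[of "V _ _"]
        by (rule V_lipschitz[OF cont cont]) (simp add: dist_bounded flip: dist_norm)
    qed
  qed
  then obtain f where "?W f = f" by blast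
  then have "V (apply_bcontfun f) = apply_bcontfun f" using W by metis
  then show ?thesis using that[OF cont, of f] by simp
qed

text \<open>The group law turns the fixed point equation at \<open>\<theta> t p\<close> into a
  convolution over the past of the single function \<open>\<Phi> g (\<theta> s p)\<close> of
  \<open>s\<close>; splitting off the last time span \<open>d\<close> gives variation of
  constants.\<close>

lemma equilibrium_variation:
  assumes g: "continuous_on UNIV g" "\<And>p. V g p = g p" and "0 \<le> d"
  shows "g (\<theta> (t + d) p) = T d (g (\<theta> t p)) + integral {0..d} (\<lambda>s. S s (\<Phi> g (\<theta> (t + d - s) p)))"
proof -
  obtain B where B: "\<And>q. norm (\<Phi> g q) \<le> B" using \<Phi>_bounded[OF g(1)] by blast
  have "g (\<theta> t p) = integral {0<..} (\<lambda>s. S s (\<Phi> g (\<theta> (t - s) p)))" for t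
    using g(2)[of "\<theta> t p"] by (simp add: V_def flip: \<theta>_add)
  moreover have "continuous_on UNIV (\<lambda>s. \<Phi> g (\<theta> s p))"
    by (intro continuous_\<Phi>_orbit[OF g(1)] continuous_intros)
  ultimately show ?thesis
    using S_integral_split[where h="\<lambda>s. \<Phi> g (\<theta> s p)", OF _ B \<open>0 \<le> d\<close>] by metis
qed

text \<open>At \<open>\<omega> = 0\<close> the quantity is \<open>M * L * \<kappa> \<beta>\<close>,
  which is below \<open>1\<close>, and it is continuous in \<open>\<omega>\<close>. Restriction to
  \<open>\<omega> \<le> \<beta> / 2\<close> keeps the rate of the kernel away from
  \<open>0\<close>.\<close>

lemma decay_rate_exists:
  obtains \<omega> where "0 < \<omega>" "\<omega> < \<beta>" "M * L * exp (\<omega> * r) * \<kappa> (\<beta> - \<omega>) < 1"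
proof -
  let ?f = "\<lambda>\<omega>. M * L * exp (\<omega> * r) * \<kappa> (\<beta> - \<omega>)"
  have "continuous_on {0..\<beta> / 2} ?f"
    by (intro continuous_intros continuous_on_compose2[OF continuous_on_kernel_mass[OF \<alpha>, of "\<beta> / 2"]])
       (use \<beta> in auto)
  then have "\<forall>x\<in>{0..\<beta> / 2}. (?f \<longlongrightarrow> ?f x) (at x within {0..\<beta> / 2})"
    unfolding continuous_on_def .
  then have "(?f \<longlongrightarrow> ?f 0) (at 0 within {0..\<beta> / 2})"
    by (rule bspec) (use \<beta> in simp)
  moreover have "?f 0 < 1" using small by simp
  ultimately have "\<forall>\<^sub>F \<omega> in at 0 within {0..\<beta> / 2}. ?f \<omega> < 1" by (rule order_tendstoD(2))
  then obtain d where d: "0 < d" "\<forall>\<omega>\<in>{0..\<beta> / 2}. \<omega> \<noteq> 0 \<and> dist \<omega> 0 < d \<longrightarrow> ?f \<omega> < 1"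
    unfolding eventually_at by blast
  define \<omega> where "\<omega> = min (\<beta> / 2) (d / 2)"
  have "0 < \<omega>" "\<omega> < \<beta>" "\<omega> \<le> \<beta> / 2" "\<omega> < d" unfolding \<omega>_def using \<beta> d(1) by auto
  then show ?thesis using that[of \<omega>] bspec[OF d(2), of \<omega>] by (simp add: dist_real_def)
qed

text \<open>The estimate bounds the weighted distance at any \<open>t\<close> by its own bound
  \<open>K\<close> on \<open>{-r..t}\<close>, with factor below \<open>1\<close>. Applied at the
  point where the maximum over \<open>{-r..t0}\<close> is attained, it can be solved for the
  maximum.\<close>

lemma exponential_stability:
  assumes g: "continuous_on UNIV g" "\<And>p. V g p = g p"
    and u: "continuous_on {-r..} u"
    and mild: "\<And>t. 0 \<le> t \<Longrightarrow> u t = T t (u 0) + integral {0..t} (\<lambda>s. S s (G (\<theta> (t - s) p) (\<lambda>\<sigma>. u (t - s + \<sigma>))))"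
    and \<omega>: "0 < \<omega>" "\<omega> < \<beta>" and \<rho>: "M * L * exp (\<omega> * r) * \<kappa> (\<beta> - \<omega>) < 1"
    and m: "\<And>s. s \<in> {-r..0} \<Longrightarrow> norm (u s - g (\<theta> s p)) \<le> m"
    and "0 \<le> t0"
  shows "norm (u t0 - g (\<theta> t0 p)) \<le> M / (1 - M * L * exp (\<omega> * r) * \<kappa> (\<beta> - \<omega>)) * exp (- \<omega> * t0) * m"
proof -
  define w where "w t = u t - g (\<theta> t p)" for t
  define \<rho> where "\<rho> = M * L * exp (\<omega> * r) * \<kappa> (\<beta> - \<omega>)"
  have \<rho>1: "\<rho> < 1" unfolding \<rho>_def by (rule \<rho>)
  have "norm (u 0 - g (\<theta> 0 p)) \<le> m" by (rule m) (use r in simp)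
  then have m0: "0 \<le> m" by (rule order_trans[OF norm_ge_zero])
  have wc: "continuous_on {-r..} w"
    unfolding w_def by (intro continuous_intros u continuous_orbit g(1))
  define f where "f t = G (\<theta> t p) (\<lambda>\<sigma>. u (t + \<sigma>)) - \<Phi> g (\<theta> t p)" for t
  have uc: "continuous_on {-r..0} (\<lambda>\<sigma>. u (t + \<sigma>))" if "0 \<le> t" for t
    by (rule continuous_on_compose2[OF u]) (use that in \<open>auto intro!: continuous_intros\<close>)
  note fuc = continuous_on_G_history[OF u, of p]
  have fgc: "continuous_on U (\<lambda>t. \<Phi> g (\<theta> t p))" for U
    by (intro continuous_\<Phi>_orbit[OF g(1)] continuous_intros)
  have fc: "continuous_on {0..} f" unfolding f_def by (intro continuous_intros fuc fgc)
  have flip: "continuous_on {0..t} (\<lambda>s. h (t - s))" if "continuous_on {0..} h" for t and h :: "real \<Rightarrow> 'x"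
    by (rule continuous_on_compose2[OF that]) (auto intro!: continuous_intros)
  have w_eq: "w t = T t (w 0) + integral {0..t} (\<lambda>s. S s (f (t - s)))" if t: "0 \<le> t" for t
  proof -
    have 1: "(\<lambda>s. S s (G (\<theta> (t - s) p) (\<lambda>\<sigma>. u (t - s + \<sigma>)))) integrable_on {0..t}"
      by (rule S_integrable_Icc[OF flip[OF fuc]])
    have 2: "(\<lambda>s. S s (\<Phi> g (\<theta> (t - s) p))) integrable_on {0..t}"
      by (rule S_integrable_Icc[OF flip[OF fgc]])
    have "w t = T t (u 0) - T t (g (\<theta> 0 p)) + (integral {0..t} (\<lambda>s. S s (G (\<theta> (t - s) p) (\<lambda>\<sigma>. u (t - s + \<sigma>))))
        - integral {0..t} (\<lambda>s. S s (\<Phi> g (\<theta> (t - s) p))))"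
      unfolding w_def using mild[OF t] equilibrium_variation[OF g t, of 0 p] by simp
    also have "T t (u 0) - T t (g (\<theta> 0 p)) = T t (w 0)"
      unfolding w_def using linear_diff[OF linear_T[OF t]] by simp
    also have "integral {0..t} (\<lambda>s. S s (G (\<theta> (t - s) p) (\<lambda>\<sigma>. u (t - s + \<sigma>)))) - integral {0..t} (\<lambda>s. S s (\<Phi> g (\<theta> (t - s) p)))
        = integral {0..t} (\<lambda>s. S s (G (\<theta> (t - s) p) (\<lambda>\<sigma>. u (t - s + \<sigma>))) - S s (\<Phi> g (\<theta> (t - s) p)))"
      by (rule Henstock_Kurzweil_Integration.integral_diff[OF 1 2, symmetric])
    also have "\<dots> = integral {0..t} (\<lambda>s. S s (f (t - s)))"
      by (rule integral_spike[where S="{0}"]) (auto simp: f_def S_diff)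
    finally show ?thesis .
  qed
  have step: "exp (\<omega> * t) * norm (w t) \<le> M * m + \<rho> * K"
    if t: "0 \<le> t" and K: "\<And>s. s \<in> {-r..t} \<Longrightarrow> exp (\<omega> * s) * norm (w s) \<le> K" for t K
  proof -
    have K0: "0 \<le> K" using K[of t] t r by (meson atLeastAtMost_iff exp_ge_zero mult_nonneg_nonneg norm_ge_zero order_trans order_refl neg_le_0_iff_le)
    have wK: "norm (w s) \<le> K * exp (- \<omega> * s)" if "s \<in> {-r..t}" for s
      using K[OF that] by (simp add: exp_minus field_simps)
    define B where "B = L * (exp (\<omega> * r) * K * exp (- \<omega> * t))"
    have "norm (f (t - s)) \<le> B * exp (\<omega> * s)" if s: "0 \<le> s" "s \<le> t" for s
    proof -
      have "norm (f (t - s)) \<le> L * (exp (\<omega> * r) * K * exp (- \<omega> * (t - s)))"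
        unfolding f_def \<Phi>_def
      proof (rule G_lipschitz[OF uc continuous_orbit[OF g(1)]])
        fix \<sigma> assume \<sigma>: "\<sigma> \<in> {-r..0}"
        have "norm (w (t - s + \<sigma>)) \<le> K * exp (- \<omega> * (t - s + \<sigma>))"
          using s \<sigma> by (intro wK) auto
        \<comment> \<open>The delay enters here: \<open>- \<sigma> \<le> r\<close> produces the
          factor \<open>exp (\<omega> * r)\<close>.\<close>
        also have "\<dots> \<le> K * exp (\<omega> * r + - \<omega> * (t - s))"
        proof -
          have "\<omega> * (- \<sigma>) \<le> \<omega> * r" using \<sigma> \<omega>(1) by (intro mult_left_mono) auto
          then show ?thesis using K0 by (intro mult_left_mono) (auto simp: algebra_simps)
        qed
        also have "\<dots> = exp (\<omega> * r) * K * exp (- \<omega> * (t - s))" by (simp only: exp_add mult_ac)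
        finally show "norm (u (t - s + \<sigma>) - g (\<theta> \<sigma> (\<theta> (t - s) p))) \<le> exp (\<omega> * r) * K * exp (- \<omega> * (t - s))"
          unfolding w_def by (simp add: add.commute flip: \<theta>_add)
      qed (use s in simp)
      also have "exp (- \<omega> * (t - s)) = exp (- \<omega> * t) * exp (\<omega> * s)"
        by (simp add: algebra_simps flip: exp_add)
      finally show ?thesis unfolding B_def by (simp add: mult_ac)
    qed
    then have "norm (integral {0..t} (\<lambda>s. S s (f (t - s)))) \<le> M * B * \<kappa> (\<beta> - \<omega>)"
      using L K0 \<omega> by (intro norm_S_integral_Icc flip fc) (auto simp: B_def)
    also have "M * B * \<kappa> (\<beta> - \<omega>) = \<rho> * K * exp (- \<omega> * t)" unfolding B_def \<rho>_def by simp
    finally have 1: "norm (integral {0..t} (\<lambda>s. S s (f (t - s)))) \<le> \<rho> * K * exp (- \<omega> * t)" .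
    have "norm (T t (w 0)) \<le> M * exp (- \<beta> * t) * norm (w 0)" by (rule norm_T[OF t])
    also have "\<dots> \<le> M * exp (- \<omega> * t) * m"
    proof (intro mult_mono)
      show "norm (w 0) \<le> m" unfolding w_def by (rule m) (use r in simp)
      show "exp (- \<beta> * t) \<le> exp (- \<omega> * t)" using t \<omega> by (simp add: mult_right_mono)
    qed (use M in auto)
    finally have 2: "norm (T t (w 0)) \<le> M * exp (- \<omega> * t) * m" .
    have "norm (w t) \<le> norm (T t (w 0)) + norm (integral {0..t} (\<lambda>s. S s (f (t - s))))"
      unfolding w_eq[OF t] by (rule norm_triangle_ineq)
    with 1 2 have "norm (w t) \<le> (M * m + \<rho> * K) * exp (- \<omega> * t)" by (simp add: algebra_simps)
    then show ?thesis by (simp add: exp_minus field_simps)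
  qed
  have "\<exists>s\<in>{-r..t0}. \<forall>s'\<in>{-r..t0}. exp (\<omega> * s') * norm (w s') \<le> exp (\<omega> * s) * norm (w s)"
    using r \<open>0 \<le> t0\<close>
    by (intro continuous_attains_sup continuous_intros continuous_on_subset[OF wc]) auto
  then obtain s where s: "s \<in> {-r..t0}" and max: "\<And>s'. s' \<in> {-r..t0} \<Longrightarrow> exp (\<omega> * s') * norm (w s') \<le> exp (\<omega> * s) * norm (w s)"
    by blast
  define K where "K = exp (\<omega> * s) * norm (w s)"
  \<comment> \<open>If the maximum is attained at a negative time, the weight is at most
    \<open>1\<close> and the initial distance bounds it.\<close>
  have "K \<le> M * m + \<rho> * K"
  proof (cases "0 \<le> s")
    case True
    show ?thesis unfolding K_def by (rule step[OF True max]) (use s in auto)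
  next
    case False
    have "K \<le> 1 * m" unfolding K_def
      using False s m[of s] \<omega>(1) by (intro mult_mono) (auto simp: w_def mult_nonneg_nonpos)
    also have "1 * m \<le> M * m" using M m0 by (rule mult_right_mono)
    moreover have "0 \<le> \<rho> * K" unfolding \<rho>_def K_def using M L kernel_mass_pos[OF \<alpha>, of "\<beta> - \<omega>"] \<omega>(2) by auto
    ultimately show ?thesis by linarith
  qed
  then have "K \<le> M * m / (1 - \<rho>)" using \<rho>1 by (simp add: field_simps)
  moreover have "exp (\<omega> * t0) * norm (w t0) \<le> K"
    unfolding K_def using max[of t0] r \<open>0 \<le> t0\<close> by simp
  ultimately have "exp (\<omega> * t0) * norm (w t0) \<le> M * m / (1 - \<rho>)" by linarith
  then have "exp (- \<omega> * t0) * (exp (\<omega> * t0) * norm (w t0)) \<le> exp (- \<omega> * t0) * (M * m / (1 - \<rho>))"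
    by (rule mult_left_mono) simp
  moreover have "exp (- \<omega> * t0) * (exp (\<omega> * t0) * norm (w t0)) = norm (w t0)"
    by (simp add: exp_minus)
  ultimately have "norm (w t0) \<le> exp (- \<omega> * t0) * (M * m / (1 - \<rho>))" by (simp only:)
  then show ?thesis unfolding w_def \<rho>_def by (simp only: mult_ac times_divide_eq_left times_divide_eq_right)
qed

end

section \<open>Back to the fractional space\<close>

context
  fixes D :: "'x::banach set" and \<Lambda> :: "'x \<Rightarrow> 'x" and \<alpha> :: real
  assumes linear_neg_power: "linear (neg_power D \<Lambda> \<alpha>)" and inj_neg_power: "inj (neg_power D \<Lambda> \<alpha>)"
begin

lemma frac_norm_neg_power: "frac_norm D \<Lambda> \<alpha> (neg_power D \<Lambda> \<alpha> x) = norm x"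
  unfolding frac_norm_def frac_power_def by (simp add: inv_f_f[OF inj_neg_power])

lemma frac_norm_neg_power_diff:
  "frac_norm D \<Lambda> \<alpha> (neg_power D \<Lambda> \<alpha> x - neg_power D \<Lambda> \<alpha> y) = norm (x - y)"
  using frac_norm_neg_power[of "x - y"] by (simp add: linear_diff[OF linear_neg_power])

text \<open>By the preceding isometry, continuity into the fractional space is ordinary continuity
  of the coordinate; this lemma and the next are the two directions.\<close>

lemma frac_continuous_onI:
  assumes v: "continuous_on U v" and u: "\<And>s. s \<in> U \<Longrightarrow> u s = neg_power D \<Lambda> \<alpha> (v s)"
  shows "frac_continuous_on D \<Lambda> \<alpha> U u"
  unfolding frac_continuous_on_def
proof (intro conjI ballI)
  fix s assume s: "s \<in> U"
  show "u s \<in> frac_space D \<Lambda> \<alpha>" unfolding frac_space_def using u[OF s] by simp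
  have "((\<lambda>t. norm (v t - v s)) \<longlongrightarrow> 0) (at s within U)"
    using v s unfolding continuous_on_def by (intro tendsto_norm_zero LIM_zero) blast
  moreover have "\<forall>\<^sub>F t in at s within U. norm (v t - v s) = frac_norm D \<Lambda> \<alpha> (u t - u s)"
    unfolding eventually_at_filter using s by (intro always_eventually) (simp add: u frac_norm_neg_power_diff)
  ultimately show "((\<lambda>t. frac_norm D \<Lambda> \<alpha> (u t - u s)) \<longlongrightarrow> 0) (at s within U)"
    by (rule Lim_transform_eventually)
qed

lemma frac_continuous_onD:
  assumes u: "frac_continuous_on D \<Lambda> \<alpha> U u"
  shows "\<And>s. s \<in> U \<Longrightarrow> neg_power D \<Lambda> \<alpha> (frac_power D \<Lambda> \<alpha> (u s)) = u s"
    and "continuous_on U (\<lambda>s. frac_power D \<Lambda> \<alpha> (u s))"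
proof -
  show R: "neg_power D \<Lambda> \<alpha> (frac_power D \<Lambda> \<alpha> (u s)) = u s" if "s \<in> U" for s
    using u that unfolding frac_continuous_on_def frac_space_def frac_power_def by (simp add: f_inv_into_f)
  show "continuous_on U (\<lambda>s. frac_power D \<Lambda> \<alpha> (u s))"
    unfolding continuous_on_def
  proof
    fix s assume s: "s \<in> U"
    have "((\<lambda>t. frac_norm D \<Lambda> \<alpha> (u t - u s)) \<longlongrightarrow> 0) (at s within U)"
      using u s unfolding frac_continuous_on_def by blast
    moreover have "\<forall>\<^sub>F t in at s within U. frac_norm D \<Lambda> \<alpha> (u t - u s) = norm (frac_power D \<Lambda> \<alpha> (u t) - frac_power D \<Lambda> \<alpha> (u s))"
      unfolding eventually_at_filter
    proof (intro always_eventually allI impI)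
      fix t assume "t \<in> U"
      then show "frac_norm D \<Lambda> \<alpha> (u t - u s) = norm (frac_power D \<Lambda> \<alpha> (u t) - frac_power D \<Lambda> \<alpha> (u s))"
        using frac_norm_neg_power_diff[of "frac_power D \<Lambda> \<alpha> (u t)" "frac_power D \<Lambda> \<alpha> (u s)"] R s by simp
    qed
    ultimately have "((\<lambda>t. norm (frac_power D \<Lambda> \<alpha> (u t) - frac_power D \<Lambda> \<alpha> (u s))) \<longlongrightarrow> 0) (at s within U)"
      by (rule Lim_transform_eventually)
    then show "((\<lambda>t. frac_power D \<Lambda> \<alpha> (u t)) \<longlongrightarrow> frac_power D \<Lambda> \<alpha> (u s)) (at s within U)"
      by (simp only: tendsto_norm_zero_iff LIM_zero_iff)
  qed
qed

lemma restrict_mem_hist_space: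
  assumes "continuous_on {-r..0} \<phi>"
  shows "(\<lambda>\<sigma>\<in>{-r..0}. neg_power D \<Lambda> \<alpha> (\<phi> \<sigma>)) \<in> hist_space r D \<Lambda> \<alpha>"
  unfolding hist_space_def using frac_continuous_onI[OF assms] by simp

text \<open>\<open>0 \<le> r\<close> makes the interval nonempty, as a least upper bound over it
  requires.\<close>

lemma hist_norm_restrict_le:
  assumes "0 \<le> r" "\<And>\<sigma>. \<sigma> \<in> {-r..0} \<Longrightarrow> norm (\<phi> \<sigma> - \<psi> \<sigma>) \<le> d"
  shows "hist_norm r D \<Lambda> \<alpha> (\<lambda>s. (\<lambda>\<sigma>\<in>{-r..0}. neg_power D \<Lambda> \<alpha> (\<phi> \<sigma>)) s - (\<lambda>\<sigma>\<in>{-r..0}. neg_power D \<Lambda> \<alpha> (\<psi> \<sigma>)) s) \<le> d"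
  unfolding hist_norm_def by (rule cSUP_least) (use assms in \<open>auto simp: frac_norm_neg_power_diff\<close>)

end

theorem theorem4p7:
  fixes \<theta> :: "real \<Rightarrow> 'h::metric_space \<Rightarrow> 'h"
    and D :: "'x::banach set"
    and A \<Lambda> :: "'x \<Rightarrow> 'x"
    and T :: "real \<Rightarrow> 'x \<Rightarrow> 'x"
    and F :: "'h \<Rightarrow> (real \<Rightarrow> 'x) \<Rightarrow> 'x"
    and a r \<alpha> \<beta> L M :: real
  assumes "compact (UNIV :: 'h set)"
    and "dynamical_system \<theta>"
    and "minimal_system \<theta>"
    and "sectorial D A"
    and "compact_resolvent D A"
    and "is_exp_semigroup D A T"
    and "\<Lambda> = (\<lambda>x. A x + a *\<^sub>R x)"
    and "\<forall>z\<in>spectrum D \<Lambda>. Re z > 0"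
    and "0 \<le> r"
    and "0 \<le> \<alpha>" and "\<alpha> < 1"
    and "hist_continuous r D \<Lambda> \<alpha> F"
    and "L > 0"
    and "\<forall>p. \<forall>\<phi>\<in>hist_space r D \<Lambda> \<alpha>. \<forall>\<phi>'\<in>hist_space r D \<Lambda> \<alpha>.
           norm (F p \<phi> - F p \<phi>') \<le> L * hist_norm r D \<Lambda> \<alpha> (\<lambda>s. \<phi> s - \<phi>' s)"
    and "\<beta> > 0"
    and "\<forall>z\<in>spectrum D A. Re z \<ge> \<beta>"
    and "M \<ge> 1"
    and "semigroup_bounds D \<Lambda> \<alpha> T \<beta> M"
    and "L < 1 / (kappa0 \<alpha> \<beta> * M * (1 + M))"
  shows "\<exists>\<Gamma>. equilibrium_solution r D \<Lambda> \<alpha> T \<theta> F \<Gamma> \<and>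
           (\<exists>C>0. \<exists>\<omega>>0. \<forall>p. \<forall>\<phi>\<in>hist_space r D \<Lambda> \<alpha>. \<forall>u.
              mild_solution r D \<Lambda> \<alpha> T \<theta> F p \<phi> u \<longrightarrow>
              (\<forall>t\<ge>0. frac_norm D \<Lambda> \<alpha> (u t - \<Gamma> (\<theta> t p))
                 \<le> C * exp (- \<omega> * t) *
                    (SUP s\<in>{-r..0}. frac_norm D \<Lambda> \<alpha> (\<phi> s - \<Gamma> (\<theta> s p)))))"
proof -
  define R where "R = neg_power D \<Lambda> \<alpha>"
  obtain K where "positive_operator D \<Lambda> K"
    using sectorial_imp_positive_operator[OF \<open>sectorial D A\<close> \<open>\<Lambda> = _\<close> \<open>\<forall>z\<in>spectrum D \<Lambda>. Re z > 0\<close>] .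
  then interpret po: positive_operator D \<Lambda> K .
  have \<alpha>: "0 \<le> \<alpha>" "\<alpha> < 1" by fact+
  have blR: "bounded_linear R" and injR: "inj R"
    unfolding R_def by (intro po.bounded_linear_neg_power po.inj_neg_power \<alpha>)+
  have linR: "linear R" using blR by (rule bounded_linear.linear)
  note frac = linR[unfolded R_def] injR[unfolded R_def]
  have T: "is_exp_semigroup D A T" by fact
  have blT: "bounded_linear (T t)" if "0 \<le> t" for t using T that unfolding is_exp_semigroup_def by blast
  interpret smoothing_semigroup R T \<alpha> \<beta> M
  proof (rule smoothing_semigroup.intro)
    show "T t (R x) = R (T t x)" if "0 \<le> t" for t x
      unfolding R_def
    proof (rule po.neg_power_commute[OF \<alpha> blT[OF that]])
      fix y assume "y \<in> D"
      from exp_semigroup_generator_commute[OF T that this]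
      show "T t y \<in> D \<and> \<Lambda> (T t y) = T t (\<Lambda> y)"
        unfolding \<open>\<Lambda> = _\<close> using blT[OF that] by (simp add: linear_add linear_scale bounded_linear.linear)
    qed
    show "T t x \<in> range R" "norm (inv R (T t (R x))) \<le> M * exp (- \<beta> * t) * norm x"
      "norm (inv R (T t x)) \<le> M * t powr (- \<alpha>) * exp (- \<beta> * t) * norm x" if "0 < t" for t x
      using \<open>semigroup_bounds D \<Lambda> \<alpha> T \<beta> M\<close> that
      unfolding semigroup_bounds_def frac_space_def frac_power_def R_def by blast+
  qed (use blR injR blT T \<alpha> \<open>\<beta> > 0\<close> \<open>M \<ge> 1\<close> in \<open>auto simp: is_exp_semigroup_def\<close>)
  \<comment> \<open>The restriction makes the argument extensional, so that it belongs to the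
    history space where \<open>F\<close> is controlled.\<close>
  define G where "G p \<phi> = F p (\<lambda>\<sigma>\<in>{-r..0}. R (\<phi> \<sigma>))" for p \<phi>
  interpret retarded_equation R T \<alpha> \<beta> M \<theta> G r L
  proof
    show "norm (G p \<phi> - G p \<psi>) \<le> L * d"
      if "continuous_on {-r..0} \<phi>" "continuous_on {-r..0} \<psi>"
        "\<And>\<sigma>. \<sigma> \<in> {-r..0} \<Longrightarrow> norm (\<phi> \<sigma> - \<psi> \<sigma>) \<le> d" for p \<phi> \<psi> d
    proof -
      have "norm (G p \<phi> - G p \<psi>) \<le> L * hist_norm r D \<Lambda> \<alpha> (\<lambda>s. (\<lambda>\<sigma>\<in>{-r..0}. R (\<phi> \<sigma>)) s - (\<lambda>\<sigma>\<in>{-r..0}. R (\<psi> \<sigma>)) s)"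
        unfolding G_def using assms(14) restrict_mem_hist_space[OF frac] that(1,2) unfolding R_def by blast
      also have "\<dots> \<le> L * d"
        unfolding R_def using \<open>L > 0\<close> by (intro mult_left_mono hist_norm_restrict_le[OF frac \<open>0 \<le> r\<close>] that) auto
      finally show ?thesis .
    qed
    show "\<exists>\<delta>>0. \<forall>q \<psi>. continuous_on {-r..0} \<psi> \<longrightarrow> dist q p < \<delta> \<longrightarrow>
          (\<forall>\<sigma>\<in>{-r..0}. norm (\<psi> \<sigma> - \<phi> \<sigma>) \<le> \<delta>) \<longrightarrow> dist (G q \<psi>) (G p \<phi>) < e"
      if \<phi>: "continuous_on {-r..0} \<phi>" and "0 < e" for \<phi> e p
    proof -
      have "\<exists>\<delta>>0. \<forall>q. \<forall>\<psi>\<in>hist_space r D \<Lambda> \<alpha>.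
          dist q p < \<delta> \<and> hist_norm r D \<Lambda> \<alpha> (\<lambda>s. \<psi> s - (\<lambda>\<sigma>\<in>{-r..0}. R (\<phi> \<sigma>)) s) < \<delta> \<longrightarrow> dist (F q \<psi>) (G p \<phi>) < e"
        using \<open>hist_continuous r D \<Lambda> \<alpha> F\<close> restrict_mem_hist_space[OF frac \<phi>] \<open>0 < e\<close>
        unfolding hist_continuous_def R_def G_def by blast
      then obtain \<delta> where \<delta>: "0 < \<delta>" "\<forall>q. \<forall>\<psi>\<in>hist_space r D \<Lambda> \<alpha>.
          dist q p < \<delta> \<and> hist_norm r D \<Lambda> \<alpha> (\<lambda>s. \<psi> s - (\<lambda>\<sigma>\<in>{-r..0}. R (\<phi> \<sigma>)) s) < \<delta> \<longrightarrow> dist (F q \<psi>) (G p \<phi>) < e"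
        by blast
      \<comment> \<open>Half of \<open>\<delta>\<close>, since the pointwise bound gives a supremum
        that is at most, not below, the bound.\<close>
      have "dist (G q \<psi>) (G p \<phi>) < e"
        if \<psi>: "continuous_on {-r..0} \<psi>" "dist q p < \<delta> / 2" "\<forall>\<sigma>\<in>{-r..0}. norm (\<psi> \<sigma> - \<phi> \<sigma>) \<le> \<delta> / 2" for q \<psi>
      proof -
        have "hist_norm r D \<Lambda> \<alpha> (\<lambda>s. (\<lambda>\<sigma>\<in>{-r..0}. R (\<psi> \<sigma>)) s - (\<lambda>\<sigma>\<in>{-r..0}. R (\<phi> \<sigma>)) s) \<le> \<delta> / 2"
          unfolding R_def using \<psi>(3) by (intro hist_norm_restrict_le[OF frac \<open>0 \<le> r\<close>]) auto
        then have "hist_norm r D \<Lambda> \<alpha> (\<lambda>s. (\<lambda>\<sigma>\<in>{-r..0}. R (\<psi> \<sigma>)) s - (\<lambda>\<sigma>\<in>{-r..0}. R (\<phi> \<sigma>)) s) < \<delta>"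
          using \<delta>(1) by linarith
        moreover have "dist q p < \<delta>" using \<psi>(2) \<delta>(1) by linarith
        moreover have "(\<lambda>\<sigma>\<in>{-r..0}. R (\<psi> \<sigma>)) \<in> hist_space r D \<Lambda> \<alpha>"
          unfolding R_def by (rule restrict_mem_hist_space[OF frac \<psi>(1)])
        ultimately show ?thesis using \<delta>(2) unfolding G_def by blast
      qed
      then show ?thesis using \<delta>(1) by (intro exI[of _ "\<delta> / 2"]) auto
    qed
    have \<kappa>: "0 < \<kappa> \<beta>" "\<kappa> \<beta> \<le> kappa0 \<alpha> \<beta>"
      by (intro kernel_mass_pos kernel_mass_le_kappa0 \<alpha> \<open>\<beta> > 0\<close>)+
    then have pos: "0 < kappa0 \<alpha> \<beta> * M * (1 + M)" using \<open>M \<ge> 1\<close> by (intro mult_pos_pos) auto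
    have "M * L * \<kappa> \<beta> = L * (\<kappa> \<beta> * M * 1)" by simp
    also have "\<dots> \<le> L * (kappa0 \<alpha> \<beta> * M * (1 + M))"
      using \<kappa> \<open>M \<ge> 1\<close> \<open>L > 0\<close> by (intro mult_left_mono mult_mono) auto
    also have "\<dots> < 1"
      using \<open>L < 1 / _\<close> pos by (simp only: pos_less_divide_eq)
    finally show "M * L * \<kappa> \<beta> < 1" .
  qed fact+
  obtain g where g: "continuous_on UNIV g" "\<And>p. V g p = g p" using equilibrium_exists that by blast
  define \<Gamma> where "\<Gamma> p = R (g p)" for p
  have F_\<Gamma>: "F (\<theta> s p) (lift r (\<lambda>t. \<Gamma> (\<theta> t p)) s) = \<Phi> g (\<theta> s p)" for s p
    unfolding \<Phi>_def G_def lift_def \<Gamma>_def by (simp add: add.commute flip: \<theta>_add)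
  have "equilibrium_solution r D \<Lambda> \<alpha> T \<theta> F \<Gamma>"
    unfolding equilibrium_solution_def
  proof (intro conjI allI)
    show "frac_continuous_on D \<Lambda> \<alpha> UNIV \<Gamma>"
      by (rule frac_continuous_onI[OF frac g(1)]) (simp add: \<Gamma>_def R_def)
    fix p
    have "bounded (range g)"
      by (intro compact_imp_bounded compact_continuous_image g(1) compact_base)
    then obtain B where "\<forall>y\<in>range g. norm y \<le> B" unfolding bounded_iff ..
    then show "\<exists>B. \<forall>t. frac_norm D \<Lambda> \<alpha> (\<Gamma> (\<theta> t p)) \<le> B"
      unfolding \<Gamma>_def R_def by (intro exI[of _ B]) (simp add: frac_norm_neg_power[OF frac])
    show "complete_solution r D \<Lambda> \<alpha> T \<theta> F p (\<lambda>t. \<Gamma> (\<theta> t p))"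
      unfolding complete_solution_def F_\<Gamma>
    proof (intro conjI allI impI)
      show "frac_continuous_on D \<Lambda> \<alpha> UNIV (\<lambda>t. \<Gamma> (\<theta> t p))"
        by (rule frac_continuous_onI[OF frac continuous_orbit[OF g(1)]]) (simp add: \<Gamma>_def R_def)
      fix \<tau> t :: real assume "\<tau> \<le> t"
      then have d: "0 \<le> t - \<tau>" by simp
      have "\<Gamma> (\<theta> t p) = R (T (t - \<tau>) (g (\<theta> \<tau> p))) + R (integral {0..t - \<tau>} (\<lambda>s. S s (\<Phi> g (\<theta> (t - s) p))))"
        unfolding \<Gamma>_def using equilibrium_variation[OF g d, of \<tau> p] by (simp add: linear_add[OF linR])
      also have "R (T (t - \<tau>) (g (\<theta> \<tau> p))) = T (t - \<tau>) (\<Gamma> (\<theta> \<tau> p))"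
        unfolding \<Gamma>_def by (simp add: T_R[OF d])
      also have "R (integral {0..t - \<tau>} (\<lambda>s. S s (\<Phi> g (\<theta> (t - s) p)))) = integral {\<tau>..t} (\<lambda>s. T (t - s) (\<Phi> g (\<theta> s p)))"
        by (rule convolution_eq[symmetric]) (intro continuous_\<Phi>_orbit[OF g(1)] continuous_intros)
      finally show "\<Gamma> (\<theta> t p) = T (t - \<tau>) (\<Gamma> (\<theta> \<tau> p)) + integral {\<tau>..t} (\<lambda>s. T (t - s) (\<Phi> g (\<theta> s p)))" .
    qed
  qed
  moreover obtain \<omega> where \<omega>: "0 < \<omega>" "\<omega> < \<beta>" and \<rho>: "M * L * exp (\<omega> * r) * \<kappa> (\<beta> - \<omega>) < 1"
    by (rule decay_rate_exists)
  define C where "C = M / (1 - M * L * exp (\<omega> * r) * \<kappa> (\<beta> - \<omega>))"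
  have "0 < C" unfolding C_def using \<rho> \<open>M \<ge> 1\<close> by simp
  moreover have "frac_norm D \<Lambda> \<alpha> (u t - \<Gamma> (\<theta> t p)) \<le> C * exp (- \<omega> * t) * (SUP s\<in>{-r..0}. frac_norm D \<Lambda> \<alpha> (\<phi> s - \<Gamma> (\<theta> s p)))"
    if mild: "mild_solution r D \<Lambda> \<alpha> T \<theta> F p \<phi> u" and "0 \<le> t" for p \<phi> u t
  proof -
    \<comment> \<open>The coordinate of \<open>u\<close>. Applying \<open>R\<close> to it recovers
      \<open>u\<close> on the whole half line from \<open>-r\<close>, and injectivity of
      \<open>R\<close> will cancel it from the integral equation.\<close>
    define v where "v s = frac_power D \<Lambda> \<alpha> (u s)" for s
    have uc: "frac_continuous_on D \<Lambda> \<alpha> {-r..} u" using mild unfolding mild_solution_def by blast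
    have vc: "continuous_on {-r..} v" unfolding v_def by (rule frac_continuous_onD(2)[OF frac uc])
    have Rv: "R (v s) = u s" if "-r \<le> s" for s
      unfolding v_def R_def by (rule frac_continuous_onD(1)[OF frac uc]) (use that in simp)
    have u_\<phi>: "u s = \<phi> s" if "s \<in> {-r..0}" for s using mild that unfolding mild_solution_def by blast
    have diff: "frac_norm D \<Lambda> \<alpha> (u s - \<Gamma> (\<theta> s p)) = norm (v s - g (\<theta> s p))" if "-r \<le> s" for s
      using Rv[OF that] frac_norm_neg_power_diff[OF frac] unfolding \<Gamma>_def R_def by metis
    have F_u: "F (\<theta> s p) (lift r u s) = G (\<theta> s p) (\<lambda>\<sigma>. v (s + \<sigma>))" if "0 \<le> s" for s
      unfolding G_def lift_def using that by (intro arg_cong[of _ _ "F (\<theta> s p)"] restrict_ext) (simp add: Rv)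
    have v_eq: "v t = T t (v 0) + integral {0..t} (\<lambda>s. S s (G (\<theta> (t - s) p) (\<lambda>\<sigma>. v (t - s + \<sigma>))))" if t: "0 \<le> t" for t
    proof -
      have "R (v t) = T t (\<phi> 0) + integral {0..t} (\<lambda>s. T (t - s) (F (\<theta> s p) (lift r u s)))"
        using mild t Rv[of t] \<open>0 \<le> r\<close> unfolding mild_solution_def by simp
      also have "\<phi> 0 = R (v 0)" using Rv[of 0] u_\<phi>[of 0] \<open>0 \<le> r\<close> by simp
      also have "T t (R (v 0)) = R (T t (v 0))" by (rule T_R[OF t])
      also have "integral {0..t} (\<lambda>s. T (t - s) (F (\<theta> s p) (lift r u s))) =
          integral {0..t} (\<lambda>s. T (t - s) (G (\<theta> s p) (\<lambda>\<sigma>. v (s + \<sigma>))))"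
        by (rule integral_cong) (simp add: F_u)
      also have "\<dots> = R (integral {0..t - 0} (\<lambda>s. S s (G (\<theta> (t - s) p) (\<lambda>\<sigma>. v (t - s + \<sigma>)))))"
        by (rule convolution_eq) (rule continuous_on_subset[OF continuous_on_G_history[OF vc]], simp)
      finally have "R (v t) = R (T t (v 0) + integral {0..t} (\<lambda>s. S s (G (\<theta> (t - s) p) (\<lambda>\<sigma>. v (t - s + \<sigma>)))))"
        by (simp add: linear_add[OF linR])
      then show ?thesis using injR by (rule injD[rotated])
    qed
    have "norm (v s - g (\<theta> s p)) \<le> (SUP s\<in>{-r..0}. frac_norm D \<Lambda> \<alpha> (\<phi> s - \<Gamma> (\<theta> s p)))" if s: "s \<in> {-r..0}" for s
    proof -
      have eq: "norm (v s - g (\<theta> s p)) = frac_norm D \<Lambda> \<alpha> (\<phi> s - \<Gamma> (\<theta> s p))" if "s \<in> {-r..0}" for s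
        using diff[of s] u_\<phi>[OF that] that by simp
      \<comment> \<open>Continuity on the compact interval bounds the set of distances, so each of
        them lies below the supremum in the claim.\<close>
      have "compact ((\<lambda>s. norm (v s - g (\<theta> s p))) ` {-r..0})"
        by (intro compact_continuous_image continuous_intros continuous_on_subset[OF vc] continuous_orbit[OF g(1)]) auto
      then have "bdd_above ((\<lambda>s. norm (v s - g (\<theta> s p))) ` {-r..0})"
        by (intro bounded_imp_bdd_above compact_imp_bounded)
      also have "(\<lambda>s. norm (v s - g (\<theta> s p))) ` {-r..0} = (\<lambda>s. frac_norm D \<Lambda> \<alpha> (\<phi> s - \<Gamma> (\<theta> s p))) ` {-r..0}"
        by (rule image_cong[OF refl eq])
      finally show ?thesis unfolding eq[OF s] by (rule cSUP_upper[OF s])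
    qed
    from exponential_stability[OF g vc v_eq \<omega> \<rho> this \<open>0 \<le> t\<close>]
    show ?thesis unfolding C_def using diff[of t] \<open>0 \<le> t\<close> \<open>0 \<le> r\<close> by simp
  qed
  ultimately show ?thesis using \<omega>(1) by blast
qed

end
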